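(* Every triangulation of a connected closed $2$-dimensional surface admits a $z$-knotted shredding.
   Context: Let $M$ be a connected closed $2$-dimensional surface (not necessarily orientable). We consider connected simple finite graphs $\Gamma$ embedded in $M$ (vertices are points, edges are arcs homeomorphic to closed segments, two distinct edges are disjoint or meet in a common vertex) such that: every face (closure of a connected component of $M\setminus\Gamma$) is homeomorphic to a closed $2$-disc; every edge lies in exactly two distinct faces; and two distinct faces intersect in an edge, in a vertex, or not at all. Such a $\Gamma$ is a triangulation of $M$ if every face contains exactly three edges. Two distinct edges are adjacent if they share a vertex and lie in a common face. A zigzag is a sequence of edges $(e_i)_{i\in\mathbb N}$ such that for every $i$, $e_i,e_{i+1}$ are adjacent, and the face containing $e_i,e_{i+1}$ is distinct from the face containing $e_{i+1},e_{i+2}$; since the graph is finite the sequence is periodic and is regarded as a cyclic sequence (up to shift). The reversed sequence $Z^{-1}$ of a zigzag $Z$ is again a zigzag. $\Gamma$ is $z$-knotted if it has exactly one pair of zigzags $\{Z,Z^{-1}\}$. Connected sum: if $\Gamma,\Gamma'$ are triangulations of surfaces $M,M'$ with faces $F,F'$, a special homeomorphism $g:\partial F\to\partial F'$ is a homeomorphism sending vertices of $F$ to vertices of $F'$; the connected sum $\Gamma\#_g\Gamma'$ is the triangulation of $M\# M'$ obtained by removing the interiors of $F$ and $F'$ and gluing along $g$, i.e. its vertex set is the union of the vertex sets with each vertex $v$ of $F$ identified with $g(v)$, and its edge set is the union of the edge sets with each edge of $F$ identified with the corresponding edge of $F'$. A triangulation $\Gamma_2$ is a shredding of a triangulation $\Gamma_1$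 (of the same surface) if $\Gamma_2$ can be presented as the connected sum of $\Gamma_1$ and some triangulations of the sphere $\mathbb S^2$.
   Formalization: A zigzag is additionally required to have e_i and e_{i+2} disjoint for every i (the usual left-right condition); without this, going round a vertex would also be a zigzag, periodicity would fail, and no triangulation would be z-knotted. *)

theory Defs
  imports "HOL-Analysis.Analysis"
begin

section \<open>Closed surfaces and embedded graphs\<close>

text \<open>Second countability is not listed: a compact locally Euclidean space has it.
  Connectedness does not exclude the empty space in the library, so that is done separately.\<close>

definition closed_surface :: "'a topology \<Rightarrow> bool" where
  "closed_surface M \<longleftrightarrow>
     topspace M \<noteq> {} \<and> connected_space M \<and> compact_space M \<and> Hausdorff_space M \<and>
     (\<forall>x\<in>topspace M. \<exists>U. openin M U \<and> x \<in> U \<and>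
        subtopology M U homeomorphic_space (euclidean :: (real^2) topology))"

text \<open>A graph drawn in a space is given by its set of vertices (points) and its set of edges,
  each edge being the point set of a closed arc that contains its two end points.\<close>

record 'a drawn_graph =
  vertices :: "'a set"
  edges :: "'a set set"

definition arc_joining :: "'a topology \<Rightarrow> 'a \<Rightarrow> 'a \<Rightarrow> 'a set \<Rightarrow> bool" where
  "arc_joining M u v e \<longleftrightarrow>
     (\<exists>p. embedding_map (top_of_set {0..1::real}) M p \<and> p ` {0..1} = e \<and> p 0 = u \<and> p 1 = v)"

text \<open>Simplicity is part of this definition: an arc has two different end points, so there are no
  loops, and two distinct edges share at most one point, so there are no multiple edges.\<close>

definition embedded_simple_graph :: "'a topology \<Rightarrow> 'a drawn_graph \<Rightarrow> bool" where
  "embedded_simple_graph M \<Gamma> \<longleftrightarrow>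
     finite (vertices \<Gamma>) \<and> vertices \<Gamma> \<subseteq> topspace M \<and> finite (edges \<Gamma>) \<and>
     (\<forall>e\<in>edges \<Gamma>. \<exists>u\<in>vertices \<Gamma>. \<exists>v\<in>vertices \<Gamma>.
        arc_joining M u v e \<and> e \<inter> vertices \<Gamma> = {u, v}) \<and>
     (\<forall>e\<in>edges \<Gamma>. \<forall>f\<in>edges \<Gamma>. e \<noteq> f \<longrightarrow>
        e \<inter> f = {} \<or> (\<exists>v\<in>vertices \<Gamma>. e \<inter> f = {v}))"

definition joined :: "'a topology \<Rightarrow> 'a drawn_graph \<Rightarrow> 'a \<Rightarrow> 'a \<Rightarrow> bool" where
  "joined M \<Gamma> u v \<longleftrightarrow> (\<exists>e\<in>edges \<Gamma>. arc_joining M u v e)"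

definition connected_graph :: "'a topology \<Rightarrow> 'a drawn_graph \<Rightarrow> bool" where
  "connected_graph M \<Gamma> \<longleftrightarrow>
     (\<forall>u\<in>vertices \<Gamma>. \<forall>v\<in>vertices \<Gamma>. (joined M \<Gamma>)\<^sup>*\<^sup>* u v)"

definition skeleton :: "'a drawn_graph \<Rightarrow> 'a set" where
  "skeleton \<Gamma> = vertices \<Gamma> \<union> \<Union>(edges \<Gamma>)"

definition faces :: "'a topology \<Rightarrow> 'a drawn_graph \<Rightarrow> 'a set set" where
  "faces M \<Gamma> =
     (\<lambda>C. M closure_of C) ` connected_components_of (subtopology M (topspace M - skeleton \<Gamma>))"

definition surface_graph :: "'a topology \<Rightarrow> 'a drawn_graph \<Rightarrow> bool" where
  "surface_graph M \<Gamma> \<longleftrightarrow>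
     embedded_simple_graph M \<Gamma> \<and> connected_graph M \<Gamma> \<and>
     (\<forall>F\<in>faces M \<Gamma>. subtopology M F homeomorphic_space top_of_set (cball (0::real^2) 1)) \<and>
     (\<forall>e\<in>edges \<Gamma>. card {F \<in> faces M \<Gamma>. e \<subseteq> F} = 2) \<and>
     (\<forall>F\<in>faces M \<Gamma>. \<forall>G\<in>faces M \<Gamma>. F \<noteq> G \<longrightarrow>
        F \<inter> G \<in> edges \<Gamma> \<or> (\<exists>v\<in>vertices \<Gamma>. F \<inter> G = {v}) \<or> F \<inter> G = {})"

definition surface_triangulation :: "'a topology \<Rightarrow> 'a drawn_graph \<Rightarrow> bool" where
  "surface_triangulation M \<Gamma> \<longleftrightarrow>
     surface_graph M \<Gamma> \<and> (\<forall>F\<in>faces M \<Gamma>. card {e \<in> edges \<Gamma>. e \<subseteq> F} = 3)"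


section \<open>Zigzags\<close>

definition adjacent_edges :: "'a topology \<Rightarrow> 'a drawn_graph \<Rightarrow> 'a set \<Rightarrow> 'a set \<Rightarrow> bool" where
  "adjacent_edges M \<Gamma> e f \<longleftrightarrow>
     e \<in> edges \<Gamma> \<and> f \<in> edges \<Gamma> \<and> e \<noteq> f \<and> (\<exists>v\<in>vertices \<Gamma>. v \<in> e \<and> v \<in> f) \<and>
     (\<exists>F\<in>faces M \<Gamma>. e \<subseteq> F \<and> f \<subseteq> F)"

text \<open>The face containing two adjacent edges is unique, because distinct faces have at most one
  edge in common; the quantification over faces in the second condition therefore just
  compares two well-determined faces. The third condition is the usual part of the notion of a
  zigzag (or Petrie walk) that makes it turn left and right alternately. It forbids going round a
  vertex; without it a sequence would not be determined by two consecutive edges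
  and need not be periodic.\<close>

definition zigzag :: "'a topology \<Rightarrow> 'a drawn_graph \<Rightarrow> (nat \<Rightarrow> 'a set) \<Rightarrow> bool" where
  "zigzag M \<Gamma> Z \<longleftrightarrow>
     (\<forall>i. adjacent_edges M \<Gamma> (Z i) (Z (i + 1))) \<and>
     (\<forall>i. \<forall>F\<in>faces M \<Gamma>. \<forall>G\<in>faces M \<Gamma>.
        Z i \<subseteq> F \<and> Z (i + 1) \<subseteq> F \<and> Z (i + 1) \<subseteq> G \<and> Z (i + 2) \<subseteq> G \<longrightarrow> F \<noteq> G) \<and>
     (\<forall>i. Z i \<inter> Z (i + 2) = {})"

definition period :: "(nat \<Rightarrow> 'b) \<Rightarrow> nat" where
  "period Z = (LEAST n. 0 < n \<and> (\<forall>i. Z (i + n) = Z i))"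

text \<open>Both definitions below are meant for periodic sequences. For these, being a shift
  is an equivalence relation and \<open>cyclic_class Z\<close> is the class of \<open>Z\<close>.\<close>

definition reverse_seq :: "(nat \<Rightarrow> 'b) \<Rightarrow> nat \<Rightarrow> 'b" where
  "reverse_seq Z i = Z (period Z - 1 - i mod period Z)"

definition cyclic_class :: "(nat \<Rightarrow> 'b) \<Rightarrow> (nat \<Rightarrow> 'b) set" where
  "cyclic_class Z = {\<lambda>i. Z (i + k) | k. True}"

definition cyclic_zigzags :: "'a topology \<Rightarrow> 'a drawn_graph \<Rightarrow> (nat \<Rightarrow> 'a set) set set" where
  "cyclic_zigzags M \<Gamma> = {cyclic_class Z | Z. zigzag M \<Gamma> Z}"

definition z_knotted :: "'a topology \<Rightarrow> 'a drawn_graph \<Rightarrow> bool" where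
  "z_knotted M \<Gamma> \<longleftrightarrow>
     (\<exists>Z. zigzag M \<Gamma> Z \<and> cyclic_zigzags M \<Gamma> = {cyclic_class Z, cyclic_class (reverse_seq Z)})"


section \<open>Connected sums and shreddings\<close>

text \<open>Here \<open>F\<close> and \<open>G\<close> are faces, and the frontier of a face is its boundary circle.\<close>

definition special_homeomorphism ::
  "'a topology \<Rightarrow> 'a drawn_graph \<Rightarrow> 'a set \<Rightarrow> 'b topology \<Rightarrow> 'b drawn_graph \<Rightarrow> 'b set
    \<Rightarrow> ('a \<Rightarrow> 'b) \<Rightarrow> bool" where
  "special_homeomorphism M \<Gamma> F N \<Delta> G g \<longleftrightarrow>
     homeomorphic_map (subtopology M (M frontier_of F)) (subtopology N (N frontier_of G)) g \<and>
     g ` (vertices \<Gamma> \<inter> F) = vertices \<Delta> \<inter> G"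

text \<open>The space \<open>P\<close> with the graph \<open>\<Theta>\<close> is, up to homeomorphism, the result of gluing \<open>M\<close> minus the
  interior of \<open>F\<close> and \<open>N\<close> minus the interior of \<open>G\<close> along \<open>g\<close>: \<open>\<phi>\<close> and \<open>\<psi>\<close> are the
  inclusions of the two pieces. As the pieces are compact, for a Hausdorff space \<open>P\<close> these
  conditions force its topology to be the quotient topology.\<close>

definition is_connected_sum ::
  "'a topology \<Rightarrow> 'a drawn_graph \<Rightarrow> 'a set \<Rightarrow> 'b topology \<Rightarrow> 'b drawn_graph \<Rightarrow> 'b set
    \<Rightarrow> ('a \<Rightarrow> 'b) \<Rightarrow> 'c topology \<Rightarrow> 'c drawn_graph \<Rightarrow> bool" where
  "is_connected_sum M \<Gamma> F N \<Delta> G g P \<Theta> \<longleftrightarrow>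
     (\<exists>\<phi> \<psi>.
        embedding_map (subtopology M (topspace M - M interior_of F)) P \<phi> \<and>
        embedding_map (subtopology N (topspace N - N interior_of G)) P \<psi> \<and>
        \<phi> ` (topspace M - M interior_of F) \<union> \<psi> ` (topspace N - N interior_of G) = topspace P \<and>
        \<phi> ` (topspace M - M interior_of F) \<inter> \<psi> ` (topspace N - N interior_of G)
          = \<phi> ` (M frontier_of F) \<and>
        (\<forall>x\<in>M frontier_of F. \<phi> x = \<psi> (g x)) \<and>
        vertices \<Theta> = \<phi> ` vertices \<Gamma> \<union> \<psi> ` vertices \<Delta> \<and>
        edges \<Theta> = (\<lambda>e. \<phi> ` e) ` edges \<Gamma> \<union> (\<lambda>e. \<psi> ` e) ` edges \<Delta>)"

abbreviation two_sphere :: "(real^3) topology" where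
  "two_sphere \<equiv> top_of_set (sphere 0 1)"

text \<open>One connected sum with a triangulation of the sphere. It is again a triangulation of the same
  surface, so the result is taken to live on \<open>M\<close> itself.\<close>

definition sphere_sum_step :: "'a topology \<Rightarrow> 'a drawn_graph \<Rightarrow> 'a drawn_graph \<Rightarrow> bool" where
  "sphere_sum_step M \<Gamma> \<Theta> \<longleftrightarrow>
     (\<exists>\<Delta> F G g. surface_triangulation two_sphere \<Delta> \<and> F \<in> faces M \<Gamma> \<and> G \<in> faces two_sphere \<Delta> \<and>
        special_homeomorphism M \<Gamma> F two_sphere \<Delta> G g \<and>
        is_connected_sum M \<Gamma> F two_sphere \<Delta> G g M \<Theta>)"

text \<open>At least one sphere is attached; this implies the version that also admits none.\<close>

definition shredding :: "'a topology \<Rightarrow> 'a drawn_graph \<Rightarrow> 'a drawn_graph \<Rightarrow> bool" where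
  "shredding M \<Gamma>\<^sub>2 \<Gamma>\<^sub>1 \<longleftrightarrow>
     surface_triangulation M \<Gamma>\<^sub>1 \<and> surface_triangulation M \<Gamma>\<^sub>2 \<and> (sphere_sum_step M)\<^sup>+\<^sup>+ \<Gamma>\<^sub>1 \<Gamma>\<^sub>2"

end

theory Submission
  imports Defs
begin

text \<open>
  Write a zigzag as a walk \<open>v\<^sub>0, v\<^sub>1, v\<^sub>2, \<dots>\<close> on vertices in which any three consecutive vertices
  span a face. These triples (flags) are permuted by a shift \<open>\<sigma>\<close>, reversal conjugates \<open>\<sigma>\<close> to its
  inverse, and the triangulation is \<open>z\<close>-knotted if and only if \<open>\<sigma>\<close> and reversal act transitively on
  flags. It suffices to take connected sums with tetrahedra, that is, to place a new vertex \<open>x\<close> in a face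
  \<open>abc\<close> and to join it to \<open>a\<close>, \<open>b\<close>, \<open>c\<close>.

  If there are several zigzags, then by connectedness of the surface minus its vertices some face
  \<open>abc\<close> meets at least two of them. It is crossed by three strands, one for each
  middle vertex, and starring the face replaces the rotation that connects entries to exits by its
  inverse. Say that the strand at \<open>b\<close> closes up on its own. If the other two
  strands close up separately, or join so that the first returns as \<open>bca\<close> after leaving as \<open>bac\<close>,
  then one starring merges all three. In the remaining case, a second vertex placed in \<open>xab\<close> does.
  In either case all other zigzags are unchanged, so the number of zigzags drops.

  Topologically, a face is an embedded disc, and invariance of domain shows that its interior is a
  component of the complement of the graph. The new edges are radii of the disc, and the
  new faces are cones over the edges of its boundary. The tetrahedron is drawn on the sphere with
  the same cone picture in the lower hemisphere, so that vertical projection is the gluing map.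
\<close>

section \<open>Cones over circle arcs\<close>

text \<open>Each of the six flags \<open>f\<close> of a face \<open>t\<close> has an exit
  \<open>zstep T f\<close>. Up to reversal, the zigzags through \<open>t\<close> are the cycles
  formed by two perfect matchings of these exits: an outer one given by the returns to
  \<open>t\<close>, and an inner one, which in \<open>T\<close> joins the exits of \<open>f\<close>
  and \<open>flip f\<close>. A vertex put into \<open>t\<close> changes the inner matching to the
  one joining the exits of \<open>(w,v,u)\<close> and \<open>(v,w,u)\<close>. The aim is a single
  hexagon. In the remaining case one vertex yields a 4-cycle and a 2-cycle, again two zigzags; with
  the second vertex the strand at \<open>c\<close> gets back its old pairing while the strands at
  \<open>a\<close> and \<open>b\<close> interchange ends, and the hexagon appears. That only three
  outer matchings have to be treated rests on the fact that no zigzag is its own reverse. On the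
  topological side, a face is known only as the closure of a component that happens to be a disc.
  That the component is the open disc, and that its boundary is a triangle of edges, must be
  extracted from the conditions that every edge lies in two faces and that faces meet in an edge, a
  vertex or not at all.\<close>

definition cone :: "'a::real_normed_vector set \<Rightarrow> 'a set" where
  "cone A = {t *\<^sub>R u | t u. 0 \<le> t \<and> t \<le> 1 \<and> u \<in> A}"

text \<open>Apex and base are left out: over the edges of a circle without their end points this
  gives disjoint open subsets of the disc, the future components.\<close>

definition open_cone :: "'a::real_normed_vector set \<Rightarrow> 'a set" where
  "open_cone A = {t *\<^sub>R u | t u. 0 < t \<and> t < 1 \<and> u \<in> A}"

text \<open>Polar coordinates: away from the apex only radius and direction matter, so cones can be
  intersected on the sphere. A nonempty base is what puts 0 into the cone.\<close>

lemma cone_iff: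
  assumes "A \<subseteq> sphere 0 1" "A \<noteq> {}"
  shows "x \<in> cone A \<longleftrightarrow> x = 0 \<or> norm x \<le> 1 \<and> x /\<^sub>R norm x \<in> A"
proof
  assume "x \<in> cone A"
  then obtain t u where "x = t *\<^sub>R u" "0 \<le> t" "t \<le> 1" "u \<in> A" by (auto simp: cone_def)
  moreover have "norm u = 1" using assms \<open>u \<in> A\<close> by auto
  ultimately show "x = 0 \<or> norm x \<le> 1 \<and> x /\<^sub>R norm x \<in> A" by (cases "t = 0") auto
next
  assume x: "x = 0 \<or> norm x \<le> 1 \<and> x /\<^sub>R norm x \<in> A"
  show "x \<in> cone A"
  proof (cases "x = 0")
    case True
    then show ?thesis using assms(2) by (force simp: cone_def)
  next
    case False
    then show ?thesis using x unfolding cone_def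
      by (intro CollectI exI[of _ "norm x"] exI[of _ "x /\<^sub>R norm x"]) auto
  qed
qed

lemma open_cone_iff:
  assumes "A \<subseteq> sphere 0 1"
  shows "x \<in> open_cone A \<longleftrightarrow> x \<noteq> 0 \<and> norm x < 1 \<and> x /\<^sub>R norm x \<in> A"
proof
  assume "x \<in> open_cone A"
  then obtain t u where "x = t *\<^sub>R u" "0 < t" "t < 1" "u \<in> A" by (auto simp: open_cone_def)
  moreover have "norm u = 1" using assms \<open>u \<in> A\<close> by auto
  ultimately show "x \<noteq> 0 \<and> norm x < 1 \<and> x /\<^sub>R norm x \<in> A" by auto
next
  assume x: "x \<noteq> 0 \<and> norm x < 1 \<and> x /\<^sub>R norm x \<in> A"
  then show "x \<in> open_cone A" unfolding open_cone_def
    by (intro CollectI exI[of _ "norm x"] exI[of _ "x /\<^sub>R norm x"]) auto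
qed

lemma cone_Int:
  assumes "A \<subseteq> sphere 0 1" "B \<subseteq> sphere 0 1" "A \<noteq> {}" "B \<noteq> {}"
  shows "cone A \<inter> cone B = (if A \<inter> B = {} then {0} else cone (A \<inter> B))"
proof -
  have "x \<in> cone A \<inter> cone B \<longleftrightarrow> x = 0 \<or> norm x \<le> 1 \<and> x /\<^sub>R norm x \<in> A \<inter> B" for x
    using cone_iff[of A x] cone_iff[of B x] assms by blast
  moreover have "x \<in> cone (A \<inter> B) \<longleftrightarrow> x = 0 \<or> norm x \<le> 1 \<and> x /\<^sub>R norm x \<in> A \<inter> B"
    if "A \<inter> B \<noteq> {}" for x
    using cone_iff[of "A \<inter> B" x] assms(1) that by blast
  ultimately show ?thesis by auto
qed

lemma cone_singleton: "cone {w} = closed_segment 0 w"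
  by (auto simp: cone_def closed_segment_def)

lemma cone_sphere: "x \<in> sphere 0 1 \<Longrightarrow> A \<subseteq> sphere 0 1 \<Longrightarrow> x \<in> cone A \<longleftrightarrow> x \<in> A"
  using cone_iff[of A x] by (cases "A = {}") (auto simp: cone_def)

lemma cone_subset_cball: "A \<subseteq> sphere 0 1 \<Longrightarrow> cone A \<subseteq> cball 0 1"
  using cone_iff[of A] by (cases "A = {}") (auto simp: cone_def)

lemma open_cone_subset_ball: "A \<subseteq> sphere 0 1 \<Longrightarrow> open_cone A \<subseteq> ball 0 1"
  using open_cone_iff[of A] by auto

lemma cone_image: "cone A = (\<lambda>p. fst p *\<^sub>R snd p) ` ({0..1} \<times> A)"
  by (auto simp: cone_def image_iff) (metis atLeastAtMost_iff, blast)

lemma open_cone_image: "open_cone A = (\<lambda>p. fst p *\<^sub>R snd p) ` ({0<..<1} \<times> A)"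
  by (auto simp: open_cone_def image_iff) (metis greaterThanLessThan_iff, blast)

lemma compact_cone:
  assumes "compact A" shows "compact (cone A)"
  unfolding cone_image
  by (intro compact_continuous_image compact_Times assms continuous_intros) auto

lemma connected_open_cone:
  assumes "connected A" shows "connected (open_cone A)"
  unfolding open_cone_image
  by (intro connected_continuous_image connected_Times assms continuous_intros) auto

text \<open>The cone map is continuous, so it sends the closure \<open>{0..1} \<times> B\<close> of
  \<open>{0<..<1} \<times> A\<close> into the closure of the image; compactness of
  \<open>cone B\<close> gives the other inclusion.\<close>

lemma closure_open_cone:
  assumes "compact B" "closure A = B"
  shows "closure (open_cone A) = cone B"
proof
  have "A \<subseteq> B" using assms closure_subset by blast
  then have "open_cone A \<subseteq> cone B" unfolding open_cone_def cone_def by force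
  then show "closure (open_cone A) \<subseteq> cone B"
    using compact_cone[OF assms(1)] compact_imp_closed closure_minimal by blast
  have "cone B = (\<lambda>p. fst p *\<^sub>R snd p) ` closure ({0<..<1::real} \<times> A)"
    unfolding closure_Times assms(2) cone_image by simp
  also have "\<dots> \<subseteq> closure ((\<lambda>p. fst p *\<^sub>R snd p) ` ({0<..<1::real} \<times> A))"
    by (rule image_closure_subset[OF _ closed_closure closure_subset]) (intro continuous_intros)
  finally show "cone B \<subseteq> closure (open_cone A)" by (simp add: open_cone_image)
qed

text \<open>Within the open ball it is the complement of the compact cone over \<open>K\<close>,
  which contains the apex because \<open>K\<close> is nonempty.\<close>

lemma open_open_cone:
  assumes "compact K" "A = sphere 0 1 - K" "K \<subseteq> sphere 0 1" "K \<noteq> {}"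
  shows "open (open_cone (A :: 'a::real_normed_vector set))"
proof -
  have "x \<in> open_cone A \<longleftrightarrow> x \<in> ball 0 1 - cone K" for x
    using open_cone_iff[of A x] cone_iff[of K x] assms(2-4) by auto
  then have "open_cone A = ball 0 1 - cone K" by blast
  then show ?thesis using compact_cone[OF assms(1)] by (simp add: compact_imp_closed open_Diff)
qed

text \<open>Serves as the parameter domain of sectors: a triangle rather than a square, because a
  cone collapses to a point at its apex.\<close>

lemma triangle_homeomorphic_disc:
  "{x::real^2. 0 \<le> x$1 \<and> 0 \<le> x$2 \<and> x$1 + x$2 \<le> 1} homeomorphic cball (0::real^2) 1" (is "?T homeomorphic _")
proof (rule homeomorphic_convex_compact_cball)
  have eq: "?T = {x. 0 \<le> x$1} \<inter> {x. 0 \<le> x$2} \<inter> {x. x$1 + x$2 \<le> 1}" by auto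
  show "convex ?T" unfolding convex_def
  proof (intro ballI allI impI)
    fix x y :: "real^2" and u v :: real
    assume *: "x \<in> ?T" "y \<in> ?T" "0 \<le> u" "0 \<le> v" "u + v = 1"
    have "u * (x$1 + x$2) + v * (y$1 + y$2) \<le> u * 1 + v * 1"
      using * by (intro add_mono mult_left_mono) auto
    then show "u *\<^sub>R x + v *\<^sub>R y \<in> ?T" using * by (auto simp: algebra_simps)
  qed
  have "closed ?T" unfolding eq by (intro closed_Int closed_Collect_le continuous_intros)
  moreover have "?T \<subseteq> cball 0 2"
  proof
    fix x assume "x \<in> ?T"
    then have "norm x \<le> 2" using norm_le_l1_cart[of x] by (simp add: sum_2)
    then show "x \<in> cball 0 2" by simp
  qed
  ultimately show "compact ?T" by (meson bounded_cball bounded_subset compact_eq_bounded_closed)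
  let ?U = "{x::real^2. 0 < x$1} \<inter> {x. 0 < x$2} \<inter> {x. x$1 + x$2 < 1}"
  have "open ?U" by (intro open_Int open_Collect_less continuous_intros)
  moreover have "?U \<subseteq> ?T" by auto
  moreover have "vector [1/3,1/3] \<in> ?U" by simp
  ultimately show "interior ?T \<noteq> {}" using interior_maximal by blast
qed simp

lemma cone_arc_homeomorphic_disc:
  fixes p :: "real \<Rightarrow> real^2"
  assumes p: "arc p" and sph: "path_image p \<subseteq> sphere 0 1"
  shows "cone (path_image p) homeomorphic cball (0::real^2) 1"
proof -
  let ?T = "{x::real^2. 0 \<le> x$1 \<and> 0 \<le> x$2 \<and> x$1 + x$2 \<le> 1}"
  \<comment> \<open>\<open>x$1 + x$2\<close> is the radius and \<open>x$2 / (x$1 + x$2)\<close> the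
    parameter on the arc. At the corner 0 the quotient is 0 by convention and is killed by the
    radius.\<close>
  define f where "f = (\<lambda>x::real^2. (x$1 + x$2) *\<^sub>R p (x$2 / (x$1 + x$2)))"
  have cp: "continuous_on {0..1} p" using p by (simp add: arc_def path_def)
  have injp: "inj_on p {0..1}" using p by (simp add: arc_def)
  have pn: "norm (p s) = 1" if "s \<in> {0..1}" for s using sph that by (auto simp: path_image_def image_subset_iff)
  have quot: "x$2 / (x$1 + x$2) \<in> {0..1}" if "x \<in> ?T" for x using that
    by (auto simp: divide_le_eq_1)
  have nf: "norm (f x) = x$1 + x$2" if "x \<in> ?T" for x
    using pn[OF quot[OF that]] that by (simp add: f_def)
  have z: "x = 0" if "x \<in> ?T" "x$1 + x$2 = 0" for x
    using that by (simp add: vec_eq_iff forall_2)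
  have "continuous_on ?T f"
    unfolding continuous_on_eq_continuous_within
  proof
    fix x assume x: "x \<in> ?T"
    show "continuous (at x within ?T) f"
    proof (cases "x = 0")
      case True
      \<comment> \<open>Continuity at the corner: \<open>norm (f x)\<close> equals the radius, which
        tends to 0.\<close>
      have "((\<lambda>y::real^2. y$1 + y$2) \<longlongrightarrow> (0::real^2)$1 + (0::real^2)$2) (at 0 within ?T)"
        by (intro tendsto_intros)
      then have lim: "((\<lambda>y::real^2. y$1 + y$2) \<longlongrightarrow> 0) (at 0 within ?T)" by simp
      have "(f \<longlongrightarrow> 0) (at 0 within ?T)"
        by (rule Lim_null_comparison[OF _ lim]) (auto simp: eventually_at_filter nf)
      then show ?thesis using True by (simp add: continuous_within f_def)
    next
      case False
      have "continuous_on (?T - {0}) f" unfolding f_def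
        by (intro continuous_intros continuous_on_compose2[OF cp]) (use z quot in auto)
      then have "continuous (at x within (?T - {0})) f"
        using x False by (simp add: continuous_on_eq_continuous_within)
      moreover have "at x within (?T - {0}) = at x within ?T"
        using False by (intro at_within_nhd[of x "- {0}"]) (simp, simp add: open_Compl, blast)
      ultimately show ?thesis by simp
    qed
  qed
  moreover have "inj_on f ?T"
  proof (rule inj_onI)
    fix x y assume x: "x \<in> ?T" and y: "y \<in> ?T" and fxy: "f x = f y"
    then have s: "x$1 + x$2 = y$1 + y$2" using nf[OF x] nf[OF y] by simp
    show "x = y"
    proof (cases "x$1 + x$2 = 0")
      case True
      then show ?thesis using z[OF x] z[OF y] s by simp
    next
      case False
      then have "p (x$2 / (x$1 + x$2)) = p (y$2 / (y$1 + y$2))" using fxy s by (simp add: f_def)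
      then have "x$2 / (x$1 + x$2) = y$2 / (y$1 + y$2)" by (rule inj_onD[OF injp _ quot[OF x] quot[OF y]])
      then have "x$2 = y$2" using s False by simp
      then show ?thesis using s by (simp add: vec_eq_iff forall_2)
    qed
  qed
  moreover have "f ` ?T = cone (path_image p)"
  proof
    show "f ` ?T \<subseteq> cone (path_image p)"
    proof
      fix y assume "y \<in> f ` ?T"
      then obtain x where x: "x \<in> ?T" "y = f x" by blast
      then show "y \<in> cone (path_image p)"
        using quot[of x] unfolding cone_def f_def path_image_def
        by (intro CollectI exI[of _ "x$1 + x$2"] exI[of _ "p (x$2 / (x$1 + x$2))"]) auto
    qed
    show "cone (path_image p) \<subseteq> f ` ?T"
    proof
      fix y assume "y \<in> cone (path_image p)"
      then obtain t s where ts: "y = t *\<^sub>R p s" "0 \<le> t" "t \<le> 1" "0 \<le> s" "s \<le> 1"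
        by (auto simp: cone_def path_image_def)
      \<comment> \<open>The point with radius \<open>t\<close> and arc parameter
        \<open>s\<close>.\<close>
      define x :: "real^2" where "x = vector [t * (1 - s), t * s]"
      have x12: "x$1 = t * (1 - s)" "x$2 = t * s" by (simp_all add: x_def)
      have sum: "x$1 + x$2 = t" by (simp add: x12 algebra_simps)
      have "x \<in> ?T" using ts sum by (simp add: x12)
      moreover have "y = f x" using ts sum by (cases "t = 0") (auto simp: f_def x12 )
      ultimately show "y \<in> f ` ?T" by blast
    qed
  qed
  moreover have "compact ?T"
    using triangle_homeomorphic_disc homeomorphic_compactness compact_cball by blast
  ultimately have "?T homeomorphic cone (path_image p)"
    using homeomorphic_compact by blast
  then show ?thesis using triangle_homeomorphic_disc homeomorphic_sym homeomorphic_trans by blast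
qed

section \<open>Arcs and finite subsets of the circle\<close>

lemma connected_circle_minus_point:
  assumes "v \<in> sphere (0::real^2) 1"
  shows "connected (sphere 0 1 - {v})"
proof -
  have "sphere 0 1 \<inter> UNIV - {v} homeomorphic (UNIV :: real set)"
    by (rule homeomorphic_punctured_affine_sphere_affine_01) (use assms in auto)
  then show ?thesis using homeomorphic_connectedness by (metis connected_UNIV inf_top.right_neutral)
qed

lemma infinite_circle: "infinite (sphere (0::real^2) 1)"
proof -
  have "connected (sphere (0::real^2) 1)" by (rule connected_sphere) simp
  moreover have "axis 1 1 \<in> sphere (0::real^2) 1" "- axis 1 1 \<in> sphere (0::real^2) 1"
    by (simp_all add: norm_axis_1)
  moreover have "(axis 1 1 :: real^2) \<noteq> - axis 1 1"
    by (auto simp: vec_eq_iff axis_def)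
  ultimately show ?thesis using connected_finite_iff_sing by (metis empty_iff singletonD)
qed

text \<open>The circle has no isolated points. An inclusion known on a boundary circle away from the
  vertices can thus be extended to the whole circle by taking closures.\<close>

lemma closure_circle_minus_finite:
  assumes "finite K"
  shows "closure (sphere 0 1 - K) = sphere (0::real^2) 1"
proof
  show "closure (sphere 0 1 - K) \<subseteq> sphere (0::real^2) 1"
    by (rule closure_minimal) auto
  show "sphere (0::real^2) 1 \<subseteq> closure (sphere 0 1 - K)"
  proof
    fix x assume x: "x \<in> sphere (0::real^2) 1"
    have "connected (sphere (0::real^2) 1)" by (rule connected_sphere) simp
    then have "x islimpt sphere 0 1"
      using x infinite_circle connected_imp_perfect by (metis finite.emptyI finite_insert)
    then have "x islimpt (sphere 0 1 - K)"
      using islimpt_finite[OF assms] islimpt_Un[of x "sphere 0 1 - K" K] islimpt_subset[of x "sphere 0 1" "sphere 0 1 - K \<union> K"]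
      by blast
    then show "x \<in> closure (sphere 0 1 - K)" by (simp add: closure_def)
  qed
qed

lemma arc_minus_endpoints:
  assumes "arc p" 
  shows "path_image p - {p 0, p 1} = p ` {0<..<1}"
proof -
  have "p ` {0..1} - p ` {0,1} = p ` ({0..1} - {0,1})"
    using assms by (intro inj_on_image_set_diff[symmetric, of p "{0..1}"]) (auto simp: arc_def)
  moreover have "{0..1::real} - {0,1} = {0<..<1}" by auto
  ultimately show ?thesis by (simp add: path_image_def)
qed

lemma closure_arc_minus_endpoints:
  fixes p :: "real \<Rightarrow> 'a::real_normed_vector"
  assumes "arc p" 
  shows "closure (path_image p - {p 0, p 1}) = path_image p"
proof
  show "closure (path_image p - {p 0, p 1}) \<subseteq> path_image p"
    using closed_arc_image[OF assms] by (intro closure_minimal) auto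
  have "p ` closure {0<..<1} \<subseteq> closure (p ` {0<..<1})"
    by (rule image_closure_subset[OF _ closed_closure closure_subset])
      (use assms in \<open>simp add: arc_def path_def\<close>)
  then show "path_image p \<subseteq> closure (path_image p - {p 0, p 1})"
    unfolding arc_minus_endpoints[OF assms] by (simp add: path_image_def)
qed

lemma connected_arc_minus_endpoints:
  fixes p :: "real \<Rightarrow> 'a::real_normed_vector"
  assumes "arc p" 
  shows "connected (path_image p - {p 0, p 1})"
  unfolding arc_minus_endpoints[OF assms]
  by (rule connected_continuous_image) 
    (use assms in \<open>auto simp: arc_def path_def intro: continuous_on_subset\<close>)

text \<open>Otherwise \<open>A\<close> without \<open>v\<close> would be open and closed in the punctured circle.\<close>

lemma arc_endpoint_shared:
  fixes A :: "(real^2) set"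
  assumes cov: "sphere 0 1 = A \<union> B" and "closed A" "closed B"
    and AB: "A \<inter> B \<subseteq> {u,v}" and u: "u \<in> A" "u \<noteq> v" and v: "v \<in> A" and B: "\<not> B \<subseteq> {v}"
  shows "u \<in> B"
proof (rule ccontr)
  assume "u \<notin> B"
  let ?S = "sphere (0::real^2) 1 - {v}"
  have conn: "connected ?S" using connected_circle_minus_point cov v by blast
  have "?S \<inter> A \<inter> B = {}" using AB \<open>u \<notin> B\<close> by blast
  moreover have "?S \<subseteq> A \<union> B" using cov by blast
  moreover have "A \<inter> ?S \<noteq> {}" "B \<inter> ?S \<noteq> {}" using u B cov by blast+
  ultimately show False using conn assms(2,3) unfolding connected_closed by blast
qed

section \<open>Zigzags of closed triangle complexes\<close>

text \<open>The combinatorial shadow of a triangulated closed surface; the condition on pairs is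
  what makes the continuation of a zigzag unique.\<close>

definition closed_complex :: "'a set set \<Rightarrow> bool" where
  "closed_complex T \<longleftrightarrow> finite T \<and> (\<forall>t\<in>T. card t = 3) \<and>
     (\<forall>t\<in>T. \<forall>u\<in>t. \<forall>v\<in>t. u \<noteq> v \<longrightarrow> card {s\<in>T. u \<in> s \<and> v \<in> s} = 2)"

text \<open>Ordered triples: a triangle carries six flags, namely three strands, one for each middle
  vertex, in two directions each.\<close>

definition flags :: "'a set set \<Rightarrow> ('a \<times> 'a \<times> 'a) set" where
  "flags T = {(a,b,c). {a,b,c} \<in> T \<and> a \<noteq> b \<and> b \<noteq> c \<and> a \<noteq> c}"

text \<open>Crosses the edge of the last two vertices; \<open>d \<noteq> a\<close> excludes the
  triangle just left. The description is unique for flags of a closed complex and is used only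
  there.\<close>

definition zstep :: "'a set set \<Rightarrow> 'a \<times> 'a \<times> 'a \<Rightarrow> 'a \<times> 'a \<times> 'a" where
  "zstep T = (\<lambda>(a,b,c). (b, c, THE d. {b,c,d} \<in> T \<and> d \<noteq> a \<and> d \<noteq> b \<and> d \<noteq> c))"

definition flip :: "'a \<times> 'a \<times> 'a \<Rightarrow> 'a \<times> 'a \<times> 'a" where
  "flip = (\<lambda>(a,b,c). (c,b,a))"

text \<open>The orbit relation of the group generated by \<open>zstep T\<close> and \<open>flip\<close>; negative powers are
  superfluous because \<open>zstep T\<close> has finite order.\<close>

definition zrel :: "'a set set \<Rightarrow> (('a \<times> 'a \<times> 'a) \<times> ('a \<times> 'a \<times> 'a)) set" where
  "zrel T = {(f,g). f \<in> flags T \<and> (\<exists>n. g = (zstep T ^^ n) f \<or> g = (zstep T ^^ n) (flip f))}"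

lemma flags_iff [simp]: "(a,b,c) \<in> flags T \<longleftrightarrow> {a,b,c} \<in> T \<and> a \<noteq> b \<and> b \<noteq> c \<and> a \<noteq> c"
  by (simp add: flags_def)

lemma flip_simp [simp]: "flip (a,b,c) = (c,b,a)"
  by (simp add: flip_def)

lemma flip_flip [simp]: "flip (flip f) = f"
  by (cases f) simp

lemma flip_flags [simp]: "flip f \<in> flags T \<longleftrightarrow> f \<in> flags T"
  by (cases f) (auto simp: insert_commute)

lemma flip_neq: "f \<in> flags T \<Longrightarrow> flip f \<noteq> f"
  by (cases f) auto

text \<open>Exactly two triangles contain \<open>b\<close> and \<open>c\<close>; removing the given
  one leaves a single triangle, whose third vertex differs from \<open>a\<close> because triangles
  are determined by their vertices.\<close>

lemma opposite_ex1:
  assumes "closed_complex T" "{a,b,c} \<in> T" "a \<noteq> b" "b \<noteq> c" "a \<noteq> c"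
  shows "\<exists>!d. {b,c,d} \<in> T \<and> d \<noteq> a \<and> d \<noteq> b \<and> d \<noteq> c"
proof -
  define S where "S = {s\<in>T. b \<in> s \<and> c \<in> s}"
  have "\<forall>t\<in>T. \<forall>u\<in>t. \<forall>v\<in>t. u \<noteq> v \<longrightarrow> card {s\<in>T. u \<in> s \<and> v \<in> s} = 2"
    using assms(1) by (simp add: closed_complex_def)
  from bspec[OF this assms(2)] have "card S = 2" using assms(4) by (simp add: S_def)
  moreover have abc: "{a,b,c} \<in> S" using assms by (simp add: S_def)
  ultimately have "card (S - {{a,b,c}}) = 1" by (simp add: card_Diff_singleton)
  then obtain s where s0: "S - {{a,b,c}} = {s}" using card_1_singletonE by blast
  then have s: "S = {{a,b,c},s}" "s \<noteq> {a,b,c}" using abc by (metis insert_Diff, blast)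
  then have "s \<in> S" by simp
  then have sT: "s \<in> T" "b \<in> s" "c \<in> s" by (simp_all add: S_def)
  have "card s = 3" using assms(1) sT(1) by (simp add: closed_complex_def)
  then have "card (s - {b,c}) = 1" using sT assms(4) by (simp add: card_Diff_subset)
  then obtain d where d: "s - {b,c} = {d}" using card_1_singletonE by blast
  then have sd: "s = {b,c,d}" "d \<noteq> b" "d \<noteq> c" using sT(2,3) by blast+
  have "d \<noteq> a" using s(2) sd(1) by blast
  moreover have "d' = d" if "{b,c,d'} \<in> T" "d' \<noteq> a" "d' \<noteq> b" "d' \<noteq> c" for d'
  proof -
    have "{b,c,d'} \<in> S" using that(1) by (simp add: S_def)
    moreover have "{b,c,d'} \<noteq> {a,b,c}" using that(2-) by blast
    ultimately have "{b,c,d'} = {b,c,d}" using s(1) sd(1) by simp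
    then show ?thesis using that(3,4) sd(2,3) by blast
  qed
  ultimately show ?thesis using sT(1) sd by blast
qed

lemma zstep_eq:
  assumes "closed_complex T" "{a,b,c} \<in> T" "{b,c,d} \<in> T" "a \<noteq> b" "b \<noteq> c" "a \<noteq> c" "d \<noteq> a" "d \<noteq> b" "d \<noteq> c"
  shows "zstep T (a,b,c) = (b,c,d)"
  unfolding zstep_def using opposite_ex1[OF assms(1,2,4-6)] assms
  by (auto intro: the1_equality)

lemma zstep_obtain:
  assumes "closed_complex T" "(a,b,c) \<in> flags T"
  obtains d where "zstep T (a,b,c) = (b,c,d)" "{b,c,d} \<in> T" "d \<noteq> a" "d \<noteq> b" "d \<noteq> c"
  using opposite_ex1[of T a b c] zstep_eq[of T a b c] assms by (metis flags_iff)

lemma zstep_flags: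
  assumes "closed_complex T" "f \<in> flags T"
  shows "zstep T f \<in> flags T"
proof -
  obtain a b c where f: "f = (a,b,c)" by (cases f)
  with assms zstep_obtain[of T a b c] obtain d
    where "zstep T f = (b,c,d)" "{b,c,d} \<in> T" "d \<noteq> a" "d \<noteq> b" "d \<noteq> c" by metis
  then show ?thesis using assms f by auto
qed

text \<open>Walking backwards from the next flag leads to the reversed flag. So
  \<open>zstep T\<close> followed by \<open>flip\<close> is an involution on flags; this one
  identity supplies injectivity, inverses and the behaviour of reversal.\<close>

lemma zstep_flip_zstep:
  assumes "closed_complex T" "f \<in> flags T"
  shows "zstep T (flip (zstep T f)) = flip f"
proof -
  obtain a b c where f: "f = (a,b,c)" by (cases f)
  with assms zstep_obtain[of T a b c] obtain d
    where d: "zstep T f = (b,c,d)" "{b,c,d} \<in> T" "d \<noteq> a" "d \<noteq> b" "d \<noteq> c" by metis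
  have "zstep T (d,c,b) = (c,b,a)"
    using assms d f by (intro zstep_eq) (auto simp: insert_commute)
  then show ?thesis using d f by simp
qed

lemma zpow_flags:
  assumes "closed_complex T" "f \<in> flags T"
  shows "(zstep T ^^ n) f \<in> flags T"
  by (induction n) (auto simp: assms zstep_flags)

lemma zpow_flip_zpow:
  assumes "closed_complex T" "f \<in> flags T"
  shows "(zstep T ^^ n) (flip ((zstep T ^^ n) f)) = flip f"
proof (induction n)
  case (Suc n)
  have "(zstep T ^^ Suc n) (flip ((zstep T ^^ Suc n) f))
      = (zstep T ^^ n) (zstep T (flip (zstep T ((zstep T ^^ n) f))))"
    by (simp add: funpow_swap1)
  also have "\<dots> = (zstep T ^^ n) (flip ((zstep T ^^ n) f))"
    using zstep_flip_zstep[OF assms(1) zpow_flags[OF assms]] by simp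
  finally show ?case using Suc by simp
qed simp

lemma zpow_inj:
  assumes "closed_complex T" "f \<in> flags T" "g \<in> flags T" "(zstep T ^^ n) f = (zstep T ^^ n) g"
  shows "f = g"
  by (metis assms flip_flip zpow_flip_zpow)

lemma finite_flags:
  assumes "closed_complex T" shows "finite (flags T)"
proof -
  have "finite (\<Union>T)"
    using assms unfolding closed_complex_def
    by (metis card.infinite finite_Union zero_neq_numeral)
  moreover have "flags T \<subseteq> \<Union>T \<times> \<Union>T \<times> \<Union>T" by (auto simp: flags_def)
  ultimately show ?thesis by (meson finite_SigmaI finite_subset)
qed

text \<open>Pigeonhole gives two equal powers; injectivity cancels their common initial part, so the
  orbit returns to \<open>f\<close> itself.\<close>

lemma zpow_periodic:
  assumes "closed_complex T" "f \<in> flags T"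
  obtains n where "n > 0" "(zstep T ^^ n) f = f"
proof -
  have "\<not> inj_on (\<lambda>n. (zstep T ^^ n) f) UNIV"
  proof
    assume "inj_on (\<lambda>n. (zstep T ^^ n) f) UNIV"
    moreover have "range (\<lambda>n. (zstep T ^^ n) f) \<subseteq> flags T" using zpow_flags[OF assms] by auto
    ultimately show False using finite_flags[OF assms(1)]
      by (meson finite_imageD finite_subset infinite_UNIV_nat)
  qed
  then obtain i j where "i \<noteq> j" "(zstep T ^^ i) f = (zstep T ^^ j) f" by (auto simp: inj_on_def)
  then obtain i j where ij: "i < j" "(zstep T ^^ i) f = (zstep T ^^ j) f"
    by (metis linorder_neqE_nat)
  then have "(zstep T ^^ i) ((zstep T ^^ (j-i)) f) = (zstep T ^^ i) f"
    by (metis add_diff_inverse_nat funpow_add comp_apply not_less_iff_gr_or_eq)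
  then have "(zstep T ^^ (j-i)) f = f"
    using zpow_inj assms zpow_flags by metis
  then show ?thesis using ij that[of "j-i"] by simp
qed

lemma zpow_mult_period:
  assumes "(zstep T ^^ n) f = f"
  shows "(zstep T ^^ (k*n)) f = f"
  by (induction k) (auto simp: funpow_add assms)

text \<open>Stands in for negative powers.\<close>

lemma zpow_inverse:
  assumes "closed_complex T" "f \<in> flags T"
  obtains m where "(zstep T ^^ m) ((zstep T ^^ n) f) = f"
proof -
  obtain p where p: "p > 0" "(zstep T ^^ p) f = f" using zpow_periodic[OF assms] .
  \<comment> \<open>As \<open>p > 0\<close>, the multiple \<open>n*p\<close> of the period is at
    least \<open>n\<close>, so the truncated subtraction is exact.\<close>
  have "(zstep T ^^ (n*p - n)) ((zstep T ^^ n) f) = (zstep T ^^ (n*p - n + n)) f"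
    by (simp add: funpow_add)
  also have "n*p - n + n = n * p" using p by simp
  finally show ?thesis using that zpow_mult_period[OF p(2)] by simp
qed

text \<open>A reversal in the middle of a walk can be moved to its start, still with a natural
  exponent. This is what makes \<open>zrel\<close> transitive.\<close>

lemma flip_zpow:
  assumes "closed_complex T" "f \<in> flags T"
  obtains m where "flip ((zstep T ^^ n) f) = (zstep T ^^ m) (flip f)"
proof -
  obtain m where m: "(zstep T ^^ m) ((zstep T ^^ n) (flip ((zstep T ^^ n) f))) = flip ((zstep T ^^ n) f)"
    using zpow_inverse[OF assms(1), of "flip ((zstep T ^^ n) f)" n] zpow_flags[OF assms] by (metis flip_flags)
  then show ?thesis using that[of m] zpow_flip_zpow[OF assms] by metis
qed

lemma zrel_flags: "closed_complex T \<Longrightarrow> zrel T \<subseteq> flags T \<times> flags T"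
proof
  fix p assume T: "closed_complex T" and "p \<in> zrel T"
  then obtain f n where "f \<in> flags T" "p = (f, (zstep T ^^ n) f) \<or> p = (f, (zstep T ^^ n) (flip f))"
    unfolding zrel_def by blast
  then show "p \<in> flags T \<times> flags T"
    using zpow_flags[OF T] flip_flags[of f T] by (metis SigmaI)
qed

lemma zrel_refl: "f \<in> flags T \<Longrightarrow> (f,f) \<in> zrel T"
  unfolding zrel_def by (auto intro!: exI[of _ 0] simp del: flags_iff)

lemma zrel_zpow: "f \<in> flags T \<Longrightarrow> (f,(zstep T ^^ n) f) \<in> zrel T"
  unfolding zrel_def by auto

lemma zrel_zstep: "f \<in> flags T \<Longrightarrow> (f,zstep T f) \<in> zrel T"
  using zrel_zpow[of f T 1] by simp

lemma zrel_flip: "f \<in> flags T \<Longrightarrow> (f,flip f) \<in> zrel T"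
  unfolding zrel_def by (auto intro!: exI[of _ 0] simp del: flags_iff)

lemma zrel_trans:
  assumes T: "closed_complex T" and fg: "(f,g) \<in> zrel T" and gh: "(g,h) \<in> zrel T"
  shows "(f,h) \<in> zrel T"
proof -
  have f: "f \<in> flags T" using fg by (auto simp: zrel_def)
  obtain n where n: "g = (zstep T ^^ n) f \<or> g = (zstep T ^^ n) (flip f)" using fg by (auto simp: zrel_def)
  obtain m where m: "h = (zstep T ^^ m) g \<or> h = (zstep T ^^ m) (flip g)" using gh by (auto simp: zrel_def)
  obtain f' where f': "f' \<in> flags T" "f' = f \<or> f' = flip f" "g = (zstep T ^^ n) f'"
    using n f flip_flags by metis
  obtain l where l: "flip g = (zstep T ^^ l) (flip f')" using flip_zpow[OF T f'(1)] f'(3) by metis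
  have "h = (zstep T ^^ (m+n)) f' \<or> h = (zstep T ^^ (m+l)) (flip f')"
    using m l f'(3) by (auto simp: funpow_add)
  then show ?thesis using f f'(2) unfolding zrel_def by auto
qed

lemma zrel_sym:
  assumes T: "closed_complex T" and fg: "(f,g) \<in> zrel T"
  shows "(g,f) \<in> zrel T"
proof -
  have f: "f \<in> flags T" using fg by (auto simp: zrel_def)
  obtain n where n: "g = (zstep T ^^ n) f \<or> g = (zstep T ^^ n) (flip f)" using fg by (auto simp: zrel_def)
  obtain f' where f': "f' \<in> flags T" "f' = f \<or> f' = flip f" "g = (zstep T ^^ n) f'"
    using n f flip_flags by metis
  have g: "g \<in> flags T" using zpow_flags[OF T f'(1)] f'(3) by simp
  obtain m where "f' = (zstep T ^^ m) g" using zpow_inverse[OF T f'(1)] f'(3) by metis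
  then have "(g,f') \<in> zrel T" using g by (auto simp: zrel_def)
  moreover have "(f',f) \<in> zrel T" using f' f zrel_refl zrel_flip by (metis flip_flip flip_flags)
  ultimately show ?thesis using zrel_trans[OF T] by blast
qed

lemma equiv_zrel: "closed_complex T \<Longrightarrow> equiv (flags T) (zrel T)"
  by (intro equivI refl_onI symI transI)
    (use zrel_flags zrel_refl zrel_sym zrel_trans in blast)+

lemma zstep_neq_flip: "f \<in> flags T \<Longrightarrow> zstep T f \<noteq> flip f"
  by (cases f) (simp add: zstep_def)

text \<open>A zigzag is never its own reverse: the middle of the palindrome would be a degenerate flag.\<close>

lemma zpow_neq_flip:
  assumes T: "closed_complex T" and f: "f \<in> flags T"
  shows "(zstep T ^^ n) f \<noteq> flip f"
proof
  assume eq: "(zstep T ^^ n) f = flip f"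
  define m where "m = n div 2"
  define w where "w = (zstep T ^^ m) f"
  have w: "w \<in> flags T" using zpow_flags[OF T f] w_def by simp
  have fl: "(zstep T ^^ m) (flip w) = flip f" using zpow_flip_zpow[OF T f] w_def by simp
  show False
  \<comment> \<open>At the middle \<open>w\<close>, even length forces \<open>w = flip w\<close> and
    odd length forces \<open>zstep T w = flip w\<close>; either identifies two vertices of a
    flag.\<close>
  proof (cases "even n")
    case True
    then have "n = m + m" by (auto simp: m_def)
    then have "(zstep T ^^ m) w = (zstep T ^^ m) (flip w)" using eq fl w_def by (simp add: funpow_add)
    then show False using zpow_inj[OF T w, of "flip w" m] w flip_neq[OF w] by simp
  next
    case False
    then have "n = m + (1 + m)" by (auto simp: m_def elim: oddE)
    then have "(zstep T ^^ n) f = (zstep T ^^ m) ((zstep T ^^ 1) ((zstep T ^^ m) f))"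
      by (simp only: funpow_add comp_apply)
    then have "(zstep T ^^ m) (zstep T w) = (zstep T ^^ m) (flip w)" using eq fl unfolding w_def by simp
    then have "zstep T w = flip w"
      using zpow_inj[OF T zstep_flags[OF T w], of "flip w" m] w by simp
    then show False using w zstep_neq_flip by blast
  qed
qed

section \<open>Strands through a triangle that is replaced\<close>

definition first_ret :: "'a set set \<Rightarrow> 'a set \<Rightarrow> 'a \<times> 'a \<times> 'a \<Rightarrow> 'a \<times> 'a \<times> 'a" where
  "first_ret T t y = (zstep T ^^ (LEAST n. n > 0 \<and> (zstep T ^^ n) y \<in> flags {t})) y"

text \<open>Outside \<open>t\<close> nothing is lost, and \<open>t\<close> may be replaced by
  anything. This covers one or two inserted vertices, and also \<open>T' = T\<close>, which serves
  to analyse the returns in \<open>T\<close> alone.\<close>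

locale replaced_triangle =
  fixes T T' :: "'a set set" and t :: "'a set"
  assumes T: "closed_complex T" and T': "closed_complex T'"
    and tT: "t \<in> T" and sub: "T - {t} \<subseteq> T'"
begin

lemma flags_common: "flags (T - {t}) \<subseteq> flags T" "flags (T - {t}) \<subseteq> flags T'"
  using sub by auto

lemma zstep_common:
  assumes "f \<in> flags (T - {t})" "zstep T f \<in> flags (T - {t})"
  shows "zstep T' f = zstep T f"
proof -
  obtain a b c where f: "f = (a,b,c)" by (cases f)
  obtain d where d: "zstep T (a,b,c) = (b,c,d)" "{b,c,d} \<in> T" "d \<noteq> a" "d \<noteq> b" "d \<noteq> c"
    using zstep_obtain[OF T] assms(1) f flags_common by blast
  have "zstep T' (a,b,c) = (b,c,d)"
    using T' assms f d sub by (intro zstep_eq) auto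
  then show ?thesis using f d by simp
qed

lemma flags_split: "f \<in> flags T \<longleftrightarrow> f \<in> flags {t} \<or> f \<in> flags (T - {t})"
  using tT by (cases f) auto

lemma flags_disjoint: "f \<in> flags (T - {t}) \<Longrightarrow> f \<notin> flags {t}"
  by (cases f) auto

lemma zstep_leaves: assumes "f \<in> flags {t}" shows "zstep T f \<in> flags (T - {t})"
proof -
  obtain a b c where f: "f = (a,b,c)" by (cases f)
  have fT: "f \<in> flags T" using assms flags_split by blast
  then obtain d where d: "zstep T (a,b,c) = (b,c,d)" "{b,c,d} \<in> T" "d \<noteq> a" "d \<noteq> b" "d \<noteq> c"
    using zstep_obtain[OF T] f by blast
  then have "{b,c,d} \<noteq> t" using assms f by auto
  then show ?thesis using f d fT by auto
qed

text \<open>A stretch of a zigzag that avoids \<open>t\<close> uses only steps common to both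
  complexes.\<close>

lemma zpow_outside:
  assumes "f \<in> flags (T - {t})" "\<And>i. i \<le> n \<Longrightarrow> (zstep T ^^ i) f \<notin> flags {t}"
  shows "(f, (zstep T ^^ n) f) \<in> zrel T'"
  using assms
proof (induction n)
  case 0
  then have "f \<in> flags T'" using flags_common by blast
  then show ?case using zrel_refl by simp
next
  case (Suc n)
  let ?g = "(zstep T ^^ n) f"
  have fT: "f \<in> flags T" using Suc.prems(1) flags_common by auto
  have "?g \<in> flags (T - {t})" "zstep T ?g \<in> flags (T - {t})"
    using Suc.prems(2)[of n] Suc.prems(2)[of "Suc n"] zpow_flags[OF T fT, of n] zpow_flags[OF T fT, of "Suc n"]
      flags_split by auto
  then have "zstep T' ?g = zstep T ?g" "?g \<in> flags T'" using zstep_common flags_common by blast+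
  then have "(?g, zstep T ?g) \<in> zrel T'" using zrel_zstep by metis
  moreover have "(f, ?g) \<in> zrel T'" using Suc by auto
  ultimately show ?case using zrel_trans[OF T', of f ?g "zstep T ?g"] by simp
qed

lemma first_return:
  assumes y: "y \<in> flags {t}"
  obtains n where "n > 0" "first_ret T t y = (zstep T ^^ n) y" "first_ret T t y \<in> flags {t}"
    "\<And>i. 0 < i \<Longrightarrow> i < n \<Longrightarrow> (zstep T ^^ i) y \<notin> flags {t}"
proof -
  have yT: "y \<in> flags T" using y flags_split by blast
  define P where "P = (\<lambda>n. n > 0 \<and> (zstep T ^^ n) y \<in> flags {t})"
  obtain p where p: "p > 0" "(zstep T ^^ p) y = y" using zpow_periodic[OF T yT] .
  then have "P p" using y P_def by simp
  define n where "n = (LEAST n. P n)"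
  have n: "P n" "\<And>i. i < n \<Longrightarrow> \<not> P i"
    using \<open>P p\<close> LeastI not_less_Least unfolding n_def by metis+
  have "first_ret T t y = (zstep T ^^ n) y" by (simp add: first_ret_def n_def P_def)
  then show ?thesis using that[of n] n unfolding P_def by metis
qed

text \<open>The outer matching. The stretch from the exit of \<open>y\<close> to the last flag
  before the return \<open>z\<close> survives in \<open>T'\<close>, and the reversal of that last
  flag is the exit of \<open>flip z\<close>.\<close>

lemma first_return_related:
  assumes y: "y \<in> flags {t}"
  shows "(zstep T y, zstep T (flip (first_ret T t y))) \<in> zrel T'"
proof -
  have yT: "y \<in> flags T" using y flags_split by blast
  obtain n where n: "n > 0" "first_ret T t y = (zstep T ^^ n) y" "first_ret T t y \<in> flags {t}"
    "\<And>i. 0 < i \<Longrightarrow> i < n \<Longrightarrow> (zstep T ^^ i) y \<notin> flags {t}"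
    using first_return[OF y] by metis
  let ?z = "(zstep T ^^ n) y"
  \<comment> \<open>A step leaves \<open>t\<close> at once, so the return takes at least two steps
    and there is a last flag \<open>?w\<close> outside \<open>t\<close>.\<close>
  have "n \<noteq> 1"
  proof
    assume "n = 1"
    then show False using n(2,3) flags_disjoint zstep_leaves[OF y] by simp
  qed
  then obtain m where m: "n = Suc (Suc m)" using n(1)
    by (metis One_nat_def gr0_conv_Suc nat_neq_iff not0_implies_Suc)
  let ?w = "(zstep T ^^ Suc m) y"
  have w: "?w = (zstep T ^^ m) (zstep T y)" by (simp add: funpow_swap1)
  have "(zstep T y, ?w) \<in> zrel T'" unfolding w
  proof (rule zpow_outside[OF zstep_leaves[OF y]])
    fix i assume "i \<le> m"
    then show "(zstep T ^^ i) (zstep T y) \<notin> flags {t}"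
      using n(4)[of "Suc i"] m by (simp add: funpow_swap1)
  qed
  moreover have "(?w, flip ?w) \<in> zrel T'"
    using calculation zrel_flags[OF T'] zrel_flip by blast
  moreover have "zstep T (flip ?z) = flip ?w"
    using zstep_flip_zstep[OF T zpow_flags[OF T yT, of "Suc m"]] m by simp
  ultimately show ?thesis using zrel_trans[OF T', of "zstep T y" ?w "flip ?w"] n(2) by simp
qed

text \<open>A walk in \<open>T\<close> consists of stretches outside \<open>t\<close> and single
  flags inside. The stretches survive in \<open>T'\<close>, and the visits are bridged because all
  exits of \<open>t\<close> have become related.\<close>

lemma zrel_mono:
  assumes merged: "\<And>y z. y \<in> flags {t} \<Longrightarrow> z \<in> flags {t} \<Longrightarrow> (zstep T y, zstep T z) \<in> zrel T'"
    and f: "f \<in> flags (T - {t})" and g: "g \<in> flags (T - {t})" and fg: "(f,g) \<in> zrel T"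
  shows "(f,g) \<in> zrel T'"
proof -
  have main: "(f, (zstep T ^^ n) f) \<in> zrel T'"
    if "f \<in> flags (T - {t})" "(zstep T ^^ n) f \<in> flags (T - {t})" for n f
    using that
  proof (induction n arbitrary: f rule: less_induct)
    case (less n)
    have fT: "f \<in> flags T" "f \<in> flags T'" using less.prems flags_common by auto
    show ?case
    proof (cases n)
      case 0
      then show ?thesis using zrel_refl fT by simp
    next
      case (Suc m)
      let ?g = "zstep T f"
      have n: "(zstep T ^^ n) f = (zstep T ^^ m) ?g" using Suc by (simp add: funpow_swap1)
      show ?thesis
      proof (cases "?g \<in> flags (T - {t})")
        case True
        then have "(?g, (zstep T ^^ m) ?g) \<in> zrel T'" using less Suc n by auto
        moreover have "(f,?g) \<in> zrel T'" using zrel_zstep fT zstep_common less.prems True by metis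
        ultimately show ?thesis using zrel_trans[OF T'] n by metis
      next
        case False
        \<comment> \<open>The walk visits \<open>t\<close> in the single flag \<open>?g\<close>.
          Reversed, \<open>f\<close> is the exit of \<open>flip ?g\<close>, hence related to the
          exit \<open>?h\<close> of \<open>?g\<close>.\<close>
        then have g: "?g \<in> flags {t}" using zstep_flags[OF T fT(1)] flags_split by auto
        obtain l where l: "m = Suc l" using False less.prems n by (cases m) auto
        let ?h = "zstep T ?g"
        have h: "?h \<in> flags (T - {t})" using zstep_leaves g by auto
        have n': "(zstep T ^^ n) f = (zstep T ^^ l) ?h" using n l by (simp add: funpow_swap1)
        then have "(?h, (zstep T ^^ l) ?h) \<in> zrel T'" using less l Suc h by auto
        moreover have "zstep T (flip ?g) = flip f" using zstep_flip_zstep[OF T fT(1)] .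
        then have "(flip f, ?h) \<in> zrel T'" using merged[of "flip ?g" ?g] g by simp
        moreover have "(f, flip f) \<in> zrel T'" using zrel_flip fT by blast
        ultimately show ?thesis using zrel_trans[OF T'] n' by metis
      qed
    qed
  qed
  obtain n where "g = (zstep T ^^ n) f \<or> g = (zstep T ^^ n) (flip f)" using fg by (auto simp: zrel_def)
  then show ?thesis
  proof
    assume "g = (zstep T ^^ n) f" then show ?thesis using main f g by auto
  next
    assume "g = (zstep T ^^ n) (flip f)"
    then have "(flip f,g) \<in> zrel T'" using main[of "flip f" n] f g by auto
    moreover have "(f, flip f) \<in> zrel T'" using f flags_common zrel_flip by blast
    ultimately show ?thesis using zrel_trans[OF T'] by metis
  qed
qed

text \<open>The old classes map onto the new ones: onto because every new class has a flag outside
  \<open>t\<close>, well defined because relations outside \<open>t\<close> persist. The classes of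
  the unrelated flags \<open>y\<close> and \<open>z\<close> get the same image, so the number drops
  strictly.\<close>

lemma fewer_classes:
  assumes merged: "\<And>y z. y \<in> flags {t} \<Longrightarrow> z \<in> flags {t} \<Longrightarrow> (zstep T y, zstep T z) \<in> zrel T'"
    and meets: "\<And>f. f \<in> flags T' \<Longrightarrow> \<exists>g \<in> flags (T - {t}). (f,g) \<in> zrel T'"
    and y: "y \<in> flags {t}" and z: "z \<in> flags {t}" and yz: "(y,z) \<notin> zrel T"
  shows "card (flags T' // zrel T') < card (flags T // zrel T)"
proof -
  let ?K = "flags (T - {t})"
  let ?p = "\<lambda>X. zrel T' `` (X \<inter> ?K)"
  have eqT: "equiv (flags T) (zrel T)" and eqT': "equiv (flags T') (zrel T')"
    using equiv_zrel T T' by auto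
  have p: "?p (zrel T `` {f}) = zrel T' `` {f}" if "f \<in> ?K" for f
  proof
    show "?p (zrel T `` {f}) \<subseteq> zrel T' `` {f}"
      using zrel_mono[OF merged that] zrel_trans[OF T'] by blast
    have "f \<in> zrel T `` {f} \<inter> ?K" using that zrel_refl flags_common by blast
    then show "zrel T' `` {f} \<subseteq> ?p (zrel T `` {f})" by blast
  qed
  have fin: "finite (flags T // zrel T)" using finite_flags[OF T] zrel_flags[OF T] finite_quotient by blast
  have surj: "flags T' // zrel T' \<subseteq> ?p ` (flags T // zrel T)"
  proof
    fix X assume "X \<in> flags T' // zrel T'"
    then obtain f where f: "f \<in> flags T'" "X = zrel T' `` {f}" by (auto simp: quotient_def)
    obtain g where g: "g \<in> ?K" "(f,g) \<in> zrel T'" using meets f by blast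
    then have "X = zrel T' `` {g}" using f equiv_class_eq[OF eqT' g(2)] by simp
    then have "X = ?p (zrel T `` {g})" using p[OF g(1)] by simp
    moreover have "zrel T `` {g} \<in> flags T // zrel T"
      by (rule quotientI, rule subsetD[OF flags_common(1) g(1)])
    ultimately show "X \<in> ?p ` (flags T // zrel T)" by (rule image_eqI)
  qed
  let ?Y = "zrel T `` {zstep T y}" and ?Z = "zrel T `` {zstep T z}"
  have yT: "y \<in> flags T" "z \<in> flags T" using y z flags_split by auto
  have YZ: "?Y \<in> flags T // zrel T" "?Z \<in> flags T // zrel T"
    by (intro quotientI zstep_flags[OF T] yT)+
  have neq: "?Y \<noteq> ?Z"
  proof
    assume "?Y = ?Z"
    then have "(zstep T y, zstep T z) \<in> zrel T"
      using zstep_flags[OF T] yT eq_equiv_class[OF _ eqT] by blast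
    then show False using yz zrel_zstep yT zrel_trans[OF T] zrel_sym[OF T] by metis
  qed
  have "?p ?Y = ?p ?Z"
    using p[OF zstep_leaves[OF y]] p[OF zstep_leaves[OF z]] equiv_class_eq[OF eqT' merged[OF y z]] by simp
  then have "\<not> inj_on ?p (flags T // zrel T)" using YZ neq by (metis inj_onD)
  then have "card (?p ` (flags T // zrel T)) < card (flags T // zrel T)"
    using fin card_image_le eq_card_imp_inj_on le_neq_implies_less by blast
  then show ?thesis using card_mono[OF finite_imageI[OF fin] surj] by simp
qed

end

section \<open>Inserting vertices into triangles\<close>

text \<open>The stellar subdivision of \<open>t\<close>: it is replaced by the cone from
  \<open>x\<close> over its boundary.\<close>

definition insert_vertex :: "'a set set \<Rightarrow> 'a set \<Rightarrow> 'a \<Rightarrow> 'a set set" where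
  "insert_vertex T t x = (T - {t}) \<union> (\<lambda>v. insert x (t - {v})) ` t"

lemma flags_triangle:
  assumes "a \<noteq> b" "b \<noteq> c" "a \<noteq> c"
  shows "flags {{a,b,c}} = {(a,b,c),(b,c,a),(c,a,b),(c,b,a),(a,c,b),(b,a,c)}" (is "?L = ?R")
proof
  show "?L \<subseteq> ?R"
  proof
    fix f assume f: "f \<in> ?L"
    obtain p q r where pqr: "f = (p,q,r)" using prod_cases3 by blast
    have e: "{p,q,r} = {a,b,c}" "p \<noteq> q" "q \<noteq> r" "p \<noteq> r" using f pqr by simp_all
    then have "p \<in> {a,b,c}" "q \<in> {a,b,c}" "r \<in> {a,b,c}" by blast+
    then show "f \<in> ?R" using e(2-4) pqr by auto
  qed
  show "?R \<subseteq> ?L" using assms by (simp add: insert_commute)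
qed

text \<open>A stretch of a zigzag written as its list of vertices. Only windows of four are required
  to be distinct, so a walk may come back to a vertex; shorter lists are accepted vacuously.\<close>

fun zwalk :: "'a set set \<Rightarrow> 'a list \<Rightarrow> bool" where
  "zwalk T (a#b#c#d#vs) \<longleftrightarrow>
     {a,b,c} \<in> T \<and> {b,c,d} \<in> T \<and> distinct [a,b,c,d] \<and> zwalk T (b#c#d#vs)"
| "zwalk T vs \<longleftrightarrow> True"

lemma zwalk_related:
  assumes "closed_complex T" "zwalk T (a#b#c#d#vs)" "Suc (Suc i) < length (a#b#c#d#vs)"
  shows "((a,b,c), ((a#b#c#d#vs)!i, (a#b#c#d#vs)!Suc i, (a#b#c#d#vs)!Suc (Suc i))) \<in> zrel T"
  using assms(2,3)
proof (induction i arbitrary: a b c d vs)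
  case 0
  then show ?case using zrel_refl[of "(a,b,c)" T] by simp
next
  case (Suc i)
  have abc: "(a,b,c) \<in> flags T" using Suc.prems by simp
  have "zstep T (a,b,c) = (b,c,d)" using Suc.prems(1) by (intro zstep_eq[OF assms(1)]) auto
  then have st: "((a,b,c),(b,c,d)) \<in> zrel T" using zrel_zstep[OF abc] by simp
  show ?case
  proof (cases vs)
    case Nil
    then have "i = 0" using Suc.prems(2) by simp
    then show ?thesis using st by simp
  next
    case (Cons e ws)
    then have "((b,c,d), ((b#c#d#vs)!i, (b#c#d#vs)!Suc i, (b#c#d#vs)!Suc (Suc i))) \<in> zrel T"
      using Suc.IH[of b c d e ws] Suc.prems by simp
    then show ?thesis using zrel_trans[OF assms(1) st] by simp
  qed
qed

context replaced_triangle
begin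

lemma zrel'_common: "f \<in> flags (T - {t}) \<Longrightarrow> (f, flip f) \<in> zrel T'"
  using zrel_flip flags_common by blast

lemma merged_if_hub:
  assumes "\<And>z. z \<in> flags {t} \<Longrightarrow> (h, zstep T z) \<in> zrel T'"
    and "y \<in> flags {t}" "z \<in> flags {t}"
  shows "(zstep T y, zstep T z) \<in> zrel T'"
  using assms zrel_trans[OF T'] zrel_sym[OF T'] by blast

lemma flip_zstep_flip_related:
  assumes y: "y \<in> flags {t}" and "(flip (zstep T y), g) \<in> zrel T'"
  shows "(zstep T y, g) \<in> zrel T'"
  using assms zrel_trans[OF T'] zrel'_common[OF zstep_leaves[OF y]] by blast

text \<open>The three strands through \<open>t\<close> have the flags \<open>(b,a,c)\<close>, \<open>(a,b,c)\<close>, \<open>(b,c,a)\<close> and their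
  reversals.\<close>

lemma strand_cases:
  assumes t: "t = {a,b,c}" "a \<noteq> b" "b \<noteq> c" "a \<noteq> c"
    and una: "((a,b,c),(b,a,c)) \<notin> zrel T" and unc: "((a,b,c),(b,c,a)) \<notin> zrel T"
  shows "first_ret T t (a,b,c) = (a,b,c) \<and>
    (first_ret T t (b,a,c) = (b,a,c) \<and> first_ret T t (b,c,a) = (b,c,a) \<or>
     first_ret T t (b,a,c) = (b,c,a) \<and> first_ret T t (b,c,a) = (b,a,c) \<or>
     first_ret T t (b,a,c) = (a,c,b) \<and> first_ret T t (a,c,b) = (b,a,c))"
proof -
  let ?ret = "first_ret T t"
  have fl: "flags {t} = {(a,b,c),(b,c,a),(c,a,b),(c,b,a),(a,c,b),(b,a,c)}"
    using flags_triangle t by simp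
  have inT: "y \<in> flags T" if "y \<in> flags {t}" for y using that flags_split by blast
  have pow: "\<exists>n. ?ret y = (zstep T ^^ n) y" if "y \<in> flags {t}" for y
    using first_return[OF that] by metis
  have ret: "?ret y \<in> flags {t}" if "y \<in> flags {t}" for y
    using first_return[OF that] by metis
  have rel: "(y, ?ret y) \<in> zrel T" if "y \<in> flags {t}" for y
    using pow[OF that] zrel_zpow inT that by metis
  \<comment> \<open>A strand that returns as its own reversal would be a palindromic zigzag.\<close>
  have nofl: "?ret y \<noteq> flip y" if "y \<in> flags {t}" for y
    using pow[OF that] zpow_neq_flip[OF T inT[OF that]] by metis
  have nofl2: "?ret (?ret y) \<noteq> flip y" if y: "y \<in> flags {t}" for y
  proof -
    obtain n m where "?ret y = (zstep T ^^ n) y" "?ret (?ret y) = (zstep T ^^ m) (?ret y)"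
      using pow[OF y] pow[OF ret[OF y]] by blast
    then have "?ret (?ret y) = (zstep T ^^ (m+n)) y" by (simp add: funpow_add)
    then show ?thesis using zpow_neq_flip[OF T inT[OF y]] by metis
  qed
  \<comment> \<open>A strand that closes up at its first return meets \<open>t\<close> in no other
    flag than its own two.\<close>
  have lone: "z = y \<or> z = flip y"
    if y: "y \<in> flags {t}" and z: "z \<in> flags {t}" and ry: "?ret y = y" and yz: "(y,z) \<in> zrel T" for y z
  proof -
    obtain n where n: "n > 0" "(zstep T ^^ n) y = y" 
      "\<And>i. 0 < i \<Longrightarrow> i < n \<Longrightarrow> (zstep T ^^ i) y \<notin> flags {t}"
      using first_return[OF y] unfolding ry by metis
    have stay: "w = y" if "w \<in> flags {t}" "w = (zstep T ^^ m) y" for w m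
    proof -
      have "(zstep T ^^ (m mod n + (m div n) * n)) y = (zstep T ^^ (m mod n)) y"
        unfolding funpow_add comp_apply using zpow_mult_period[OF n(2)] by simp
      then have "w = (zstep T ^^ (m mod n)) y" using that(2) by simp
      moreover have "m mod n = 0" using n(3)[of "m mod n"] n(1) that(1) calculation by force
      ultimately show ?thesis by simp
    qed
    obtain m where "z = (zstep T ^^ m) y \<or> z = (zstep T ^^ m) (flip y)"
      using yz by (auto simp: zrel_def)
    then show ?thesis
    proof
      assume "z = (zstep T ^^ m) y" then show ?thesis using stay z by blast
    next
      assume zm: "z = (zstep T ^^ m) (flip y)"
      have "flip y \<in> flags T" using inT[OF y] by simp
      then obtain l where "flip z = (zstep T ^^ l) y"
        using flip_zpow[OF T, of "flip y" m] zm by (metis flip_flip)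
      moreover have "flip z \<in> flags {t}" using z by simp
      ultimately have "flip z = y" using stay by blast
      then show ?thesis by (metis flip_flip)
    qed
  qed
  have mem: "(a,b,c) \<in> flags {t}" "(b,a,c) \<in> flags {t}" "(b,c,a) \<in> flags {t}" "(a,c,b) \<in> flags {t}"
      "(c,b,a) \<in> flags {t}" "(c,a,b) \<in> flags {t}"
    using fl by auto
  note T_mem = mem[THEN inT]
  have una': "((a,b,c),(c,a,b)) \<notin> zrel T"
    using una zrel_trans[OF T _ zrel_flip[OF T_mem(6)]] by auto
  have unc': "((a,b,c),(a,c,b)) \<notin> zrel T"
    using unc zrel_trans[OF T _ zrel_flip[OF T_mem(4)]] by auto
  \<comment> \<open>The return is related to \<open>(a,b,c)\<close>, which leaves only this flag and
    its reversal, and the reversal is excluded.\<close>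
  have B: "?ret (a,b,c) = (a,b,c)"
    using ret[OF mem(1)] rel[OF mem(1)] nofl[OF mem(1)] una unc una' unc' unfolding fl by auto
  have toB: "(y,(a,b,c)) \<notin> zrel T \<and> (y,(c,b,a)) \<notin> zrel T"
    if "y \<in> {(b,a,c),(b,c,a),(a,c,b),(c,a,b)}" for y
  proof -
    have "((a,b,c),y) \<notin> zrel T" using that una unc una' unc' by auto
    then show ?thesis using zrel_sym[OF T] zrel_trans[OF T] zrel_flip[OF T_mem(1)]
      by (metis flip_simp)
  qed
  have R: "?ret y \<in> {(b,a,c),(b,c,a),(a,c,b),(c,a,b)}"
    if "y \<in> {(b,a,c),(b,c,a),(a,c,b),(c,a,b)}" for y
  proof -
    have "y \<in> flags {t}" using that fl by auto
    then show ?thesis using ret[of y] rel[of y] toB[OF that] unfolding fl by auto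
  qed
  have neqs: "(b,a,c) \<noteq> (b,c,a)" "(b,a,c) \<noteq> (a,c,b)" "(b,c,a) \<noteq> (b,a,c)" "(b,c,a) \<noteq> (c,a,b)"
    "(a,c,b) \<noteq> (b,a,c)" "(a,c,b) \<noteq> (c,a,b)"
    using t by auto
  \<comment> \<open>The strand at \<open>b\<close> is cut off from the other two, so four values are
    possible; the fourth, \<open>(c,a,b)\<close>, is the reversal of \<open>(b,a,c)\<close>.\<close>
  consider "?ret (b,a,c) = (b,a,c)" | "?ret (b,a,c) = (b,c,a)" | "?ret (b,a,c) = (a,c,b)"
    using R[of "(b,a,c)"] nofl[OF mem(2)] by auto
  then show ?thesis
  proof cases
    case 1
    have un: "((b,a,c),(b,c,a)) \<notin> zrel T" "((b,a,c),(a,c,b)) \<notin> zrel T"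
      using lone[OF mem(2,3) 1] lone[OF mem(2,4) 1] neqs by auto
    have un': "((b,c,a),(b,a,c)) \<notin> zrel T" using un(1) zrel_sym[OF T] by blast
    moreover have "((b,c,a),(c,a,b)) \<notin> zrel T"
      using un' zrel_trans[OF T _ zrel_flip[OF T_mem(6)]] by auto
    ultimately have "?ret (b,c,a) = (b,c,a)"
      using R[of "(b,c,a)"] nofl[OF mem(3)] rel[OF mem(3)] by auto
    then show ?thesis using B 1 by simp
  next
    case 2
    have "?ret (b,c,a) \<noteq> (b,c,a)"
    proof
      assume e: "?ret (b,c,a) = (b,c,a)"
      have "((b,c,a),(b,a,c)) \<in> zrel T" using rel[OF mem(2)] 2 zrel_sym[OF T] by auto
      then show False using lone[OF mem(3,2) e] neqs by auto
    qed
    then have "?ret (b,c,a) = (b,a,c)"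
      using R[of "(b,c,a)"] nofl[OF mem(3)] nofl2[OF mem(2)] 2 by auto
    then show ?thesis using B 2 by simp
  next
    case 3
    have "?ret (a,c,b) \<noteq> (a,c,b)"
    proof
      assume e: "?ret (a,c,b) = (a,c,b)"
      have "((a,c,b),(b,a,c)) \<in> zrel T" using rel[OF mem(2)] 3 zrel_sym[OF T] by auto
      then show False using lone[OF mem(4,2) e] neqs by auto
    qed
    then have "?ret (a,c,b) = (b,a,c)"
      using R[of "(a,c,b)"] nofl[OF mem(4)] nofl2[OF mem(2)] 3 by auto
    then show ?thesis using B 3 by simp
  qed
qed

end

lemma insert_vertex_triangle:
  assumes "a \<noteq> b" "b \<noteq> c" "a \<noteq> c"
  shows "insert_vertex T {a,b,c} x = (T - {{a,b,c}}) \<union> {{x,b,c},{x,c,a},{x,a,b}}"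
proof -
  have "{a,b,c} - {a} = {b,c}" "{a,b,c} - {b} = {c,a}" "{a,b,c} - {c} = {a,b}" using assms by auto
  then show ?thesis unfolding insert_vertex_def image_insert image_empty by simp
qed

section \<open>One inserted vertex\<close>

locale inserted_vertex = replaced_triangle T T' t for T T' :: "'a set set" and t +
  fixes x :: 'a
  assumes T'_eq: "T' = insert_vertex T t x" and x: "x \<notin> \<Union>T"
begin

text \<open>A zigzag entering from \<open>p\<close> across \<open>uv\<close> used to continue to
  \<open>w\<close> and leave across \<open>vw\<close>. Now it goes on to \<open>x\<close>, turns to
  \<open>w\<close> and leaves across \<open>wu\<close>, so the rotation of the three edges is
  inverted.\<close>

lemma walk:
  assumes t: "t = {u,v,w}" "u \<noteq> v" "v \<noteq> w" "u \<noteq> w"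
  obtains p r where "zstep T (w,v,u) = (v,u,p)" "zstep T (v,w,u) = (w,u,r)"
    "zwalk T' [p,u,v,x,w,u,r]"
proof -
  have fl: "(w,v,u) \<in> flags T" "(v,w,u) \<in> flags T" using t tT by (auto simp: insert_commute)
  obtain p where p: "zstep T (w,v,u) = (v,u,p)" "{v,u,p} \<in> T" "p \<noteq> w" "p \<noteq> v" "p \<noteq> u"
    using zstep_obtain[OF T fl(1)] .
  obtain r where r: "zstep T (v,w,u) = (w,u,r)" "{w,u,r} \<in> T" "r \<noteq> v" "r \<noteq> w" "r \<noteq> u"
    using zstep_obtain[OF T fl(2)] .
  have x': "x \<noteq> u" "x \<noteq> v" "x \<noteq> w" "x \<noteq> p" "x \<noteq> r" using x p r tT t by blast+
  have T'': "T' = (T - {{u,v,w}}) \<union> {{x,v,w},{x,w,u},{x,u,v}}"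
    using T'_eq insert_vertex_triangle t by simp
  have "{p,u,v} \<in> T'" "{w,u,r} \<in> T'"
    using p r t sub by (auto simp: insert_commute)
  moreover have "{x,v,w} \<in> T'" "{x,w,u} \<in> T'" "{x,u,v} \<in> T'" using T'' by simp_all
  ultimately have "zwalk T' [p,u,v,x,w,u,r]"
    using t(2-4) x' p(3-5) r(3-5) by (simp add: insert_commute)
  then show ?thesis using that p r by blast
qed

text \<open>The first claim is the new inner matching of the exits; the others attach each flag on
  the way through the star to one of these exits.\<close>

lemma walk_related:
  assumes "t = {u,v,w}" "u \<noteq> v" "v \<noteq> w" "u \<noteq> w"
  shows "(zstep T (w,v,u), zstep T (v,w,u)) \<in> zrel T'"
    and "((u,v,x), zstep T (v,w,u)) \<in> zrel T'"
    and "((v,x,w), zstep T (v,w,u)) \<in> zrel T'"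
    and "((x,w,u), zstep T (v,w,u)) \<in> zrel T'"
proof -
  obtain p r where pr: "zstep T (w,v,u) = (v,u,p)" "zstep T (v,w,u) = (w,u,r)"
    and wk: "zwalk T' [p,u,v,x,w,u,r]" using walk[OF assms] .
  have 0: "((p,u,v),(w,u,r)) \<in> zrel T'" using zwalk_related[OF T' wk, of 4] by simp
  have y: "(w,v,u) \<in> flags {t}" using assms by (simp add: insert_commute)
  show "(zstep T (w,v,u), zstep T (v,w,u)) \<in> zrel T'"
    using flip_zstep_flip_related[OF y] 0 pr by simp
  have 1: "((p,u,v),(u,v,x)) \<in> zrel T'" "((p,u,v),(v,x,w)) \<in> zrel T'" "((p,u,v),(x,w,u)) \<in> zrel T'"
    using zwalk_related[OF T' wk, of 1] zwalk_related[OF T' wk, of 2] zwalk_related[OF T' wk, of 3] by simp_all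
  show "((u,v,x), zstep T (v,w,u)) \<in> zrel T'" "((v,x,w), zstep T (v,w,u)) \<in> zrel T'"
    "((x,w,u), zstep T (v,w,u)) \<in> zrel T'"
    using 1[THEN zrel_sym[OF T']] 0 zrel_trans[OF T'] pr(2) by metis+
qed

text \<open>No zigzag of \<open>T'\<close> stays inside the star: a new flag contains
  \<open>x\<close> as first, second or third entry and accordingly is one of the three inner flags
  of a walk through the star.\<close>

lemma meets_common:
  assumes f: "f \<in> flags T'"
  shows "\<exists>g\<in>flags (T - {t}). (f,g) \<in> zrel T'"
proof (cases "f \<in> flags (T - {t})")
  case True
  then show ?thesis using zrel_refl f by blast
next
  case False
  obtain a b c where f': "f = (a,b,c)" using prod_cases3 by blast
  have d: "a \<noteq> b" "b \<noteq> c" "a \<noteq> c" "{a,b,c} \<in> T'" using f f' by simp_all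
  have "{a,b,c} \<notin> T - {t}" using False f' d(1-3) by simp
  moreover have "{a,b,c} \<in> T - {t} \<union> (\<lambda>v. insert x (t - {v})) ` t"
    using d(4) unfolding T'_eq insert_vertex_def .
  ultimately have "{a,b,c} \<in> (\<lambda>v. insert x (t - {v})) ` t" by (meson Un_iff)
  then obtain v where v: "v \<in> t" "{a,b,c} = insert x (t - {v})" by blast
  have xt: "x \<notin> t" using x tT by blast
  have t: "t = insert v ({a,b,c} - {x})" using v xt by blast
  have "v \<noteq> x" using v(1) xt by blast
  then have vn: "v \<notin> {a,b,c}" unfolding v(2) by simp
  have "x \<in> {a,b,c}" using v by blast
  then have "\<exists>y\<in>flags {t}. (f, zstep T y) \<in> zrel T'"
  proof (elim insertE emptyE)
    assume "x = a"
    then have tt: "t = {c,v,b}" using t d by auto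
    then have "((x,b,c), zstep T (v,b,c)) \<in> zrel T'" using vn d by (intro walk_related(4)) auto
    then show ?thesis using f' \<open>x = a\<close> vn d tt by (intro bexI[of _ "(v,b,c)"]) (auto simp: insert_commute)
  next
    assume "x = b"
    then have tt: "t = {v,a,c}" using t d by auto
    then have "((a,x,c), zstep T (a,c,v)) \<in> zrel T'" using vn d by (intro walk_related(3)) auto
    then show ?thesis using f' \<open>x = b\<close> vn d tt by (intro bexI[of _ "(a,c,v)"]) (auto simp: insert_commute)
  next
    assume "x = c"
    then have tt: "t = {a,b,v}" using t d by auto
    then have "((a,b,x), zstep T (b,v,a)) \<in> zrel T'" using vn d by (intro walk_related(2)) auto
    then show ?thesis using f' \<open>x = c\<close> vn d tt by (intro bexI[of _ "(b,v,a)"]) (auto simp: insert_commute)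
  qed
  then show ?thesis using zstep_leaves by blast
qed

text \<open>The outer matching joins the exits of \<open>(a,b,c)\<close> and \<open>(c,b,a)\<close>
  and, in one of two ways, the other four. With the inner matching \<open>i1\<close>,
  \<open>i2\<close>, \<open>i3\<close> either way gives a hexagon.\<close>

lemma fewer_classes_insert:
  assumes t: "t = {a,b,c}" "a \<noteq> b" "b \<noteq> c" "a \<noteq> c"
    and un: "((a,b,c),(b,a,c)) \<notin> zrel T"
    and B: "first_ret T t (a,b,c) = (a,b,c)"
    and cs: "first_ret T t (b,a,c) = (b,a,c) \<and> first_ret T t (b,c,a) = (b,c,a) \<or>
     first_ret T t (b,a,c) = (b,c,a) \<and> first_ret T t (b,c,a) = (b,a,c)"
  shows "card (flags T' // zrel T') < card (flags T // zrel T)"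
proof -
  let ?E = "zstep T"
  have fl: "flags {t} = {(a,b,c),(b,c,a),(c,a,b),(c,b,a),(a,c,b),(b,a,c)}"
    using flags_triangle t by simp
  have mem: "(a,b,c) \<in> flags {t}" "(b,a,c) \<in> flags {t}" "(b,c,a) \<in> flags {t}" using fl by auto
  note tr = zrel_trans[OF T'] and sy = zrel_sym[OF T']
  have tp: "t = {b,c,a}" "t = {c,a,b}" "t = {c,b,a}" "t = {a,c,b}" "t = {b,a,c}"
    using t(1) by auto
  have i1: "(?E (c,b,a), ?E (b,c,a)) \<in> zrel T'" using walk_related(1)[OF t] .
  have i2: "(?E (a,c,b), ?E (c,a,b)) \<in> zrel T'" using walk_related(1)[OF tp(1)] t by auto
  have i3: "(?E (b,a,c), ?E (a,b,c)) \<in> zrel T'" using walk_related(1)[OF tp(2)] t by auto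
  have b: "(?E (a,b,c), ?E (c,b,a)) \<in> zrel T'" using first_return_related[OF mem(1)] B by simp
  \<comment> \<open>The first alternative belongs to two separate strands, the second to two that
    join.\<close>
  have "(?E (b,a,c), ?E (c,a,b)) \<in> zrel T' \<and> (?E (b,c,a), ?E (a,c,b)) \<in> zrel T' \<or>
        (?E (b,a,c), ?E (a,c,b)) \<in> zrel T' \<and> (?E (b,c,a), ?E (c,a,b)) \<in> zrel T'"
    using first_return_related[OF mem(2)] first_return_related[OF mem(3)] cs by auto
  \<comment> \<open>\<open>i2\<close> relates the exits of \<open>(a,c,b)\<close> and
    \<open>(c,a,b)\<close>, which erases the difference between the alternatives.\<close>
  then have "(?E (b,a,c), ?E (c,a,b)) \<in> zrel T' \<and> (?E (b,a,c), ?E (a,c,b)) \<in> zrel T'"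
    using i2 tr sy by blast
  then have hub: "(?E (b,a,c), ?E z) \<in> zrel T'" if "z \<in> flags {t}" for z
    using that i1 i3 b tr sy unfolding fl by blast
  show ?thesis
    using fewer_classes[OF merged_if_hub[OF hub] meets_common mem(1,2) un] by blast
qed

end

section \<open>Two inserted vertices\<close>

locale twice_inserted_vertex = replaced_triangle T T' t for T T' :: "'a set set" and t +
  fixes a b c x y :: 'a
  assumes t: "t = {a,b,c}" "a \<noteq> b" "b \<noteq> c" "a \<noteq> c"
    and T'_eq: "T' = insert_vertex (insert_vertex T t x) {x,a,b} y"
    and x: "x \<notin> \<Union>T" and y: "y \<notin> \<Union>T" "y \<noteq> x"
begin

lemma x_neq: "x \<noteq> a" "x \<noteq> b" "x \<noteq> c" "y \<noteq> a" "y \<noteq> b" "y \<noteq> c"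
  using x y tT t by auto

lemma T'_cases: "T' = (T - {{a,b,c}}) \<union> {{x,b,c},{x,c,a},{y,a,b},{y,b,x},{y,x,a}}"
proof -
  have 1: "insert_vertex T t x = (T - {{a,b,c}}) \<union> {{x,b,c},{x,c,a},{x,a,b}}"
    using insert_vertex_triangle t by simp
  have 2: "{x,a,b} \<notin> T" using x by blast
  have "b \<in> {x,a,b}" "b \<notin> {x,c,a}" "a \<in> {x,a,b}" "a \<notin> {x,b,c}" using t x_neq by simp_all
  then have 3: "{x,a,b} \<noteq> {x,c,a}" "{x,a,b} \<noteq> {x,b,c}" by metis+
  have "A \<union> {P,Q,R} - {R} \<union> {X,Y,Z} = A \<union> {P,Q,X,Y,Z}"
    if "R \<notin> A" "R \<noteq> P" "R \<noteq> Q" for A :: "'a set set" and P Q R X Y Z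
    using that by blast
  then show ?thesis
    unfolding T'_eq 1 using 2 3 insert_vertex_triangle[of x a b] x_neq t(2) by simp
qed

lemma T'_mem: "{x,b,c} \<in> T'" "{x,c,a} \<in> T'" "{y,a,b} \<in> T'" "{y,b,x} \<in> T'" "{y,x,a} \<in> T'"
  using T'_cases by auto

text \<open>Three explicit walks. The third pairs the exits of \<open>(a,c,b)\<close> and
  \<open>(b,c,a)\<close> as in \<open>T\<close>, so the strand at \<open>c\<close> leaves where it
  always did; the first two interchange ends between the strands at \<open>a\<close> and
  \<open>b\<close>. The remaining claims record all flags on the way.\<close>

lemma walk_related:
  shows "(zstep T (c,b,a), zstep T (b,a,c)) \<in> zrel T'"
    and "(zstep T (c,a,b), zstep T (a,b,c)) \<in> zrel T'"
    and "(zstep T (a,c,b), zstep T (b,c,a)) \<in> zrel T'"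
    and "f \<in> {(a,b,y),(b,y,x),(y,x,a),(x,a,c)} \<Longrightarrow> (f, zstep T (b,a,c)) \<in> zrel T'"
    and "f \<in> {(b,a,y),(a,y,x),(y,x,b),(x,b,c)} \<Longrightarrow> (f, zstep T (a,b,c)) \<in> zrel T'"
    and "f \<in> {(b,c,x),(c,x,a),(x,a,y),(a,y,b),(y,b,x),(b,x,c),(x,c,a)}
      \<Longrightarrow> (f, zstep T (b,c,a)) \<in> zrel T'"
proof -
  have fl: "flags {t} = {(a,b,c),(b,c,a),(c,a,b),(c,b,a),(a,c,b),(b,a,c)}"
    using flags_triangle t by simp
  have mem: "(a,b,c) \<in> flags {t}" "(b,a,c) \<in> flags {t}" "(b,c,a) \<in> flags {t}" "(a,c,b) \<in> flags {t}"
      "(c,b,a) \<in> flags {t}" "(c,a,b) \<in> flags {t}"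
    using fl by auto
  have inT: "z \<in> flags T" if "z \<in> flags {t}" for z using that flags_split by blast
  \<comment> \<open>The vertex beyond an edge of \<open>t\<close> is an old one, hence different
    from \<open>x\<close> and \<open>y\<close>.\<close>
  have opp: "\<exists>r. zstep T (u,v,w) = (v,w,r) \<and> {v,w,r} \<in> T' \<and> r \<noteq> u \<and> r \<noteq> v \<and> r \<noteq> w \<and> r \<noteq> x \<and> r \<noteq> y"
    if uvw: "(u,v,w) \<in> flags {t}" for u v w
  proof -
    obtain r where r: "zstep T (u,v,w) = (v,w,r)" "{v,w,r} \<in> T" "r \<noteq> u" "r \<noteq> v" "r \<noteq> w"
      using zstep_obtain[OF T inT[OF uvw]] .
    have "{v,w,r} \<in> T'" using zstep_leaves[OF uvw] r(1) sub by auto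
    then show ?thesis using r x y by blast
  qed
  note tr = zrel_trans[OF T'] and sy = zrel_sym[OF T']
  note neqs = t(2-4) x_neq y(2)
  obtain p1 where p1: "zstep T (c,b,a) = (b,a,p1)" "{b,a,p1} \<in> T'" "p1 \<noteq> a" "p1 \<noteq> b" "p1 \<noteq> c" "p1 \<noteq> x" "p1 \<noteq> y"
    using opp[OF mem(5)] by blast
  obtain r1 where r1: "zstep T (b,a,c) = (a,c,r1)" "{a,c,r1} \<in> T'" "r1 \<noteq> a" "r1 \<noteq> b" "r1 \<noteq> c" "r1 \<noteq> x" "r1 \<noteq> y"
    using opp[OF mem(2)] by blast
  have w1: "zwalk T' [p1,a,b,y,x,a,c,r1]"
    using p1 r1 neqs T'_mem by (simp add: insert_commute)
  have e1: "((p1,a,b),(a,c,r1)) \<in> zrel T'" using zwalk_related[OF T' w1, of 5] by simp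
  show "(zstep T (c,b,a), zstep T (b,a,c)) \<in> zrel T'"
    using flip_zstep_flip_related[OF mem(5)] e1 p1(1) r1(1) by simp
  have "((p1,a,b),(a,b,y)) \<in> zrel T'" "((p1,a,b),(b,y,x)) \<in> zrel T'" "((p1,a,b),(y,x,a)) \<in> zrel T'"
       "((p1,a,b),(x,a,c)) \<in> zrel T'"
    using zwalk_related[OF T' w1, of 1] zwalk_related[OF T' w1, of 2] zwalk_related[OF T' w1, of 3]
      zwalk_related[OF T' w1, of 4] by simp_all
  then show "f \<in> {(a,b,y),(b,y,x),(y,x,a),(x,a,c)} \<Longrightarrow> (f, zstep T (b,a,c)) \<in> zrel T'"
    using sy tr e1 unfolding r1(1) by blast
  obtain p2 where p2: "zstep T (c,a,b) = (a,b,p2)" "{a,b,p2} \<in> T'" "p2 \<noteq> a" "p2 \<noteq> b" "p2 \<noteq> c" "p2 \<noteq> x" "p2 \<noteq> y"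
    using opp[OF mem(6)] by blast
  obtain r2 where r2: "zstep T (a,b,c) = (b,c,r2)" "{b,c,r2} \<in> T'" "r2 \<noteq> a" "r2 \<noteq> b" "r2 \<noteq> c" "r2 \<noteq> x" "r2 \<noteq> y"
    using opp[OF mem(1)] by blast
  have w2: "zwalk T' [p2,b,a,y,x,b,c,r2]"
    using p2 r2 neqs T'_mem by (simp add: insert_commute)
  have e2: "((p2,b,a),(b,c,r2)) \<in> zrel T'" using zwalk_related[OF T' w2, of 5] by simp
  show "(zstep T (c,a,b), zstep T (a,b,c)) \<in> zrel T'"
    using flip_zstep_flip_related[OF mem(6)] e2 p2(1) r2(1) by simp
  have "((p2,b,a),(b,a,y)) \<in> zrel T'" "((p2,b,a),(a,y,x)) \<in> zrel T'" "((p2,b,a),(y,x,b)) \<in> zrel T'"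
       "((p2,b,a),(x,b,c)) \<in> zrel T'"
    using zwalk_related[OF T' w2, of 1] zwalk_related[OF T' w2, of 2] zwalk_related[OF T' w2, of 3]
      zwalk_related[OF T' w2, of 4] by simp_all
  then show "f \<in> {(b,a,y),(a,y,x),(y,x,b),(x,b,c)} \<Longrightarrow> (f, zstep T (a,b,c)) \<in> zrel T'"
    using sy tr e2 unfolding r2(1) by blast
  obtain p3 where p3: "zstep T (a,c,b) = (c,b,p3)" "{c,b,p3} \<in> T'" "p3 \<noteq> a" "p3 \<noteq> b" "p3 \<noteq> c" "p3 \<noteq> x" "p3 \<noteq> y"
    using opp[OF mem(4)] by blast
  obtain r3 where r3: "zstep T (b,c,a) = (c,a,r3)" "{c,a,r3} \<in> T'" "r3 \<noteq> a" "r3 \<noteq> b" "r3 \<noteq> c" "r3 \<noteq> x" "r3 \<noteq> y"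
    using opp[OF mem(3)] by blast
  \<comment> \<open>The strand at \<open>c\<close> makes a tour through the new triangles, passing
    \<open>x\<close> twice.\<close>
  have w3: "zwalk T' [p3,b,c,x,a,y,b,x,c,a,r3]"
    using p3 r3 neqs T'_mem by (simp add: insert_commute)
  have e3: "((p3,b,c),(c,a,r3)) \<in> zrel T'" using zwalk_related[OF T' w3, of 8] by simp
  show "(zstep T (a,c,b), zstep T (b,c,a)) \<in> zrel T'"
    using flip_zstep_flip_related[OF mem(4)] e3 p3(1) r3(1) by simp
  have "((p3,b,c),(b,c,x)) \<in> zrel T'" "((p3,b,c),(c,x,a)) \<in> zrel T'" "((p3,b,c),(x,a,y)) \<in> zrel T'"
       "((p3,b,c),(a,y,b)) \<in> zrel T'" "((p3,b,c),(y,b,x)) \<in> zrel T'" "((p3,b,c),(b,x,c)) \<in> zrel T'"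
       "((p3,b,c),(x,c,a)) \<in> zrel T'"
    using zwalk_related[OF T' w3, of 1] zwalk_related[OF T' w3, of 2] zwalk_related[OF T' w3, of 3]
      zwalk_related[OF T' w3, of 4] zwalk_related[OF T' w3, of 5] zwalk_related[OF T' w3, of 6]
      zwalk_related[OF T' w3, of 7] by simp_all
  then show "f \<in> {(b,c,x),(c,x,a),(x,a,y),(a,y,b),(y,b,x),(b,x,c),(x,c,a)}
      \<Longrightarrow> (f, zstep T (b,c,a)) \<in> zrel T'"
    using sy tr e3 unfolding r3(1) by blast
qed

lemma meets_common:
  assumes f: "f \<in> flags T'"
  shows "\<exists>g\<in>flags (T - {t}). (f,g) \<in> zrel T'"
proof (cases "f \<in> flags (T - {t})")
  case True
  then show ?thesis using zrel_refl f by blast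
next
  case False
  \<comment> \<open>One direction of each of the 15 strands, three in each of the five new
    triangles: 4, 4 and 7 of them lie on the three walks.\<close>
  define W where "W = {(a,b,y),(b,y,x),(y,x,a),(x,a,c),(b,a,y),(a,y,x),(y,x,b),(x,b,c),
    (b,c,x),(c,x,a),(x,a,y),(a,y,b),(y,b,x),(b,x,c),(x,c,a)}"
  have fl: "flags {t} = {(a,b,c),(b,c,a),(c,a,b),(c,b,a),(a,c,b),(b,a,c)}"
    using flags_triangle t by simp
  have mem: "(a,b,c) \<in> flags {t}" "(b,a,c) \<in> flags {t}" "(b,c,a) \<in> flags {t}" using fl by auto
  have W: "\<exists>g\<in>flags (T - {t}). (h,g) \<in> zrel T'" if "h \<in> W" for h
  proof -
    have "(h, zstep T (b,a,c)) \<in> zrel T' \<or> (h, zstep T (a,b,c)) \<in> zrel T' \<or> (h, zstep T (b,c,a)) \<in> zrel T'"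
      using that walk_related(4-6) unfolding W_def by blast
    then show ?thesis using mem zstep_leaves by blast
  qed
  obtain u v w where f': "f = (u,v,w)" using prod_cases3 by blast
  have "{u,v,w} \<in> T'" "{u,v,w} \<notin> T - {t}" using f False f' by simp_all
  then have "{u,v,w} \<in> {{x,b,c},{x,c,a},{y,a,b},{y,b,x},{y,x,a}}"
    unfolding T'_cases t(1) by (meson Un_iff)
  then have f5: "f \<in> flags {{x,b,c}} \<or> f \<in> flags {{x,c,a}} \<or> f \<in> flags {{y,a,b}} \<or>
      f \<in> flags {{y,b,x}} \<or> f \<in> flags {{y,x,a}}"
    using f f' by simp
  have six: "f \<in> W \<or> flip f \<in> W"
    if "f \<in> flags {{p,q,r}}" "p \<noteq> q" "q \<noteq> r" "p \<noteq> r"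
      "(p,q,r) \<in> W \<or> (r,q,p) \<in> W" "(q,r,p) \<in> W \<or> (p,r,q) \<in> W" "(r,p,q) \<in> W \<or> (q,p,r) \<in> W"
    for p q r
    using that(1,5-7) unfolding flags_triangle[OF that(2-4)] by (elim insertE emptyE) auto
  note neqs = t(2-4) x_neq y(2)
  from f5 have "f \<in> W \<or> flip f \<in> W"
  proof (elim disjE)
    assume "f \<in> flags {{x,b,c}}" then show ?thesis
      by (rule six) (use neqs in \<open>simp_all add: W_def\<close>)
  next
    assume "f \<in> flags {{x,c,a}}" then show ?thesis
      by (rule six) (use neqs in \<open>simp_all add: W_def\<close>)
  next
    assume "f \<in> flags {{y,a,b}}" then show ?thesis
      by (rule six) (use neqs in \<open>simp_all add: W_def\<close>)
  next
    assume "f \<in> flags {{y,b,x}}" then show ?thesis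
      by (rule six) (use neqs in \<open>simp_all add: W_def\<close>)
  next
    assume "f \<in> flags {{y,x,a}}" then show ?thesis
      by (rule six) (use neqs in \<open>simp_all add: W_def\<close>)
  qed
  then show ?thesis
  proof
    assume "flip f \<in> W"
    then obtain g where g: "g \<in> flags (T - {t})" "(flip f, g) \<in> zrel T'" using W by blast
    then show ?thesis using zrel_trans[OF T' zrel_flip[OF f]] by blast
  qed (rule W)
qed

text \<open>Here the outer matching joins the exits of \<open>(b,a,c)\<close> and
  \<open>(b,c,a)\<close>, and those of \<open>(a,c,b)\<close> and \<open>(c,a,b)\<close>. A single
  star would join the latter two again and split off a 2-cycle; the double star yields a
  hexagon.\<close>

lemma fewer_classes_twice:
  assumes un: "((a,b,c),(b,a,c)) \<notin> zrel T"
    and B: "first_ret T t (a,b,c) = (a,b,c)"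
    and cs: "first_ret T t (b,a,c) = (a,c,b)" "first_ret T t (a,c,b) = (b,a,c)"
  shows "card (flags T' // zrel T') < card (flags T // zrel T)"
proof -
  let ?E = "zstep T"
  have fl: "flags {t} = {(a,b,c),(b,c,a),(c,a,b),(c,b,a),(a,c,b),(b,a,c)}"
    using flags_triangle t by simp
  have mem: "(a,b,c) \<in> flags {t}" "(b,a,c) \<in> flags {t}" "(a,c,b) \<in> flags {t}" using fl by auto
  note tr = zrel_trans[OF T'] and sy = zrel_sym[OF T']
  have b: "(?E (a,b,c), ?E (c,b,a)) \<in> zrel T'" using first_return_related[OF mem(1)] B by simp
  have c1: "(?E (b,a,c), ?E (b,c,a)) \<in> zrel T'" "(?E (a,c,b), ?E (c,a,b)) \<in> zrel T'"
    using first_return_related[OF mem(2)] first_return_related[OF mem(3)] cs by auto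
  have ba: "(?E (b,a,c), ?E (c,b,a)) \<in> zrel T'" using walk_related(1) sy by blast
  have bb: "(?E (b,a,c), ?E (a,b,c)) \<in> zrel T'" using ba b tr sy by blast
  have bc: "(?E (b,a,c), ?E (c,a,b)) \<in> zrel T'" using bb walk_related(2) tr sy by blast
  have bd: "(?E (b,a,c), ?E (a,c,b)) \<in> zrel T'" using bc c1(2) tr sy by blast
  have be: "(?E (b,a,c), ?E (b,a,c)) \<in> zrel T'" using ba tr sy by blast
  have hub: "(?E (b,a,c), ?E z) \<in> zrel T'" if "z \<in> flags {t}" for z
    using that c1(1) ba bb bc bd be unfolding fl by blast
  show ?thesis
    using fewer_classes[OF merged_if_hub[OF hub] meets_common mem(1,2) un] by blast
qed

end

section \<open>Finding a triangle that meets several zigzags\<close>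

definition edge_adjacent :: "'a set set \<Rightarrow> 'a set \<Rightarrow> 'a set \<Rightarrow> bool" where
  "edge_adjacent T s t \<longleftrightarrow> s \<in> T \<and> t \<in> T \<and> card (s \<inter> t) = 2"

text \<open>A zigzag crosses the common edge from one triangle into the other.\<close>

lemma related_if_adjacent:
  assumes T: "closed_complex T" and st: "edge_adjacent T s t"
  obtains f g where "f \<in> flags {s}" "g \<in> flags {t}" "(f,g) \<in> zrel T"
proof -
  have s: "s \<in> T" "card s = 3" "t \<in> T" "card t = 3" "card (s \<inter> t) = 2"
    using T st by (auto simp: edge_adjacent_def closed_complex_def)
  obtain b c where bc: "s \<inter> t = {b,c}" "b \<noteq> c" using s(5) by (auto simp: card_2_iff)
  have "finite s" "finite t" using s by (simp_all add: card_ge_0_finite)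
  then have "card (s - t) = 1" "card (t - s) = 1"
    using s card_Diff_subset_Int[of s t] card_Diff_subset_Int[of t s] by (simp_all add: Int_commute)
  then obtain a d where ad: "s - t = {a}" "t - s = {d}" by (auto simp: card_1_singleton_iff)
  then have st: "s = {a,b,c}" "t = {b,c,d}" "a \<noteq> b" "a \<noteq> c" "d \<noteq> b" "d \<noteq> c" "d \<noteq> a" using bc by blast+
  then have "zstep T (a,b,c) = (b,c,d)" using s bc by (intro zstep_eq[OF T]) auto
  moreover have "(a,b,c) \<in> flags T" using st s bc by simp
  ultimately have "((a,b,c),(b,c,d)) \<in> zrel T" using zrel_zstep by metis
  then show ?thesis using that[of "(a,b,c)" "(b,c,d)"] st bc by simp
qed

text \<open>Read contrapositively: if there are unrelated flags at all, then some single triangle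
  already carries two of them.\<close>

lemma zrel_all:
  assumes T: "closed_complex T"
    and conn: "\<And>s t. s \<in> T \<Longrightarrow> t \<in> T \<Longrightarrow> (edge_adjacent T)\<^sup>*\<^sup>* s t"
    and loc: "\<And>t f g. t \<in> T \<Longrightarrow> f \<in> flags {t} \<Longrightarrow> g \<in> flags {t} \<Longrightarrow> (f,g) \<in> zrel T"
    and f: "f \<in> flags T" and g: "g \<in> flags T"
  shows "(f,g) \<in> zrel T"
proof -
  have fl: "\<exists>s\<in>T. f \<in> flags {s}" if "f \<in> flags T" for f using that by (cases f) auto
  obtain s t where st: "s \<in> T" "t \<in> T" "f \<in> flags {s}" "g \<in> flags {t}" using fl f g by blast
  from conn[OF st(1,2)] have "\<forall>g\<in>flags {t}. (f,g) \<in> zrel T"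
  proof (induction rule: rtranclp_induct)
    case base
    then show ?case using loc st by blast
  next
    case (step p q)
    obtain h k where hk: "h \<in> flags {p}" "k \<in> flags {q}" "(h,k) \<in> zrel T"
      using related_if_adjacent[OF T step(2)] .
    have "q \<in> T" using step(2) by (simp add: edge_adjacent_def)
    then show ?case using hk step.IH loc zrel_trans[OF T] by blast
  qed
  then show ?thesis using st by blast
qed

text \<open>Three strands that are not all equivalent include one equivalent to neither of the
  others; the vertices are renamed so that \<open>b\<close> is its middle vertex.\<close>

lemma exists_lone_strand:
  assumes T: "closed_complex T" and t: "t \<in> T"
    and f: "f \<in> flags {t}" and g: "g \<in> flags {t}" and fg: "(f,g) \<notin> zrel T"
  obtains a b c where "t = {a,b,c}" "a \<noteq> b" "b \<noteq> c" "a \<noteq> c"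
    "((a,b,c),(b,a,c)) \<notin> zrel T" "((a,b,c),(b,c,a)) \<notin> zrel T"
proof -
  obtain p q r where pqr: "f = (p,q,r)" using prod_cases3 by blast
  have t': "t = {p,q,r}" "p \<noteq> q" "q \<noteq> r" "p \<noteq> r" using f pqr by simp_all
  have fl: "flags {t} = {(p,q,r),(q,r,p),(r,p,q),(r,q,p),(p,r,q),(q,p,r)}"
    using flags_triangle t' by simp
  have mem: "z \<in> flags T" if "z \<in> flags {t}" for z using that t by (cases z) auto
  have fz: "(z, flip z) \<in> zrel T" "(flip z, z) \<in> zrel T" if "z \<in> flags {t}" for z
    using zrel_flip mem[OF that] zrel_sym[OF T] by blast+
  have fzs: "((p,q,r),(r,q,p)) \<in> zrel T" "((r,q,p),(p,q,r)) \<in> zrel T"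
    "((q,r,p),(p,r,q)) \<in> zrel T" "((p,r,q),(q,r,p)) \<in> zrel T"
    "((r,p,q),(q,p,r)) \<in> zrel T" "((q,p,r),(r,p,q)) \<in> zrel T"
    using fz[of "(p,q,r)"] fz[of "(q,r,p)"] fz[of "(r,p,q)"] fl by auto
  note tr = zrel_trans[OF T] and sy = zrel_sym[OF T]
  have notall: "\<not> (((p,q,r),(q,r,p)) \<in> zrel T \<and> ((p,q,r),(r,p,q)) \<in> zrel T)"
  proof
    assume A: "((p,q,r),(q,r,p)) \<in> zrel T \<and> ((p,q,r),(r,p,q)) \<in> zrel T"
    have "((p,q,r),(p,q,r)) \<in> zrel T" "((p,q,r),(p,r,q)) \<in> zrel T" "((p,q,r),(q,p,r)) \<in> zrel T"
      using A fzs tr by blast+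
    then have "((p,q,r),g) \<in> zrel T" using A fzs(1) g unfolding fl by auto
    then show False using fg pqr by simp
  qed
  show ?thesis
  proof (cases "((p,q,r),(q,r,p)) \<in> zrel T")
    case True
    then have "((p,q,r),(r,p,q)) \<notin> zrel T" using notall by blast
    then have "((r,p,q),(p,q,r)) \<notin> zrel T" "((r,p,q),(q,r,p)) \<notin> zrel T"
      using True tr sy by blast+
    then have "((r,p,q),(p,q,r)) \<notin> zrel T" "((r,p,q),(p,r,q)) \<notin> zrel T" using fzs tr by blast+
    then show ?thesis by (intro that[of r p q]) (use t' in \<open>auto\<close>)
  next
    case 1: False
    show ?thesis
    proof (cases "((p,q,r),(r,p,q)) \<in> zrel T")
      case True
      then have "((q,r,p),(r,p,q)) \<notin> zrel T" "((q,r,p),(p,q,r)) \<notin> zrel T" using 1 tr sy by blast+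
      then have "((q,r,p),(r,q,p)) \<notin> zrel T" "((q,r,p),(r,p,q)) \<notin> zrel T" using fzs tr by blast+
      then show ?thesis by (intro that[of q r p]) (use t' in \<open>auto\<close>)
    next
      case False
      then have "((p,q,r),(q,p,r)) \<notin> zrel T" using fzs tr by blast
      then show ?thesis using that[of p q r] t' 1 by blast
    qed
  qed
qed

text \<open>Which alternative holds is decided in \<open>T\<close> before any new vertex is named,
  so that the geometry can later supply the points \<open>x\<close> and \<open>y\<close>, and with
  them the fact that \<open>T'\<close> is a closed complex.\<close>

theorem exists_reducing_insertion:
  assumes T: "closed_complex T"
    and conn: "\<And>s t. s \<in> T \<Longrightarrow> t \<in> T \<Longrightarrow> (edge_adjacent T)\<^sup>*\<^sup>* s t"
    and f: "f \<in> flags T" and g: "g \<in> flags T" and fg: "(f,g) \<notin> zrel T"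
  obtains a b c where "{a,b,c} \<in> T" "a \<noteq> b" "b \<noteq> c" "a \<noteq> c"
    "(\<forall>x T'. x \<notin> \<Union>T \<longrightarrow> T' = insert_vertex T {a,b,c} x \<longrightarrow> closed_complex T' \<longrightarrow>
       card (flags T' // zrel T') < card (flags T // zrel T)) \<or>
     (\<forall>x y T'. x \<notin> \<Union>T \<longrightarrow> y \<notin> \<Union>T \<longrightarrow> y \<noteq> x \<longrightarrow>
       T' = insert_vertex (insert_vertex T {a,b,c} x) {x,a,b} y \<longrightarrow> closed_complex T' \<longrightarrow>
       card (flags T' // zrel T') < card (flags T // zrel T))"
proof -
  obtain t h k where t: "t \<in> T" "h \<in> flags {t}" "k \<in> flags {t}" "(h,k) \<notin> zrel T"
    using zrel_all[OF T conn _ f g] fg by blast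
  obtain a b c where abc: "t = {a,b,c}" "a \<noteq> b" "b \<noteq> c" "a \<noteq> c"
    and un: "((a,b,c),(b,a,c)) \<notin> zrel T" "((a,b,c),(b,c,a)) \<notin> zrel T"
    using exists_lone_strand[OF T t] by metis
  \<comment> \<open>The analysis of the returns speaks of \<open>T\<close> only, so it is used with
    \<open>T' = T\<close>.\<close>
  interpret R: replaced_triangle T T t using T t(1) by unfold_locales auto
  have B: "first_ret T t (a,b,c) = (a,b,c)" using R.strand_cases[OF abc un] by blast
  show ?thesis
  proof (cases "first_ret T t (b,a,c) = (a,c,b) \<and> first_ret T t (a,c,b) = (b,a,c)")
    case True
    have "card (flags T' // zrel T') < card (flags T // zrel T)"
      if "x \<notin> \<Union>T" "y \<notin> \<Union>T" "y \<noteq> x" "T' = insert_vertex (insert_vertex T {a,b,c} x) {x,a,b} y"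
        "closed_complex T'" for x y T'
    proof -
      have "{x,a,b} \<notin> T" using that(1) by blast
      then interpret twice_inserted_vertex T T' t a b c x y
        using that T t(1) abc by unfold_locales (auto simp: insert_vertex_def)
      show ?thesis using fewer_classes_twice un(1) B True by blast
    qed
    then show ?thesis using that[of a b c] t(1) abc by blast
  next
    case False
    have "card (flags T' // zrel T') < card (flags T // zrel T)"
      if "x \<notin> \<Union>T" "T' = insert_vertex T {a,b,c} x" "closed_complex T'" for x T'
    proof -
      interpret inserted_vertex T T' t x
        using that T t(1) abc by unfold_locales (auto simp: insert_vertex_def)
      show ?thesis using fewer_classes_insert[OF abc un(1) B] R.strand_cases[OF abc un] False by blast
    qed
    then show ?thesis using that[of a b c] t(1) abc by blast
  qed
qed

section \<open>Discs in a surface\<close>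

text \<open>Each member is also closed, its complement being the union of the other open members,
  and a nonempty connected clopen set is a component.\<close>

lemma connected_components_of_partition:
  assumes un: "\<Union>\<C> = topspace X" and dj: "pairwise disjnt \<C>"
    and C: "\<And>C. C \<in> \<C> \<Longrightarrow> openin X C \<and> connectedin X C \<and> C \<noteq> {}"
  shows "connected_components_of X = \<C>"
proof -
  have comp: "connected_component_of_set X x = C" if "C \<in> \<C>" "x \<in> C" for C x
  proof
    have "topspace X - C = \<Union>(\<C> - {C})"
      using un dj that(1) by (auto simp: pairwise_def disjnt_iff)
    then have "closedin X C"
      using C that(1) by (auto simp: closedin_def openin_subset intro!: openin_Union)
    moreover have "\<not> disjnt (connected_component_of_set X x) C"
      using that C connected_component_of_refl[of X x] openin_subset
      by (metis disjnt_iff mem_Collect_eq subsetD)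
    ultimately show "connected_component_of_set X x \<subseteq> C"
      using connectedin_clopen_cases[OF connectedin_connected_component_of] C that(1) by metis
    show "C \<subseteq> connected_component_of_set X x"
      using C that by (simp add: connected_component_of_maximal)
  qed
  show ?thesis
  proof
    show "connected_components_of X \<subseteq> \<C>"
    proof
      fix D assume "D \<in> connected_components_of X"
      then obtain x where x: "x \<in> topspace X" "D = connected_component_of_set X x"
        by (auto simp: connected_components_of_def)
      then obtain C where "C \<in> \<C>" "x \<in> C" using un by blast
      then show "D \<in> \<C>" using comp x(2) by simp
    qed
    show "\<C> \<subseteq> connected_components_of X"
    proof
      fix D assume D: "D \<in> \<C>"
      then obtain x where "x \<in> D" using C by blast
      then show "D \<in> connected_components_of X"
        using comp[OF D] un D unfolding connected_components_of_def by blast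
    qed
  qed
qed

lemma homeomorphic_imp_homeomorphic_space:
  assumes "S homeomorphic T" shows "top_of_set S homeomorphic_space top_of_set T"
proof -
  obtain f g where "homeomorphism S T f g" using assms by (auto simp: homeomorphic_def)
  then have "homeomorphic_maps (top_of_set S) (top_of_set T) f g"
    by (auto simp: homeomorphic_maps_def homeomorphism_def)
  then show ?thesis unfolding homeomorphic_space_def by blast
qed

text \<open>Continuous injections of a compact space into a Hausdorff space are embeddings.\<close>

lemma arc_joining_iff:
  assumes "Hausdorff_space M"
  shows "arc_joining M u v e \<longleftrightarrow> (\<exists>p. continuous_map (top_of_set {0..1::real}) M p \<and>
    inj_on p {0..1} \<and> p ` {0..1} = e \<and> p 0 = u \<and> p 1 = v)"
proof -
  have "embedding_map (top_of_set {0..1::real}) M p \<longleftrightarrow>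
    continuous_map (top_of_set {0..1::real}) M p \<and> inj_on p {0..1}" for p
  proof
    assume "embedding_map (top_of_set {0..1::real}) M p"
    then show "continuous_map (top_of_set {0..1::real}) M p \<and> inj_on p {0..1}"
      unfolding embedding_map_def
      by (metis continuous_map_in_subtopology homeomorphic_imp_continuous_map
          homeomorphic_imp_injective_map topspace_euclidean_subtopology)
  next
    assume "continuous_map (top_of_set {0..1::real}) M p \<and> inj_on p {0..1}"
    then show "embedding_map (top_of_set {0..1::real}) M p"
      using assms by (intro continuous_imp_embedding_map) (auto simp: compact_space_subtopology)
  qed
  then show ?thesis unfolding arc_joining_def by (simp add: conj_assoc)
qed

lemma arc_joining_sym:
  assumes "Hausdorff_space M" "arc_joining M u v e"
  shows "arc_joining M v u e"
proof -
  obtain p where p: "continuous_map (top_of_set {0..1::real}) M p" "inj_on p {0..1}" "p ` {0..1} = e" "p 0 = u" "p 1 = v"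
    using assms by (auto simp: arc_joining_iff)
  let ?r = "\<lambda>t::real. 1 - t"
  have r: "?r ` {0..1} = {0..1}" by (auto simp: image_iff intro: bexI[of _ "1 - _"])
  have "continuous_map (top_of_set {0..1::real}) (top_of_set {0..1::real}) ?r"
    by (auto intro!: continuous_intros)
  then have "continuous_map (top_of_set {0..1::real}) M (p \<circ> ?r)" using p(1) continuous_map_compose by blast
  moreover have "inj_on (p \<circ> ?r) {0..1}"
    by (rule comp_inj_on) (use p(2) r in \<open>auto simp: inj_on_def\<close>)
  moreover have "(p \<circ> ?r) ` {0..1} = e" using p(3) r by (metis image_comp)
  ultimately show ?thesis unfolding arc_joining_iff[OF assms(1)] using p(4,5)
    by (intro exI[of _ "p \<circ> ?r"]) simp
qed

lemma joined_rtranclp_sym: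
  assumes "Hausdorff_space M" "(joined M \<Gamma>)\<^sup>*\<^sup>* u v"
  shows "(joined M \<Gamma>)\<^sup>*\<^sup>* v u"
proof -
  have "symp (joined M \<Gamma>)" using arc_joining_sym[OF assms(1)] unfolding joined_def by (intro sympI) blast
  then show ?thesis using assms(2) by (metis sympD symp_rtranclp)
qed

locale disc_chart =
  fixes M :: "'a topology" and k :: "real^2 \<Rightarrow> 'a"
  assumes Haus: "Hausdorff_space M"
    and emb: "embedding_map (top_of_set (cball 0 1)) M k"
begin

lemma cont: "continuous_map (top_of_set (cball 0 1)) M k"
  using emb unfolding embedding_map_def
  by (metis continuous_map_in_subtopology homeomorphic_imp_continuous_map)

lemma inj: "inj_on k (cball 0 1)"
  using emb unfolding embedding_map_def
  by (metis homeomorphic_imp_injective_map topspace_euclidean_subtopology)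

lemma cont_subset: "S \<subseteq> cball 0 1 \<Longrightarrow> continuous_map (top_of_set S) M k"
  using cont continuous_map_from_subtopology_mono by blast

lemma image_topspace: "k ` cball 0 1 \<subseteq> topspace M"
  using continuous_map_image_subset_topspace[OF cont] by simp

lemma compactin_image:
  assumes "compact S" "S \<subseteq> cball 0 1" shows "compactin M (k ` S)"
  by (rule image_compactin[OF _ cont_subset[OF assms(2)]])
    (use assms in \<open>simp add: compactin_subtopology\<close>)

lemma closedin_image: "compact S \<Longrightarrow> S \<subseteq> cball 0 1 \<Longrightarrow> closedin M (k ` S)"
  using compactin_image compactin_imp_closedin[OF Haus] by blast

lemma connectedin_image:
  assumes "connected S" "S \<subseteq> cball 0 1" shows "connectedin M (k ` S)"
  by (rule connectedin_continuous_map_image[OF cont_subset[OF assms(2)]])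
    (use assms in \<open>simp add: connectedin_subtopology\<close>)

lemma closure_of_image:
  assumes S: "S \<subseteq> cball 0 1"
  shows "M closure_of (k ` S) = k ` closure S"
proof
  have cl: "closure S \<subseteq> cball 0 1" using S by (simp add: closure_minimal)
  then have "compact (closure S)" using S by (meson bounded_cball bounded_subset compact_closure)
  then have "closedin M (k ` closure S)" using closedin_image cl by blast
  then show "M closure_of (k ` S) \<subseteq> k ` closure S"
    by (metis closure_of_minimal closure_subset image_mono)
  have "(top_of_set (cball 0 1)) closure_of S = closure S"
    using S cl by (simp add: closure_of_subtopology Int_absorb1)
  then show "k ` closure S \<subseteq> M closure_of (k ` S)"
    using continuous_map_image_closure_subset[OF cont, of S] by simp
qed

text \<open>An embedded disc in an arbitrary Hausdorff space need not have an open interior, hence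
  the first assumption. On a surface it comes from invariance of domain, for the open hemispheres
  from a strict inequality.\<close>

lemma openin_image:
  assumes op: "openin M (k ` ball 0 1)" and S: "open S" "S \<subseteq> ball 0 1"
  shows "openin M (k ` S)"
proof -
  have "openin (top_of_set (cball 0 1)) S"
    using S by (metis ball_subset_cball open_openin_trans open_subset subset_trans open_subset)
  then have "openin (subtopology M (k ` cball 0 1)) (k ` S)"
    using emb unfolding embedding_map_def by (metis homeomorphic_imp_open_map open_map_def topspace_euclidean_subtopology)
  then obtain T where T: "openin M T" "k ` S = T \<inter> k ` cball 0 1" by (auto simp: openin_subtopology)
  have "k ` S \<subseteq> k ` ball 0 1" "k ` ball 0 1 \<subseteq> k ` cball 0 1"
    using S(2) by (auto intro: image_mono)
  then have "k ` S = T \<inter> k ` ball 0 1" using T(2) by blast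
  then show ?thesis using T(1) op by auto
qed

lemma embedding_subset: "S \<subseteq> cball 0 1 \<Longrightarrow> embedding_map (top_of_set S) M k"
proof -
  assume S: "S \<subseteq> cball 0 1"
  have "homeomorphic_map (subtopology (top_of_set (cball 0 1)) S) (subtopology (subtopology M (k ` cball 0 1)) (k ` S)) k"
    by (rule homeomorphic_map_subtopologies)
      (use emb S image_topspace in \<open>auto simp: embedding_map_def\<close>)
  then show ?thesis
    using S unfolding embedding_map_def subtopology_subtopology
    by (simp add: Int_absorb1 image_mono)
qed

lemma homeomorphic_image:
  assumes "S \<subseteq> cball 0 1" "S homeomorphic T"
  shows "subtopology M (k ` S) homeomorphic_space top_of_set T"
proof -
  have "top_of_set S homeomorphic_space subtopology M (k ` S)"
    using embedding_map_imp_homeomorphic_space[OF embedding_subset[OF assms(1)]] by simp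
  then show ?thesis
    using assms(2) homeomorphic_space_sym homeomorphic_space_trans homeomorphic_imp_homeomorphic_space by blast
qed

definition k' :: "'a \<Rightarrow> real^2" where "k' = inv_into (cball 0 1) k"

lemma k'_k [simp]: "x \<in> cball 0 1 \<Longrightarrow> k' (k x) = x"
  unfolding k'_def using inv_into_f_f[OF inj] .

lemma k_k': "y \<in> k ` cball 0 1 \<Longrightarrow> k (k' y) = y" "y \<in> k ` cball 0 1 \<Longrightarrow> k' y \<in> cball 0 1"
  unfolding k'_def by (simp add: f_inv_into_f, rule inv_into_into)

lemma cont': "continuous_map (subtopology M (k ` cball 0 1)) (top_of_set (cball 0 1)) k'"
proof -
  have "homeomorphic_map (top_of_set (cball 0 1)) (subtopology M (k ` cball 0 1)) k"
    using emb unfolding embedding_map_def by simp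
  then obtain g where g: "homeomorphic_maps (top_of_set (cball 0 1)) (subtopology M (k ` cball 0 1)) k g"
    by (auto simp: homeomorphic_map_maps)
  then have "continuous_map (subtopology M (k ` cball 0 1)) (top_of_set (cball 0 1)) g"
    by (simp add: homeomorphic_maps_def)
  moreover have "g y = k' y" if "y \<in> topspace (subtopology M (k ` cball 0 1))" for y
    using g that by (auto simp: homeomorphic_maps_def)
  ultimately show ?thesis by (metis continuous_map_eq)
qed

lemma image_Int: "S \<subseteq> cball 0 1 \<Longrightarrow> T \<subseteq> cball 0 1 \<Longrightarrow> k ` S \<inter> k ` T = k ` (S \<inter> T)"
  using inj_on_image_Int[OF inj] by blast

lemma image_subset_iff: "S \<subseteq> cball 0 1 \<Longrightarrow> T \<subseteq> cball 0 1 \<Longrightarrow> k ` S \<subseteq> k ` T \<longleftrightarrow> S \<subseteq> T"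
  using inj_on_image_subset_iff[OF inj] .

lemma image_k': "e \<subseteq> k ` cball 0 1 \<Longrightarrow> k ` (k' ` e) = e"
  using k_k' by (force simp: image_image)

text \<open>Brings edges into the plane disc, where cones can be formed over them.\<close>

lemma arc_k':
  assumes "arc_joining M u v e" "e \<subseteq> k ` cball 0 1"
  obtains q where "arc q" "path_image q = k' ` e" "q 0 = k' u" "q 1 = k' v"
proof -
  obtain p where p: "continuous_map (top_of_set {0..1::real}) M p" "inj_on p {0..1}" "p ` {0..1} = e" "p 0 = u" "p 1 = v"
    using assms by (auto simp: arc_joining_iff[OF Haus])
  have "continuous_map (top_of_set {0..1}) (subtopology M (k ` cball 0 1)) p"
    using p(1,3) assms(2) by (auto simp: continuous_map_in_subtopology)
  then have "continuous_map (top_of_set {0..1}) (top_of_set (cball 0 1)) (k' \<circ> p)"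
    using cont' continuous_map_compose by blast
  then have "path (k' \<circ> p)" by (simp add: path_def)
  moreover have "inj_on (k' \<circ> p) {0..1}"
    using p(2,3) assms(2) k_k'(1) by (intro comp_inj_on) (auto intro!: inj_on_inverseI[of _ k])
  moreover have "path_image (k' \<circ> p) = k' ` e" using p(3) by (auto simp: path_image_def)
  ultimately show ?thesis using that[of "k' \<circ> p"] p(4,5) by (simp add: arc_def)
qed

lemma arc_joining_image:
  assumes "arc q" "path_image q \<subseteq> cball 0 1"
  shows "arc_joining M (k (q 0)) (k (q 1)) (k ` path_image q)"
proof -
  have "continuous_map (top_of_set {0..1}) (top_of_set (cball 0 1)) q"
    using assms by (auto simp: arc_def path_def path_image_def)
  then have "continuous_map (top_of_set {0..1}) M (k \<circ> q)" using cont continuous_map_compose by blast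
  moreover have "inj_on (k \<circ> q) {0..1}"
    using assms inj by (intro comp_inj_on) (auto simp: arc_def path_image_def intro: inj_on_subset)
  moreover have "(k \<circ> q) ` {0..1} = k ` path_image q" by (simp add: path_image_def image_comp)
  ultimately show ?thesis unfolding arc_joining_iff[OF Haus] by (intro exI[of _ "k \<circ> q"]) simp
qed

end

section \<open>Starring a face\<close>

lemma embedded_edge:
  assumes "embedded_simple_graph M \<Gamma>" "e \<in> edges \<Gamma>"
  obtains u v where "u \<in> vertices \<Gamma>" "v \<in> vertices \<Gamma>" "u \<noteq> v" "arc_joining M u v e" "e \<inter> vertices \<Gamma> = {u,v}"
proof -
  obtain u v where uv: "u \<in> vertices \<Gamma>" "v \<in> vertices \<Gamma>" "arc_joining M u v e" "e \<inter> vertices \<Gamma> = {u,v}"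
    using assms unfolding embedded_simple_graph_def by metis
  then obtain p where p: "embedding_map (top_of_set {0..1::real}) M p" "p 0 = u" "p 1 = v"
    by (auto simp: arc_joining_def)
  then have "inj_on p {0..1}"
    unfolding embedding_map_def
    by (metis homeomorphic_imp_injective_map topspace_euclidean_subtopology)
  then have "u \<noteq> v" using p(2,3) inj_onD[of p "{0..1}" 0 1] by auto
  then show ?thesis using that uv by blast
qed

lemma edges_Int:
  assumes "embedded_simple_graph M \<Gamma>" "e \<in> edges \<Gamma>" "f \<in> edges \<Gamma>" "e \<noteq> f"
  shows "e \<inter> f = {} \<or> (\<exists>v\<in>vertices \<Gamma>. e \<inter> f = {v})"
  using assms unfolding embedded_simple_graph_def by blast

lemma edge_eqI:
  assumes "embedded_simple_graph M \<Gamma>" "e \<in> edges \<Gamma>" "f \<in> edges \<Gamma>" "u \<in> e \<inter> f" "v \<in> e \<inter> f" "u \<noteq> v"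
  shows "e = f"
proof (rule ccontr)
  assume "e \<noteq> f"
  then obtain w where "e \<inter> f \<subseteq> {w}" using edges_Int[OF assms(1-3)] by (metis empty_subsetI subset_refl)
  then show False using assms(4-6) by (metis singletonD subsetD)
qed

lemma edge_subset_eq:
  assumes "embedded_simple_graph M \<Gamma>" "e \<in> edges \<Gamma>" "f \<in> edges \<Gamma>" "e \<subseteq> f"
  shows "e = f"
proof -
  obtain u v where "u \<noteq> v" "e \<inter> vertices \<Gamma> = {u,v}" using embedded_edge[OF assms(1,2)] by metis
  then show ?thesis using edge_eqI[OF assms(1-3), of u v] assms(4) by blast
qed

text \<open>Distinct faces may share several edges here, so that the locale also covers the sphere with the two
  hemispheres as its only faces.\<close>

locale pierced_face = disc_chart M k for M :: "'a topology" and k +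
  fixes \<Gamma> :: "'a drawn_graph"
  assumes graph: "embedded_simple_graph M \<Gamma>"
    and comp: "k ` ball 0 1 \<in> connected_components_of (subtopology M (topspace M - skeleton \<Gamma>))"
    and comps_open: "\<And>C. C \<in> connected_components_of (subtopology M (topspace M - skeleton \<Gamma>)) \<Longrightarrow> openin M C"
    and boundary: "k ` sphere 0 1 = \<Union>{e\<in>edges \<Gamma>. e \<subseteq> k ` cball 0 1}"
    and degree: "\<And>v. v \<in> vertices \<Gamma> \<Longrightarrow> v \<in> k ` cball 0 1 \<Longrightarrow>
      card {e\<in>edges \<Gamma>. e \<subseteq> k ` cball 0 1 \<and> v \<in> e} = 2"
begin

abbreviation F :: "'a set" where "F \<equiv> k ` cball 0 1"
abbreviation C0 :: "'a set" where "C0 \<equiv> k ` ball 0 1"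
definition EF :: "'a set set" where "EF = {e\<in>edges \<Gamma>. e \<subseteq> F}"
definition W :: "'a set" where "W = vertices \<Gamma> \<inter> F"

definition spoke :: "'a \<Rightarrow> 'a set" where "spoke w = k ` cone {k' w}"
definition sector :: "'a set \<Rightarrow> 'a set" where "sector e = k ` cone (k' ` e)"
text \<open>The end points of the edge are removed because the radii towards them are the
  spokes.\<close>

definition open_sector :: "'a set \<Rightarrow> 'a set" where "open_sector e = k ` open_cone (k' ` e - k' ` W)"

definition star :: "'a drawn_graph" where
  "star = \<lparr>vertices = insert (k 0) (vertices \<Gamma>), edges = edges \<Gamma> \<union> spoke ` W\<rparr>"

lemma open_C0: "openin M C0" using comps_open comp by blast

lemma C0_skeleton: "C0 \<inter> skeleton \<Gamma> = {}"
  using connected_components_of_subset[OF comp] by auto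

lemma k0: "k 0 \<in> C0" "k 0 \<in> F" "k 0 \<notin> vertices \<Gamma>" "e \<in> edges \<Gamma> \<Longrightarrow> k 0 \<notin> e"
proof -
  show "k 0 \<in> C0" "k 0 \<in> F" by auto
  then show "k 0 \<notin> vertices \<Gamma>" "e \<in> edges \<Gamma> \<Longrightarrow> k 0 \<notin> e" 
    using C0_skeleton unfolding skeleton_def by blast+
qed

lemma F_split: "F = C0 \<union> k ` sphere 0 1" "C0 \<inter> k ` sphere 0 1 = {}"
proof -
  have "cball 0 1 = ball 0 1 \<union> sphere (0::real^2) 1" by auto
  then show "F = C0 \<union> k ` sphere 0 1" by (metis image_Un)
  have "C0 \<inter> k ` sphere 0 1 = k ` (ball 0 1 \<inter> sphere 0 1)" by (rule image_Int) auto
  moreover have "ball 0 1 \<inter> sphere 0 1 = ({}::(real^2) set)" by auto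
  ultimately show "C0 \<inter> k ` sphere 0 1 = {}" by simp
qed

lemma sphere_iff: "y \<in> k ` sphere 0 1 \<longleftrightarrow> y \<in> F \<and> y \<notin> C0" using F_split by blast

lemma k'_sphere: "y \<in> k ` sphere 0 1 \<Longrightarrow> k' y \<in> sphere 0 1"
  by (auto simp: k'_k)

lemma EFD: "e \<in> EF \<Longrightarrow> e \<in> edges \<Gamma>" "e \<in> EF \<Longrightarrow> e \<subseteq> F" by (simp_all add: EF_def)

lemma EFI: "e \<in> edges \<Gamma> \<Longrightarrow> e \<subseteq> F \<Longrightarrow> e \<in> EF" by (simp add: EF_def)

lemma WD: "w \<in> W \<Longrightarrow> w \<in> vertices \<Gamma>" "w \<in> W \<Longrightarrow> w \<in> F" by (simp_all add: W_def)

lemma boundary_EF: "k ` sphere 0 1 = \<Union>EF" using boundary by (simp add: EF_def)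

lemma edge_F: assumes "e \<in> EF" shows "e \<subseteq> k ` sphere 0 1" "k' ` e \<subseteq> sphere 0 1" "k ` k' ` e = e"
proof -
  show *: "e \<subseteq> k ` sphere 0 1" using assms boundary_EF by blast
  then show "k' ` e \<subseteq> sphere 0 1" using k'_sphere by blast
  show "k ` k' ` e = e" using image_k'[OF EFD(2)[OF assms]] .
qed

lemma W_F: assumes "w \<in> W" shows "w \<in> k ` sphere 0 1" "k' w \<in> sphere 0 1" "k (k' w) = w"
proof -
  have "w \<notin> C0" using WD(1)[OF assms] C0_skeleton by (auto simp: skeleton_def)
  then show *: "w \<in> k ` sphere 0 1" using WD(2)[OF assms] sphere_iff by blast
  then show "k' w \<in> sphere 0 1" using k'_sphere by blast
  show "k (k' w) = w" using k_k'(1)[OF WD(2)[OF assms]] .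
qed

lemma k'_Int: "S \<subseteq> F \<Longrightarrow> T \<subseteq> F \<Longrightarrow> k' ` S \<inter> k' ` T = k' ` (S \<inter> T)"
proof -
  assume "S \<subseteq> F" "T \<subseteq> F"
  moreover have "inj_on k' F" using k_k'(1) by (rule inj_on_inverseI)
  ultimately show ?thesis using inj_on_image_Int by blast
qed

lemma edge_arc:
  assumes e: "e \<in> EF"
  obtains q u v where "arc q" "path_image q = k' ` e" "q 0 = k' u" "q 1 = k' v"
    "u \<in> W" "v \<in> W" "u \<noteq> v" "e \<inter> vertices \<Gamma> = {u,v}" "k' ` e \<inter> k' ` W = {k' u, k' v}"
proof -
  obtain u v where uv: "u \<in> vertices \<Gamma>" "v \<in> vertices \<Gamma>" "u \<noteq> v" "arc_joining M u v e" "e \<inter> vertices \<Gamma> = {u,v}"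
    using embedded_edge[OF graph EFD(1)[OF e]] .
  obtain q where q: "arc q" "path_image q = k' ` e" "q 0 = k' u" "q 1 = k' v"
    using arc_k'[OF uv(4) EFD(2)[OF e]] .
  have eW: "e \<inter> W = {u,v}" using uv(5) EFD(2)[OF e] by (auto simp: W_def)
  then have W: "u \<in> W" "v \<in> W" by blast+
  have "k' ` e \<inter> k' ` W = k' ` (e \<inter> W)"
    by (rule k'_Int[OF EFD(2)[OF e]]) (simp add: W_def)
  also note eW
  finally show ?thesis using that[of q u v] q uv W by simp
qed

lemma EF_nonempty: assumes "e \<in> EF" shows "e \<noteq> {}"
proof -
  obtain u v where "e \<inter> vertices \<Gamma> = {u,v}" using edge_arc[OF assms] by metis
  then show ?thesis by auto
qed

lemma sphere_cover: "sphere 0 1 = (\<Union>e\<in>EF. k' ` e)"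
proof
  show "(\<Union>e\<in>EF. k' ` e) \<subseteq> sphere 0 1" using edge_F(2) by blast
  show "sphere 0 1 \<subseteq> (\<Union>e\<in>EF. k' ` e)"
  proof
    fix x :: "real^2" assume x: "x \<in> sphere 0 1"
    then have "k x \<in> \<Union>EF" using boundary_EF by blast
    then obtain e where "e \<in> EF" "k x \<in> e" by blast
    moreover have "k' (k x) = x" using x by (intro k'_k) auto
    ultimately show "x \<in> (\<Union>e\<in>EF. k' ` e)" by (intro UN_I) (auto intro: rev_image_eqI)
  qed
qed

lemma EF_ex: "\<exists>e. e \<in> EF"
proof -
  have "sphere (0::real^2) 1 \<noteq> {}" by simp
  then show ?thesis using sphere_cover by blast
qed

lemma finite_EF: "finite EF" "finite W"
  using graph by (auto simp: embedded_simple_graph_def EF_def W_def)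

lemma edges_F_Int:
  assumes "e \<in> EF" "f \<in> EF" "e \<noteq> f"
  shows "k' ` e \<inter> k' ` f \<subseteq> k' ` W"
proof -
  have "e \<inter> f \<subseteq> vertices \<Gamma>"
    using edges_Int[OF graph EFD(1)[OF assms(1)] EFD(1)[OF assms(2)] assms(3)]
    by (elim disjE bexE) simp_all
  then have "e \<inter> f \<subseteq> W" using EFD(2)[OF assms(1)] by (auto simp: W_def)
  then show ?thesis using k'_Int[OF EFD(2)[OF assms(1)] EFD(2)[OF assms(2)]] by (metis image_mono)
qed

lemma compact_k'_edge: "e \<in> EF \<Longrightarrow> compact (k' ` e)"
  using edge_arc[of e] compact_arc_image by metis

text \<open>The last claim presents an edge without its ends as the complement of a compact part of
  the circle, the form required for its open cone to be open.\<close>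

lemma edge_minus_W:
  assumes e: "e \<in> EF"
  shows "closure (k' ` e - k' ` W) = k' ` e" "connected (k' ` e - k' ` W)" "k' ` e - k' ` W \<noteq> {}"
    "k' ` e - k' ` W = sphere 0 1 - (k' ` W \<union> (\<Union>f\<in>EF - {e}. k' ` f))"
proof -
  obtain q u v where q: "arc q" "path_image q = k' ` e" "q 0 = k' u" "q 1 = k' v"
    "k' ` e \<inter> k' ` W = {k' u, k' v}"
    using edge_arc[OF e] by metis
  have "k' ` e - k' ` W = k' ` e - (k' ` e \<inter> k' ` W)" by blast
  then have eq: "k' ` e - k' ` W = path_image q - {q 0, q 1}" unfolding q(2-5) .
  show "closure (k' ` e - k' ` W) = k' ` e" "connected (k' ` e - k' ` W)"
    unfolding eq using closure_arc_minus_endpoints[OF q(1)] connected_arc_minus_endpoints[OF q(1)] q(2) by simp_all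
  then show "k' ` e - k' ` W \<noteq> {}" using EF_nonempty[OF e] by (metis closure_empty image_is_empty)
  show "k' ` e - k' ` W = sphere 0 1 - (k' ` W \<union> (\<Union>f\<in>EF - {e}. k' ` f))"
  proof
    show "k' ` e - k' ` W \<subseteq> sphere 0 1 - (k' ` W \<union> (\<Union>f\<in>EF - {e}. k' ` f))"
      using edge_F(2)[OF e] edges_F_Int[OF e] by blast
    show "sphere 0 1 - (k' ` W \<union> (\<Union>f\<in>EF - {e}. k' ` f)) \<subseteq> k' ` e - k' ` W"
    proof
      fix x assume x: "x \<in> sphere 0 1 - (k' ` W \<union> (\<Union>f\<in>EF - {e}. k' ` f))"
      then obtain f where "f \<in> EF" "x \<in> k' ` f" using sphere_cover by (metis DiffD1 UN_E)
      then have "x \<in> k' ` e" using x by (cases "f = e") simp_all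
      then show "x \<in> k' ` e - k' ` W" using x by simp
    qed
  qed
qed

lemma cone_edge: "e \<in> EF \<Longrightarrow> cone (k' ` e) \<subseteq> cball 0 1"
  using cone_subset_cball[OF edge_F(2)] .

lemma cone_W: "w \<in> W \<Longrightarrow> cone {k' w} \<subseteq> cball 0 1"
  using cone_subset_cball[of "{k' w}"] W_F(2)[of w] by simp

lemma sector_disc:
  assumes e: "e \<in> EF"
  shows "subtopology M (sector e) homeomorphic_space top_of_set (cball (0::real^2) 1)"
proof -
  obtain q where q: "arc q" "path_image q = k' ` e" using edge_arc[OF e] by metis
  have "cone (k' ` e) homeomorphic cball (0::real^2) 1"
    using cone_arc_homeomorphic_disc[OF q(1)] q(2) edge_F(2)[OF e] by simp
  then show ?thesis unfolding sector_def using homeomorphic_image[OF cone_edge[OF e]] by blast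
qed

lemma sector_sphere:
  assumes e: "e \<in> EF" shows "sector e \<inter> k ` sphere 0 1 = e"
proof -
  have "cone (k' ` e) \<inter> sphere 0 1 = k' ` e"
    using cone_sphere[OF _ edge_F(2)[OF e]] edge_F(2)[OF e] by blast
  moreover have "sector e \<inter> k ` sphere 0 1 = k ` (cone (k' ` e) \<inter> sphere 0 1)"
    unfolding sector_def using image_Int[OF cone_edge[OF e]] by auto
  ultimately show ?thesis using edge_F(3)[OF e] by simp
qed

lemma spoke_sphere:
  assumes w: "w \<in> W" shows "spoke w \<inter> k ` sphere 0 1 = {w}"
proof -
  have "{k' w} \<subseteq> sphere 0 1" using W_F(2)[OF w] by simp
  then have "cone {k' w} \<inter> sphere 0 1 = {k' w}"
    using cone_sphere[of _ "{k' w}"] by blast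
  moreover have "spoke w \<inter> k ` sphere 0 1 = k ` (cone {k' w} \<inter> sphere 0 1)"
    unfolding spoke_def using image_Int[OF cone_W[OF w]] by auto
  ultimately show ?thesis using W_F(3)[OF w] by simp
qed

lemma cone_0: "A \<noteq> {} \<Longrightarrow> 0 \<in> cone A"
  by (force simp: cone_def)

lemma sector_subset: "e \<in> EF \<Longrightarrow> sector e \<subseteq> F" "e \<in> EF \<Longrightarrow> k 0 \<in> sector e"
  unfolding sector_def using cone_edge cone_0[of "k' ` e"] EF_nonempty by blast+

lemma spoke_subset: "w \<in> W \<Longrightarrow> spoke w \<subseteq> F" "k 0 \<in> spoke w"
  unfolding spoke_def using cone_W cone_0[of "{k' w}"] by blast+

lemma spoke_Int:
  assumes "w \<in> W" "w' \<in> W" "w \<noteq> w'" shows "spoke w \<inter> spoke w' = {k 0}"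
proof -
  have "k' w \<noteq> k' w'" using W_F(3) assms by metis
  then have "cone {k' w} \<inter> cone {k' w'} = {0}"
    using cone_Int[of "{k' w}" "{k' w'}"] W_F(2) assms by simp
  then show ?thesis unfolding spoke_def using image_Int[OF cone_W cone_W] assms by simp
qed

text \<open>Two cones meet in the cone over the common part of their bases, which for two edges is
  empty or one vertex; these cases give the centre and a spoke.\<close>

lemma sector_Int:
  assumes "e \<in> EF" "f \<in> EF" "e \<noteq> f"
  shows "sector e \<inter> sector f = {k 0} \<or> (\<exists>w\<in>W. sector e \<inter> sector f = spoke w)"
proof -
  have I: "cone (k' ` e) \<inter> cone (k' ` f) = (if k' ` e \<inter> k' ` f = {} then {0} else cone (k' ` e \<inter> k' ` f))"
    by (rule cone_Int) (use assms edge_F(2) EF_nonempty in simp_all)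
  have II: "sector e \<inter> sector f = k ` (cone (k' ` e) \<inter> cone (k' ` f))"
    unfolding sector_def using image_Int[OF cone_edge cone_edge] assms by blast
  have III: "k' ` e \<inter> k' ` f = k' ` (e \<inter> f)" using k'_Int EFD(2) assms by blast
  consider "e \<inter> f = {}" | v where "v \<in> vertices \<Gamma>" "e \<inter> f = {v}"
    using edges_Int[OF graph, of e f] EFD(1) assms by blast
  then show ?thesis
  proof cases
    case 1
    then show ?thesis using I II III by simp
  next
    case 2
    then have "v \<in> W" using EFD(2)[OF assms(1)] by (auto simp: W_def)
    moreover have "sector e \<inter> sector f = spoke v" using I II III 2 by (simp add: spoke_def)
    ultimately show ?thesis by blast
  qed
qed

lemma spoke_sector:
  assumes e: "e \<in> EF" and w: "w \<in> W" shows "spoke w \<subseteq> sector e \<longleftrightarrow> w \<in> e"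
proof
  assume "spoke w \<subseteq> sector e"
  moreover have "w \<in> spoke w" using spoke_sphere[OF w] by blast
  ultimately show "w \<in> e" using sector_sphere[OF e] W_F(1)[OF w] by blast
next
  assume "w \<in> e"
  then show "spoke w \<subseteq> sector e" unfolding spoke_def sector_def by (force simp: cone_def)
qed

lemma inj_spoke: "inj_on spoke W"
proof (rule inj_onI)
  fix w w' assume "w \<in> W" "w' \<in> W" "spoke w = spoke w'"
  then show "w = w'" using spoke_sphere by (metis singleton_inject)
qed

lemma inj_sector: "inj_on sector EF"
proof (rule inj_onI)
  fix e f assume "e \<in> EF" "f \<in> EF" "sector e = sector f"
  then show "e = f" using sector_sphere by metis
qed

lemma skeleton_F: assumes "x \<in> skeleton \<Gamma>" "x \<in> F" shows "x \<in> k ` sphere 0 1"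
  using assms sphere_iff C0_skeleton by blast

lemma spoke_edge:
  assumes w: "w \<in> W" and e: "e \<in> edges \<Gamma>" shows "spoke w \<inter> e \<subseteq> {w}"
proof
  fix x assume x: "x \<in> spoke w \<inter> e"
  have "x \<in> skeleton \<Gamma>" using x e by (auto simp: skeleton_def)
  then have "x \<in> k ` sphere 0 1" using skeleton_F x spoke_subset(1)[OF w] by blast
  then show "x \<in> {w}" using spoke_sphere[OF w] x by blast
qed

lemma spoke_vertices:
  assumes w: "w \<in> W" shows "spoke w \<inter> insert (k 0) (vertices \<Gamma>) = {k 0, w}"
proof
  show "spoke w \<inter> insert (k 0) (vertices \<Gamma>) \<subseteq> {k 0, w}"
  proof
    fix x assume x: "x \<in> spoke w \<inter> insert (k 0) (vertices \<Gamma>)"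
    show "x \<in> {k 0, w}"
    proof (cases "x = k 0")
      case False
      then have "x \<in> skeleton \<Gamma>" using x by (auto simp: skeleton_def)
      then have "x \<in> k ` sphere 0 1" using skeleton_F x spoke_subset(1)[OF w] by blast
      then show "x \<in> {k 0, w}" using spoke_sphere[OF w] x by blast
    qed simp
  qed
  have "w \<in> spoke w" using spoke_sphere[OF w] by blast
  then show "{k 0, w} \<subseteq> spoke w \<inter> insert (k 0) (vertices \<Gamma>)"
    using spoke_subset(2) WD(1)[OF w] by blast
qed

lemma spoke_arc:
  assumes w: "w \<in> W" shows "arc_joining M (k 0) w (spoke w)"
proof -
  have "k' w \<noteq> 0" using W_F(2)[OF w] by auto
  then have "arc (linepath 0 (k' w))" by (intro arc_linepath) simp
  then have "arc_joining M (k (linepath 0 (k' w) 0)) (k (linepath 0 (k' w) 1)) (k ` path_image (linepath 0 (k' w)))"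
    using cone_W[OF w] by (intro arc_joining_image) (simp_all add: cone_singleton del: linepath_0)
  moreover have "linepath 0 (k' w) 0 = 0" "linepath 0 (k' w) 1 = k' w" by (simp_all add: linepath_def)
  ultimately show ?thesis
    unfolding path_image_linepath spoke_def cone_singleton by (metis W_F(3)[OF w])
qed

lemma star_simps: "vertices star = insert (k 0) (vertices \<Gamma>)" "edges star = edges \<Gamma> \<union> spoke ` W"
  by (simp_all add: star_def)

lemma embedded_star: "embedded_simple_graph M star"
  unfolding embedded_simple_graph_def star_simps
proof (intro conjI ballI impI)
  show "finite (insert (k 0) (vertices \<Gamma>))" "finite (edges \<Gamma> \<union> spoke ` W)"
    using graph finite_EF(2) by (auto simp: embedded_simple_graph_def)
  show "insert (k 0) (vertices \<Gamma>) \<subseteq> topspace M"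
    using graph k0(2) image_topspace by (auto simp: embedded_simple_graph_def)
next
  fix e assume e: "e \<in> edges \<Gamma> \<union> spoke ` W"
  show "\<exists>u\<in>insert (k 0) (vertices \<Gamma>). \<exists>v\<in>insert (k 0) (vertices \<Gamma>).
          arc_joining M u v e \<and> e \<inter> insert (k 0) (vertices \<Gamma>) = {u, v}"
  proof (cases "e \<in> edges \<Gamma>")
    case True
    obtain u v where uv: "u \<in> vertices \<Gamma>" "v \<in> vertices \<Gamma>" "arc_joining M u v e" "e \<inter> vertices \<Gamma> = {u,v}"
      using embedded_edge[OF graph True] by metis
    moreover have "e \<inter> insert (k 0) (vertices \<Gamma>) = e \<inter> vertices \<Gamma>" using k0(4)[OF True] by blast
    ultimately show ?thesis by (intro bexI[of _ u] bexI[of _ v]) simp_all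
  next
    case False
    then obtain w where w: "w \<in> W" "e = spoke w" using e by blast
    then show ?thesis using spoke_arc[OF w(1)] spoke_vertices[OF w(1)]
      WD(1)[OF w(1)] by (intro bexI[of _ "k 0"] bexI[of _ w]) simp_all
  qed
next
  fix e f assume e: "e \<in> edges \<Gamma> \<union> spoke ` W" and f: "f \<in> edges \<Gamma> \<union> spoke ` W" and ef: "e \<noteq> f"
  have mixed: "g \<inter> h = {} \<or> (\<exists>v\<in>insert (k 0) (vertices \<Gamma>). g \<inter> h = {v})"
    if "g \<in> edges \<Gamma>" "h \<in> spoke ` W" for g h
  proof -
    obtain w where "w \<in> W" "h = spoke w" using \<open>h \<in> spoke ` W\<close> by blast
    then have "g \<inter> h \<subseteq> {w}" "w \<in> vertices \<Gamma>" using spoke_edge[of w g] \<open>g \<in> edges \<Gamma>\<close> WD(1) by blast+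
    then show ?thesis by blast
  qed
  show "e \<inter> f = {} \<or> (\<exists>v\<in>insert (k 0) (vertices \<Gamma>). e \<inter> f = {v})"
  proof (cases "e \<in> edges \<Gamma>"; cases "f \<in> edges \<Gamma>")
    assume "e \<in> edges \<Gamma>" "f \<in> edges \<Gamma>"
    then show ?thesis using edges_Int[OF graph _ _ ef] by blast
  next
    assume "e \<in> edges \<Gamma>" "f \<notin> edges \<Gamma>"
    then show ?thesis using mixed f by blast
  next
    assume "e \<notin> edges \<Gamma>" "f \<in> edges \<Gamma>"
    then show ?thesis using mixed[of f e] e by (metis Int_commute UnE)
  next
    assume "e \<notin> edges \<Gamma>" "f \<notin> edges \<Gamma>"
    then obtain w w' where "w \<in> W" "e = spoke w" "w' \<in> W" "f = spoke w'" using e f by blast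
    moreover have "w \<noteq> w'" using calculation ef by blast
    ultimately show ?thesis using spoke_Int by blast
  qed
qed

text \<open>The centre is joined to one vertex of the boundary, and through it to all
  others.\<close>

lemma connected_star:
  assumes "connected_graph M \<Gamma>" shows "connected_graph M star"
proof -
  obtain w where w: "w \<in> W" using EF_ex edge_arc by metis
  have mono: "(joined M star)\<^sup>*\<^sup>* u v" if "(joined M \<Gamma>)\<^sup>*\<^sup>* u v" for u v
  proof -
    have "joined M \<Gamma> \<le> joined M star" by (auto simp: joined_def star_simps)
    then show ?thesis using that rtranclp_mono by blast
  qed
  have w0: "(joined M star)\<^sup>*\<^sup>* (k 0) w"
    using spoke_arc[OF w] w by (intro r_into_rtranclp) (auto simp: joined_def star_simps)
  have toz: "(joined M star)\<^sup>*\<^sup>* u (k 0)" if "u \<in> vertices star" for u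
  proof (cases "u = k 0")
    case False
    then have "(joined M star)\<^sup>*\<^sup>* u w"
      using assms that WD(1)[OF w] mono False unfolding connected_graph_def star_simps by blast
    then show ?thesis using joined_rtranclp_sym[OF Haus w0] by (meson rtranclp_trans)
  qed simp
  show ?thesis unfolding connected_graph_def
    using toz joined_rtranclp_sym[OF Haus] by (meson rtranclp_trans)
qed

end

section \<open>Components and faces after starring\<close>

context pierced_face
begin

abbreviation comps :: "'a set set" where
  "comps \<equiv> connected_components_of (subtopology M (topspace M - skeleton \<Gamma>))"

lemma face_eq: "M closure_of C0 = F"
proof -
  have "M closure_of C0 = k ` closure (ball 0 1)" by (rule closure_of_image) auto
  then show ?thesis by simp
qed

lemma F_face: "F \<in> faces M \<Gamma>"
  unfolding faces_def using comp face_eq by (metis image_eqI)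

lemma disjoint_C0:
  assumes "C \<in> comps" "C \<noteq> C0" shows "(M closure_of C) \<inter> C0 = {}"
proof -
  have "C \<inter> C0 = {}" using connected_components_of_overlap[OF assms(1) comp] assms(2) by blast
  then show ?thesis using openin_Int_closure_of_eq_empty[OF open_C0, of C] by (simp add: Int_commute)
qed

text \<open>\<open>faces\<close> is an image under closure, so it must be checked that no other
  component has closure \<open>F\<close>: such a closure misses the open set
  \<open>C0\<close>.\<close>

lemma other_face_iff: "G \<in> faces M \<Gamma> - {F} \<longleftrightarrow> (\<exists>C\<in>comps - {C0}. G = M closure_of C)"
proof
  assume "G \<in> faces M \<Gamma> - {F}"
  then obtain C where "C \<in> comps" "G = M closure_of C" "G \<noteq> F" by (auto simp: faces_def)
  then show "\<exists>C\<in>comps - {C0}. G = M closure_of C" using face_eq by auto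
next
  assume "\<exists>C\<in>comps - {C0}. G = M closure_of C"
  then obtain C where C: "C \<in> comps" "C \<noteq> C0" "G = M closure_of C" by blast
  have "F \<inter> C0 \<noteq> {}" using k0 by blast
  then have "G \<noteq> F" using disjoint_C0[OF C(1,2)] C(3) by auto
  then show "G \<in> faces M \<Gamma> - {F}" using C by (simp add: faces_def)
qed

lemma other_face_C0:
  assumes "G \<in> faces M \<Gamma> - {F}" shows "G \<inter> C0 = {}"
proof -
  obtain C where "C \<in> comps - {C0}" "G = M closure_of C" using assms other_face_iff by metis
  then show ?thesis using disjoint_C0[of C] by simp
qed

lemma other_face_F:
  assumes "G \<in> faces M \<Gamma> - {F}" shows "G \<inter> F \<subseteq> k ` sphere 0 1" 
  using other_face_C0[OF assms] F_split by blast

lemma open_cone_sub: "e \<in> EF \<Longrightarrow> open_cone (k' ` e - k' ` W) \<subseteq> ball 0 1"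
  using edge_F(2) by (intro open_cone_subset_ball) blast

lemma open_sector:
  assumes e: "e \<in> EF"
  shows "openin M (open_sector e)" "connectedin M (open_sector e)" "open_sector e \<noteq> {}"
    "M closure_of (open_sector e) = sector e" "open_sector e \<subseteq> C0"
proof -
  \<comment> \<open>The part of the circle outside the interior of the edge
    \<open>e\<close>.\<close>
  let ?K = "k' ` W \<union> (\<Union>f\<in>EF - {e}. k' ` f)"
  have ball: "open_cone (k' ` e - k' ` W) \<subseteq> ball 0 1" using open_cone_sub[OF e] .
  then have cball: "open_cone (k' ` e - k' ` W) \<subseteq> cball 0 1" by auto
  have K1: "compact ?K" using finite_EF compact_k'_edge
    by (intro compact_Un compact_UN) (auto intro: finite_imp_compact)
  have K2: "?K \<subseteq> sphere 0 1" using W_F(2) edge_F(2) by blast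
  have "W \<noteq> {}" using edge_arc[OF e] by (metis empty_iff)
  then have "?K \<noteq> {}" by simp
  then have "open (open_cone (k' ` e - k' ` W))"
    by (rule open_open_cone[OF K1 edge_minus_W(4)[OF e] K2])
  then show "openin M (open_sector e)" unfolding open_sector_def by (rule openin_image[OF open_C0 _ ball])
  show "connectedin M (open_sector e)" unfolding open_sector_def
    by (rule connectedin_image[OF connected_open_cone[OF edge_minus_W(2)[OF e]] cball])
  obtain u where "u \<in> k' ` e - k' ` W" using edge_minus_W(3)[OF e] by blast
  then have "(1/2) *\<^sub>R u \<in> open_cone (k' ` e - k' ` W)" unfolding open_cone_def
    by (intro CollectI exI[of _ "1/2"] exI[of _ u]) simp
  then show "open_sector e \<noteq> {}" unfolding open_sector_def by blast
  show "M closure_of (open_sector e) = sector e"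
    unfolding open_sector_def sector_def closure_of_image[OF cball]
    using closure_open_cone[OF compact_k'_edge[OF e] edge_minus_W(1)[OF e]] by simp
  show "open_sector e \<subseteq> C0" unfolding open_sector_def using ball by blast
qed

lemma open_sector_disjoint:
  assumes "e \<in> EF" "f \<in> EF" "e \<noteq> f" shows "open_sector e \<inter> open_sector f = {}"
proof -
  have "open_cone (k' ` e - k' ` W) \<inter> open_cone (k' ` f - k' ` W) = {}"
  proof (rule ccontr)
    assume "\<not> ?thesis"
    then obtain x where x: "x \<in> open_cone (k' ` e - k' ` W)" "x \<in> open_cone (k' ` f - k' ` W)" by blast
    have s: "k' ` e - k' ` W \<subseteq> sphere 0 1" "k' ` f - k' ` W \<subseteq> sphere 0 1"
      using edge_F(2) assms by blast+
    have "x /\<^sub>R norm x \<in> k' ` e - k' ` W" "x /\<^sub>R norm x \<in> k' ` f - k' ` W"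
      using x open_cone_iff[OF s(1)] open_cone_iff[OF s(2)] by blast+
    then show False using edges_F_Int[OF assms] by blast
  qed
  moreover have "open_sector e \<inter> open_sector f = k ` (open_cone (k' ` e - k' ` W) \<inter> open_cone (k' ` f - k' ` W))"
    unfolding open_sector_def
    by (rule image_Int) (use open_cone_sub assms ball_subset_cball in blast)+
  ultimately show ?thesis by simp
qed

text \<open>Radial projection: the direction of a point other than the centre is a boundary vertex
  or lies inside exactly one edge.\<close>

lemma C0_minus_spokes: "C0 - \<Union>(spoke ` W) = \<Union>(open_sector ` EF)"
proof
  show "C0 - \<Union>(spoke ` W) \<subseteq> \<Union>(open_sector ` EF)"
  proof
    fix y assume y: "y \<in> C0 - \<Union>(spoke ` W)"
    then obtain x where x: "y = k x" "norm x < 1" by auto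
    obtain w where w: "w \<in> W" using EF_ex edge_arc by metis
    have x0: "x \<noteq> 0" using y x w spoke_subset(2)[of w] by blast
    then have "x /\<^sub>R norm x \<in> sphere 0 1" by simp
    then obtain e where e: "e \<in> EF" "x /\<^sub>R norm x \<in> k' ` e" using sphere_cover by blast
    have "x /\<^sub>R norm x \<notin> k' ` W"
    proof
      assume "x /\<^sub>R norm x \<in> k' ` W"
      then obtain v where v: "v \<in> W" "x /\<^sub>R norm x = k' v" by blast
      have "x \<in> cone {k' v}" using cone_iff[of "{k' v}" x] W_F(2)[OF v(1)] v(2) x(2) by simp
      then show False using y x v(1) unfolding spoke_def by blast
    qed
    then have "x \<in> open_cone (k' ` e - k' ` W)"
      using open_cone_iff[of "k' ` e - k' ` W" x] edge_F(2)[OF e(1)] e(2) x0 x(2) by blast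
    then show "y \<in> \<Union>(open_sector ` EF)" using e(1) x(1) unfolding open_sector_def by blast
  qed
  show "\<Union>(open_sector ` EF) \<subseteq> C0 - \<Union>(spoke ` W)"
  proof
    fix y assume "y \<in> \<Union>(open_sector ` EF)"
    then obtain e where e: "e \<in> EF" "y \<in> open_sector e" by blast
    then obtain x where x: "y = k x" "x \<in> open_cone (k' ` e - k' ` W)" by (auto simp: open_sector_def)
    have x': "x \<noteq> 0" "norm x < 1" "x /\<^sub>R norm x \<in> k' ` e - k' ` W"
      using open_cone_iff[of "k' ` e - k' ` W" x] edge_F(2)[OF e(1)] x(2) by blast+
    have "y \<notin> spoke w" if w: "w \<in> W" for w
    proof
      assume "y \<in> spoke w"
      then obtain z where z: "z \<in> cone {k' w}" "y = k z" by (auto simp: spoke_def)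
      have "z \<in> cball 0 1" using z(1) cone_W[OF w] by blast
      then have "x = z" using x(1) z(2) x'(2) inj by (auto dest: inj_onD)
      then have "x /\<^sub>R norm x \<in> {k' w}"
        using z(1) cone_iff[of "{k' w}" x] W_F(2)[OF w] x'(1) by simp
      then show False using x'(3) w by blast
    qed
    then show "y \<in> C0 - \<Union>(spoke ` W)" using x(1) x'(2) by auto
  qed
qed

text \<open>The other components are untouched, and the spokes cut \<open>C0\<close> into the open
  sectors. All pieces are open, connected and disjoint, so the partition criterion applies.\<close>

lemma comps_star:
  "connected_components_of (subtopology M (topspace M - skeleton star)) = (comps - {C0}) \<union> open_sector ` EF"
proof (rule connected_components_of_partition)
  have Uc: "\<Union>comps = topspace M - skeleton \<Gamma>" 
    using Union_connected_components_of[of "subtopology M (topspace M - skeleton \<Gamma>)"] by auto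
  have sk: "skeleton star = skeleton \<Gamma> \<union> \<Union>(spoke ` W)"
  proof -
    obtain w where "w \<in> W" using EF_ex edge_arc by metis
    then have "k 0 \<in> \<Union>(spoke ` W)" using spoke_subset(2) by blast
    then have "insert (k 0) (vertices \<Gamma>) \<union> (\<Union>(edges \<Gamma>) \<union> \<Union>(spoke ` W))
        = vertices \<Gamma> \<union> \<Union>(edges \<Gamma>) \<union> \<Union>(spoke ` W)"
      by (simp only: insert_is_Un[of "k 0" "vertices \<Gamma>"] Un_assoc) (auto simp only: Un_iff singleton_iff)
    then show ?thesis unfolding skeleton_def star_simps Union_Un_distrib .
  qed
  have rest: "\<Union>(comps - {C0}) = topspace M - skeleton \<Gamma> - C0"
  proof -
    have "C \<inter> C0 = {}" if "C \<in> comps - {C0}" for C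
      using connected_components_of_overlap[OF _ comp, of C] that by blast
    moreover have "\<Union>(A - {c}) = \<Union>A - c" if "\<And>C. C \<in> A - {c} \<Longrightarrow> C \<inter> c = {}" for A :: "'a set set" and c
      using that by blast
    ultimately show ?thesis using Uc by metis
  qed
  have spF: "\<Union>(spoke ` W) \<subseteq> C0 \<union> skeleton \<Gamma>"
  proof
    fix x assume "x \<in> \<Union>(spoke ` W)"
    then obtain w where w: "w \<in> W" "x \<in> spoke w" by blast
    then have "x \<in> C0 \<or> x \<in> k ` sphere 0 1" using spoke_subset(1) F_split(1) by blast
    then show "x \<in> C0 \<union> skeleton \<Gamma>" using boundary_EF EFD(1) unfolding skeleton_def by blast
  qed
  have C0_top: "C0 \<subseteq> topspace M - skeleton \<Gamma>" using comp Uc by blast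
  have tot: "topspace M - skeleton star = (topspace M - skeleton \<Gamma> - C0) \<union> (C0 - \<Union>(spoke ` W))"
    using sk spF C0_top by blast
  show un: "\<Union>(comps - {C0} \<union> open_sector ` EF) = topspace (subtopology M (topspace M - skeleton star))"
    unfolding Union_Un_distrib rest C0_minus_spokes[symmetric] tot[symmetric] by auto
  show "pairwise disjnt (comps - {C0} \<union> open_sector ` EF)"
  proof (rule pairwiseI)
    fix C D assume C: "C \<in> comps - {C0} \<union> open_sector ` EF" and D: "D \<in> comps - {C0} \<union> open_sector ` EF"
      and CD: "C \<noteq> D"
    have mixed: "A \<inter> B = {}" if "A \<in> comps - {C0}" "B \<in> open_sector ` EF" for A B
    proof -
      have "A \<inter> C0 = {}" using rest that(1) by blast
      then show ?thesis using open_sector(5) that(2) by blast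
    qed
    consider "C \<in> comps - {C0}" "D \<in> comps - {C0}" | "C \<in> comps - {C0}" "D \<in> open_sector ` EF"
      | "D \<in> comps - {C0}" "C \<in> open_sector ` EF" | "C \<in> open_sector ` EF" "D \<in> open_sector ` EF"
      using C D by blast
    then have "C \<inter> D = {}"
    proof cases
      case 1
      then show ?thesis
        using connected_components_of_overlap[OF DiffD1[OF 1(1)] DiffD1[OF 1(2)]] CD by simp
    next
      case 2
      then show ?thesis by (rule mixed)
    next
      case 3
      then show ?thesis using mixed[OF 3] by (simp add: Int_commute)
    next
      case 4
      then obtain e f where ef: "e \<in> EF" "f \<in> EF" "C = open_sector e" "D = open_sector f" by auto
      then have "e \<noteq> f" using CD by auto
      then show ?thesis using open_sector_disjoint ef by simp
    qed
    then show "disjnt C D" by (simp add: disjnt_def)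
  qed
  fix C assume C: "C \<in> comps - {C0} \<union> open_sector ` EF"
  have sub: "C \<subseteq> topspace M - skeleton star" using C un by (simp add: Int_absorb1) blast
  have "openin M C \<and> connectedin M C \<and> C \<noteq> {}"
  proof (cases "C \<in> comps")
    case True
    then show ?thesis
      using comps_open connectedin_connected_components_of[OF True] nonempty_connected_components_of[OF True]
      by (simp add: connectedin_subtopology)
  next
    case False
    then show ?thesis using C open_sector by blast
  qed
  then show "openin (subtopology M (topspace M - skeleton star)) C \<and>
      connectedin (subtopology M (topspace M - skeleton star)) C \<and> C \<noteq> {}"
    using sub by (auto simp: connectedin_subtopology openin_subtopology)
qed

lemma faces_star: "faces M star = (faces M \<Gamma> - {F}) \<union> sector ` EF"
proof -
  have "faces M star = (\<lambda>C. M closure_of C) ` (comps - {C0}) \<union> (\<lambda>C. M closure_of C) ` open_sector ` EF"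
    unfolding faces_def[of M star] comps_star by (rule image_Un)
  moreover have "(\<lambda>C. M closure_of C) ` (comps - {C0}) = faces M \<Gamma> - {F}"
    by (intro set_eqI) (simp only: other_face_iff image_iff)
  moreover have "(\<lambda>C. M closure_of C) ` open_sector ` EF = sector ` EF"
    unfolding image_image using open_sector(4) by (intro image_cong) auto
  ultimately show ?thesis by simp
qed

lemma sector_not_face: "e \<in> EF \<Longrightarrow> sector e \<notin> faces M \<Gamma> - {F}"
  using sector_subset(2) k0(1) other_face_C0 by blast

lemma spoke_not_edge: "spoke w \<notin> edges \<Gamma>"
  using k0(4) spoke_subset(2) by blast

lemma spoke_not_subset_face: "G \<in> faces M \<Gamma> - {F} \<Longrightarrow> \<not> spoke w \<subseteq> G"
  using k0(1) spoke_subset(2) other_face_C0 by blast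

lemma edge_subset_sector:
  assumes e: "e \<in> EF" and f: "f \<in> edges \<Gamma>" shows "f \<subseteq> sector e \<longleftrightarrow> f = e"
proof
  assume "f \<subseteq> sector e"
  moreover have "f \<subseteq> k ` sphere 0 1"
  proof
    fix x assume "x \<in> f"
    then show "x \<in> k ` sphere 0 1"
      using calculation sector_subset(1)[OF e] f by (intro skeleton_F) (auto simp: skeleton_def)
  qed
  ultimately have "f \<subseteq> e" using sector_sphere[OF e] by blast
  then show "f = e" using edge_subset_eq[OF graph f EFD(1)[OF e]] by blast
next
  assume "f = e" then show "f \<subseteq> sector e" using sector_sphere[OF e] by blast
qed

lemma card_edges_sector:
  assumes e: "e \<in> EF" shows "card {f\<in>edges star. f \<subseteq> sector e} = 3"
proof -
  obtain u v where uv: "u \<in> W" "v \<in> W" "u \<noteq> v" "e \<inter> vertices \<Gamma> = {u,v}"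
    using edge_arc[OF e] by metis
  have "{f\<in>edges star. f \<subseteq> sector e} = insert e (spoke ` {w\<in>W. w \<in> e})"
    using edge_subset_sector[OF e] spoke_sector[OF e] EFD(1)[OF e] unfolding star_simps by blast
  moreover have "{w\<in>W. w \<in> e} = {u,v}" using uv WD(1) by blast
  ultimately have eq: "{f\<in>edges star. f \<subseteq> sector e} = {e, spoke u, spoke v}" by simp
  have "spoke u \<noteq> spoke v" using inj_onD[OF inj_spoke] uv by blast
  moreover have "e \<noteq> spoke u" "e \<noteq> spoke v" using spoke_not_edge EFD(1)[OF e] by metis+
  ultimately show ?thesis unfolding eq by simp
qed

lemma edges_other_face:
  assumes "G \<in> faces M \<Gamma> - {F}" shows "{f\<in>edges star. f \<subseteq> G} = {f\<in>edges \<Gamma>. f \<subseteq> G}"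
  using spoke_not_subset_face[OF assms] unfolding star_simps by blast

text \<open>An edge of \<open>F\<close> exchanges \<open>F\<close> for its own sector, and an edge
  not in \<open>F\<close> keeps its faces. A spoke at \<open>w\<close> lies in the sectors of the
  boundary edges through \<open>w\<close>, and \<open>degree\<close> says that there are
  two.\<close>

lemma card_faces_containing:
  assumes "\<forall>e\<in>edges \<Gamma>. card {G\<in>faces M \<Gamma>. e \<subseteq> G} = 2" "e \<in> edges star"
  shows "card {G\<in>faces M star. e \<subseteq> G} = 2"
proof (cases "e \<in> edges \<Gamma>")
  case True
  show ?thesis
  proof (cases "e \<in> EF")
    case eF: True
    have "{G\<in>faces M star. e \<subseteq> G} = insert (sector e) ({G\<in>faces M \<Gamma>. e \<subseteq> G} - {F})"
    proof -
      have "{H\<in>sector ` EF. e \<subseteq> H} = {sector e}" using edge_subset_sector[OF _ True] eF by auto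
      moreover have "{G\<in>faces M star. e \<subseteq> G} =
          ({G\<in>faces M \<Gamma>. e \<subseteq> G} - {F}) \<union> {H\<in>sector ` EF. e \<subseteq> H}"
        unfolding faces_star by auto
      ultimately show ?thesis by simp
    qed
    moreover have c: "card {G\<in>faces M \<Gamma>. e \<subseteq> G} = 2" using assms(1) True by blast
    moreover have "F \<in> {G\<in>faces M \<Gamma>. e \<subseteq> G}" using F_face EFD(2)[OF eF] by blast
    then have "card ({G\<in>faces M \<Gamma>. e \<subseteq> G} - {F}) = 1" using c by simp
    moreover have "finite {G\<in>faces M \<Gamma>. e \<subseteq> G}" using c by (intro card_ge_0_finite) simp
    then have "finite ({G\<in>faces M \<Gamma>. e \<subseteq> G} - {F})" by simp
    moreover have "sector e \<notin> {G\<in>faces M \<Gamma>. e \<subseteq> G} - {F}" using sector_not_face[OF eF] by blast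
    ultimately show ?thesis by simp
  next
    case False
    then have nF: "\<not> e \<subseteq> F" using EFI True by blast
    have "\<not> e \<subseteq> sector f" if "f \<in> EF" for f using sector_subset(1)[OF that] nF by blast
    then have "{G\<in>faces M star. e \<subseteq> G} = {G\<in>faces M \<Gamma>. e \<subseteq> G}"
      unfolding faces_star using nF by blast
    then show ?thesis using assms(1) True by simp
  qed
next
  case False
  then obtain w where w: "w \<in> W" "e = spoke w" using assms(2) unfolding star_simps by blast
  have "{G\<in>faces M star. e \<subseteq> G} = sector ` {f\<in>EF. w \<in> f}"
    unfolding faces_star w(2) using spoke_not_subset_face spoke_sector w(1) by blast
  moreover have "card (sector ` {f\<in>EF. w \<in> f}) = card {f\<in>EF. w \<in> f}"
    by (intro card_image inj_on_subset[OF inj_sector]) blast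
  moreover have "{f\<in>EF. w \<in> f} = {e\<in>edges \<Gamma>. e \<subseteq> F \<and> w \<in> e}" by (auto simp: EF_def)
  ultimately show ?thesis using degree[OF WD[OF w(1)]] by simp
qed

text \<open>Stated for an arbitrary set, because it is asked both of intersections of two faces and
  of intersections of a face with a single edge of \<open>F\<close>.\<close>

definition meets_nicely :: "'a set \<Rightarrow> bool" where
  "meets_nicely S \<longleftrightarrow> S \<in> edges \<Gamma> \<or> (\<exists>v\<in>vertices \<Gamma>. S = {v}) \<or> S = {}"

text \<open>No condition concerns the intersection of another face with \<open>F\<close> as a whole,
  only with its single edges: a sector meets another face just in the edge that it is built on. For
  two hemispheres the whole intersection would be a circle.\<close>

theorem star_triangulation:
  assumes conn: "connected_graph M \<Gamma>"
    and two: "\<forall>e\<in>edges \<Gamma>. card {G\<in>faces M \<Gamma>. e \<subseteq> G} = 2"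
    and disc: "\<And>G. G \<in> faces M \<Gamma> - {F} \<Longrightarrow> subtopology M G homeomorphic_space top_of_set (cball (0::real^2) 1)"
    and three: "\<And>G. G \<in> faces M \<Gamma> - {F} \<Longrightarrow> card {e\<in>edges \<Gamma>. e \<subseteq> G} = 3"
    and others: "\<And>G H. G \<in> faces M \<Gamma> - {F} \<Longrightarrow> H \<in> faces M \<Gamma> - {F} \<Longrightarrow> G \<noteq> H \<Longrightarrow> meets_nicely (G \<inter> H)"
    and edge: "\<And>G e. G \<in> faces M \<Gamma> - {F} \<Longrightarrow> e \<in> EF \<Longrightarrow> meets_nicely (G \<inter> e)"
  shows "surface_triangulation M star"
proof -
  let ?nice = "\<lambda>S. S \<in> edges star \<or> (\<exists>v\<in>vertices star. S = {v}) \<or> S = {}"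
  have nice: "?nice S" if "meets_nicely S" for S using that unfolding meets_nicely_def star_simps by blast
  have mixed: "?nice (G \<inter> sector e)" if G: "G \<in> faces M \<Gamma> - {F}" and e: "e \<in> EF" for G e
  proof -
    have "G \<inter> sector e = G \<inter> e"
    proof -
      have *: "A \<inter> B = A \<inter> c" if "A \<inter> D \<subseteq> S" "B \<subseteq> D" "B \<inter> S = c" for A B c D S :: "'a set"
        using that by blast
      show ?thesis by (rule *[OF other_face_F[OF G] sector_subset(1)[OF e] sector_sphere[OF e]])
    qed
    then show ?thesis using nice[OF edge[OF G e]] by simp
  qed
  have "?nice (G \<inter> H)" if G: "G \<in> faces M star" and H: "H \<in> faces M star" and GH: "G \<noteq> H" for G H
  proof -
    consider "G \<in> faces M \<Gamma> - {F}" "H \<in> faces M \<Gamma> - {F}"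
      | e where "G \<in> faces M \<Gamma> - {F}" "e \<in> EF" "H = sector e"
      | e where "H \<in> faces M \<Gamma> - {F}" "e \<in> EF" "G = sector e"
      | e f where "e \<in> EF" "f \<in> EF" "G = sector e" "H = sector f"
      using G H unfolding faces_star by blast
    then show ?thesis
    proof cases
      case 1
      then show ?thesis using nice[OF others[OF _ _ GH]] by blast
    next
      case (2 e)
      then show ?thesis using mixed by simp
    next
      case (3 e)
      then show ?thesis using mixed[of H e] by (simp add: Int_commute)
    next
      case (4 e f)
      then have "e \<noteq> f" using GH by blast
      from sector_Int[OF 4(1,2) this] show ?thesis unfolding 4 star_simps by blast
    qed
  qed
  moreover have "\<forall>G\<in>faces M star. subtopology M G homeomorphic_space top_of_set (cball (0::real^2) 1)"
    unfolding faces_star using disc sector_disc by blast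
  moreover have "\<forall>G\<in>faces M star. card {e\<in>edges star. e \<subseteq> G} = 3"
  proof
    fix G assume "G \<in> faces M star"
    then consider "G \<in> faces M \<Gamma> - {F}" | e where "e \<in> EF" "G = sector e"
      unfolding faces_star by blast
    then show "card {e\<in>edges star. e \<subseteq> G} = 3"
      using three[of G] edges_other_face[of G] card_edges_sector by cases simp_all
  qed
  ultimately show ?thesis
    unfolding surface_triangulation_def surface_graph_def
    by (intro conjI embedded_star connected_star[OF conn] ballI impI card_faces_containing[OF two]) simp_all
qed

end

section \<open>Faces of a triangulated surface\<close>

lemma surface_chart:
  assumes M: "closed_surface M" and x: "x \<in> topspace M"
  obtains c :: "real^2 \<Rightarrow> 'a" where "continuous_map euclidean M c" "inj c" "x \<in> range c"
    "\<And>S. open S \<Longrightarrow> openin M (c ` S)" "continuous_map (subtopology M (range c)) euclidean (inv c)"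
proof -
  obtain U where U: "openin M U" "x \<in> U"
    "subtopology M U homeomorphic_space (euclidean :: (real^2) topology)"
    using assms unfolding closed_surface_def by blast
  have top: "topspace (subtopology M U) = U" using openin_subset[OF U(1)] by auto
  obtain c where c: "homeomorphic_map (euclidean :: (real^2) topology) (subtopology M U) c"
    using U(3) homeomorphic_space homeomorphic_space_sym by blast
  have im: "range c = U" using homeomorphic_imp_surjective_map[OF c] top by simp
  have inj: "inj c" using homeomorphic_imp_injective_map[OF c] by simp
  have "openin M (c ` S)" if "open S" for S
  proof -
    have "openin (subtopology M U) (c ` S)"
      using homeomorphic_imp_open_map[OF c] that unfolding open_map_def by simp
    then show ?thesis using U(1) openin_trans_full by blast
  qed
  moreover have "continuous_map euclidean M c"
    using homeomorphic_imp_continuous_map[OF c] continuous_map_in_subtopology by blast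
  moreover have "continuous_map (subtopology M (range c)) euclidean (inv c)"
  proof -
    obtain g where g: "homeomorphic_maps (euclidean :: (real^2) topology) (subtopology M U) c g"
      using c by (auto simp: homeomorphic_map_maps)
    then have "continuous_map (subtopology M U) euclidean g" by (simp add: homeomorphic_maps_def)
    moreover have "g y = inv c y" if "y \<in> topspace (subtopology M U)" for y
    proof -
      have "y \<in> range c" using that unfolding top im .
      then obtain z where "y = c z" by blast
      then show ?thesis using g inj by (simp add: homeomorphic_maps_def)
    qed
    ultimately show ?thesis unfolding im by (rule continuous_map_eq)
  qed
  ultimately show ?thesis using that[of c] inj im U(2) by simp
qed

text \<open>Makes the components of the complement of the graph open.\<close>

lemma locally_connected_surface:
  assumes M: "closed_surface M" shows "locally_connected_space M"
proof (rule locally_connected_C)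
  show "neighbourhood_base_of (\<lambda>U. openin M U \<and> connectedin M U) M"
    unfolding neighbourhood_base_of
  proof (intro allI impI)
    fix W x assume W: "openin M W \<and> x \<in> W"
    then have "x \<in> topspace M" using openin_subset by blast
    then obtain c :: "real^2 \<Rightarrow> 'a" where c: "continuous_map euclidean M c" "x \<in> range c"
        "\<And>S. open S \<Longrightarrow> openin M (c ` S)"
      using surface_chart[OF M] by metis
    obtain z where z: "x = c z" using c(2) by blast
    have "open (c -` W)" using c(1) W unfolding continuous_map_def by (simp add: vimage_def)
    then obtain r where r: "r > 0" "ball z r \<subseteq> c -` W" using z W open_contains_ball by blast
    have "connectedin M (c ` ball z r)"
      by (rule connectedin_continuous_map_image[OF c(1)]) simp
    then show "\<exists>U V. openin M U \<and> (openin M V \<and> connectedin M V) \<and> x \<in> U \<and> U \<subseteq> V \<and> V \<subseteq> W"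
      using r z c(3)[of "ball z r"] by (intro exI[of _ "c ` ball z r"]) auto
  qed
qed

text \<open>In a chart \<open>c\<close>, the map \<open>k' \<circ> c\<close> is a continuous
  injection of an open plane set into the closed disc. By invariance of domain its image is open and
  so avoids the boundary circle.\<close>

lemma (in disc_chart) open_subset_disc:
  assumes M: "closed_surface M" and V: "openin M V" "V \<subseteq> k ` cball 0 1"
  shows "V \<subseteq> k ` ball 0 1"
proof
  fix x assume x: "x \<in> V"
  then have "x \<in> topspace M" using V(1) openin_subset by blast
  then obtain c :: "real^2 \<Rightarrow> 'a" where c: "continuous_map euclidean M c" "inj c" "x \<in> range c"
    using surface_chart[OF M] by metis
  define N where "N = c -` V"
  have "open N" using c(1) V(1) unfolding continuous_map_def N_def by (simp add: vimage_def)
  have cN: "c ` N \<subseteq> k ` cball 0 1" using V(2) by (auto simp: N_def)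
  have "continuous_map (top_of_set N) (subtopology M (k ` cball 0 1)) c"
    using cN c(1) by (simp add: continuous_map_in_subtopology continuous_map_from_subtopology image_subset_iff_funcset)
  then have "continuous_map (top_of_set N) (top_of_set (cball 0 1)) (k' \<circ> c)"
    using cont' continuous_map_compose by blast
  then have cont: "continuous_on N (k' \<circ> c)" by simp
  have "inj_on (k' \<circ> c) N"
  proof (rule comp_inj_on)
    show "inj_on c N" using c(2) inj_on_subset by blast
    show "inj_on k' (c ` N)" using cN k_k'(1) by (intro inj_on_inverseI[of _ k]) blast
  qed
  then have "open ((k' \<circ> c) ` N)" using invariance_of_domain[OF cont \<open>open N\<close>] by blast
  moreover have "(k' \<circ> c) ` N \<subseteq> cball 0 1" using cN k_k'(2) by force
  ultimately have "(k' \<circ> c) ` N \<subseteq> ball 0 1" by (metis interior_cball interior_maximal)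
  moreover obtain z where z: "x = c z" using c(3) by blast
  moreover have "z \<in> N" using x z by (simp add: N_def)
  ultimately have "k' x \<in> ball 0 1" unfolding z by (metis comp_apply imageI subsetD)
  then show "x \<in> k ` ball 0 1" using k_k'(1)[of x] x V(2) by (metis image_eqI subsetD)
qed

text \<open>Invariance of domain in the other direction: \<open>inv c \<circ> k\<close> is open near
  each point of the open disc, and so is the chart \<open>c\<close>.\<close>

lemma (in disc_chart) openin_ball:
  assumes M: "closed_surface M" shows "openin M (k ` ball 0 1)"
proof (subst openin_subopen, intro ballI)
  fix y assume "y \<in> k ` ball 0 1"
  then obtain b where b: "b \<in> ball 0 1" "y = k b" by blast
  have "y \<in> topspace M" using b image_topspace by auto
  then obtain c :: "real^2 \<Rightarrow> 'a" where c: "inj c" "y \<in> range c"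
    "\<And>S. open S \<Longrightarrow> openin M (c ` S)" "continuous_map (subtopology M (range c)) euclidean (inv c)"
    using surface_chart[OF M] by metis
  define N where "N = {b\<in>ball 0 1. k b \<in> range c}"
  have ck: "continuous_map (top_of_set (ball 0 1)) M k" by (rule cont_subset) auto
  have "openin (top_of_set (ball 0 1)) N"
    using openin_continuous_map_preimage[OF ck c(3)[OF open_UNIV]] by (simp add: N_def)
  then have "open N" using openin_open_trans by blast
  have "continuous_map (top_of_set N) M k" by (rule cont_subset) (auto simp: N_def)
  then have "continuous_map (top_of_set N) (subtopology M (range c)) k"
    by (auto simp: continuous_map_in_subtopology N_def)
  then have "continuous_map (top_of_set N) euclidean (inv c \<circ> k)"
    using c(4) continuous_map_compose by blast
  then have cont: "continuous_on N (inv c \<circ> k)" by simp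
  have cinv: "c (inv c z) = z" if "z \<in> range c" for z using that by (simp add: f_inv_into_f)
  have "inj_on (inv c \<circ> k) N"
  proof (rule comp_inj_on)
    show "inj_on k N" using inj by (rule inj_on_subset) (auto simp: N_def)
    show "inj_on (inv c) (k ` N)" using cinv by (intro inj_on_inverseI[of _ c]) (auto simp: N_def)
  qed
  then have "open ((inv c \<circ> k) ` N)" using invariance_of_domain[OF cont \<open>open N\<close>] by blast
  then have "openin M (c ` (inv c \<circ> k) ` N)" by (rule c(3))
  moreover have "c ` (inv c \<circ> k) ` N = k ` N"
    unfolding image_image using cinv by (intro image_cong) (auto simp: N_def)
  moreover have "y \<in> k ` N" using b c(2) by (auto simp: N_def)
  moreover have "k ` N \<subseteq> k ` ball 0 1" by (auto simp: N_def)
  ultimately show "\<exists>T. openin M T \<and> y \<in> T \<and> T \<subseteq> k ` ball 0 1" by metis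
qed

text \<open>\<open>P e\<close> stands for the two ends of the edge \<open>e\<close>. Starting from
  one pair \<open>{a,b}\<close>, the other two pairs each contain one of its points, and their
  second points must coincide.\<close>

lemma triangle_of_pairs:
  assumes E: "card E = 3" and P: "\<And>e. e \<in> E \<Longrightarrow> \<exists>u v. u \<noteq> v \<and> P e = {u,v}"
    and I: "\<And>e f u v. e \<in> E \<Longrightarrow> f \<in> E \<Longrightarrow> u \<in> P e \<inter> P f \<Longrightarrow> v \<in> P e \<inter> P f \<Longrightarrow> u \<noteq> v \<Longrightarrow> e = f"
    and S: "\<And>e u. e \<in> E \<Longrightarrow> u \<in> P e \<Longrightarrow> \<exists>f\<in>E. f \<noteq> e \<and> u \<in> P f"
  obtains a b c x y z where "a \<noteq> b" "b \<noteq> c" "a \<noteq> c" "E = {x,y,z}" "x \<noteq> y" "y \<noteq> z" "x \<noteq> z"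
    "P x = {b,c}" "P y = {a,c}" "P z = {a,b}"
proof -
  obtain z p q where E3: "E = {z,p,q}" "z \<noteq> p" "p \<noteq> q" "z \<noteq> q"
    using E by (metis card_3_iff)
  obtain a b where ab: "a \<noteq> b" "P z = {a,b}" using P[of z] E3 by blast
  obtain y where y: "y \<in> E" "y \<noteq> z" "a \<in> P y" using S[of z a] E3 ab by blast
  obtain x where x: "x \<in> E" "x \<noteq> z" "b \<in> P x" using S[of z b] E3 ab by blast
  have xy: "x \<noteq> y" using I[of z y a b] x y ab E3 by blast
  obtain c where c: "P y = {a,c}" "a \<noteq> c" using P[OF y(1)] y(3) by (metis doubleton_eq_iff insert_iff singletonD)
  have cb: "c \<noteq> b" using I[of z y a b] y ab c E3 by blast
  have E': "E = {x,y,z}" using E3 x y xy by auto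
  have "c \<in> P y" "c \<notin> P z" using c ab cb by simp_all
  then have "c \<in> P x" using S[OF y(1), of c] E' by auto
  then have "P x = {b,c}" using P[OF x(1)] x(3) cb by (metis doubleton_eq_iff insert_iff singletonD)
  then show ?thesis using that[of a b c x y z] ab c cb E' xy x(2) y(2) by metis
qed

section \<open>The boundary of a face as a triangle of edges\<close>

locale triangulated_surface =
  fixes M :: "'a topology" and \<Gamma> :: "'a drawn_graph"
  assumes M: "closed_surface M" and tri: "surface_triangulation M \<Gamma>"
begin

abbreviation comps :: "'a set set" where
  "comps \<equiv> connected_components_of (subtopology M (topspace M - skeleton \<Gamma>))"

lemma Haus: "Hausdorff_space M" using M by (simp add: closed_surface_def)

lemma graph: "embedded_simple_graph M \<Gamma>" "connected_graph M \<Gamma>"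
  using tri by (simp_all add: surface_triangulation_def surface_graph_def)

lemma disc: "G \<in> faces M \<Gamma> \<Longrightarrow> subtopology M G homeomorphic_space top_of_set (cball (0::real^2) 1)"
  using tri by (simp add: surface_triangulation_def surface_graph_def)

lemma two_faces: "e \<in> edges \<Gamma> \<Longrightarrow> card {G\<in>faces M \<Gamma>. e \<subseteq> G} = 2"
  using tri by (simp add: surface_triangulation_def surface_graph_def)

lemma three_edges: "G \<in> faces M \<Gamma> \<Longrightarrow> card {e\<in>edges \<Gamma>. e \<subseteq> G} = 3"
  using tri by (simp add: surface_triangulation_def)

lemma faces_Int: "G \<in> faces M \<Gamma> \<Longrightarrow> H \<in> faces M \<Gamma> \<Longrightarrow> G \<noteq> H \<Longrightarrow>
    G \<inter> H \<in> edges \<Gamma> \<or> (\<exists>v\<in>vertices \<Gamma>. G \<inter> H = {v}) \<or> G \<inter> H = {}"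
  using tri by (simp add: surface_triangulation_def surface_graph_def)

lemma finite_graph: "finite (vertices \<Gamma>)" "finite (edges \<Gamma>)" "vertices \<Gamma> \<subseteq> topspace M"
  using graph by (simp_all add: embedded_simple_graph_def)

lemma edge_closed: assumes "e \<in> edges \<Gamma>" shows "closedin M e"
proof -
  obtain u v where "arc_joining M u v e" using embedded_edge[OF graph(1) assms] by metis
  then obtain p where p: "continuous_map (top_of_set {0..1::real}) M p" "p ` {0..1} = e"
    by (auto simp: arc_joining_iff[OF Haus])
  have "compactin M (p ` {0..1})"
    by (rule image_compactin[OF _ p(1)]) (simp add: compactin_subtopology)
  then show ?thesis using p(2) compactin_imp_closedin[OF Haus] by simp
qed

lemma closedin_finite_vertices: "V \<subseteq> vertices \<Gamma> \<Longrightarrow> closedin M V"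
  using finite_graph Haus Hausdorff_imp_t1_space t1_space_closedin_finite
  by (metis finite_subset subset_trans)

lemma comps_open: assumes "C \<in> comps" shows "openin M C"
proof -
  have "closedin M (skeleton \<Gamma>)" unfolding skeleton_def
    using edge_closed finite_graph closedin_finite_vertices by (intro closedin_Un closedin_Union) auto
  then have "openin M (topspace M - skeleton \<Gamma>)" by blast
  then show ?thesis
    using locally_connected_surface[OF M] assms locally_connected_space_open_connected_components by blast
qed

lemma comps_disjoint: "C \<in> comps \<Longrightarrow> D \<in> comps \<Longrightarrow> C \<noteq> D \<Longrightarrow> C \<inter> D = {}"
  using connected_components_of_overlap[of C _ D] by metis

text \<open>Identifies the open disc with the component and the circle with a union of edges. The
  component lies in the open disc by invariance of domain; conversely the rest of the face belongs
  to the skeleton, and the skeleton stays out of the open disc.\<close>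

lemma comp_chart:
  assumes C: "C \<in> comps"
  obtains k where "disc_chart M k" "k ` cball 0 1 = M closure_of C" "k ` ball 0 1 = C"
    "k ` sphere 0 1 = \<Union>{e\<in>edges \<Gamma>. e \<subseteq> k ` cball 0 1}"
proof -
  let ?G = "M closure_of C"
  have G: "?G \<in> faces M \<Gamma>" using C by (simp add: faces_def)
  have "top_of_set (cball (0::real^2) 1) homeomorphic_space subtopology M ?G"
    using disc[OF G] homeomorphic_space_sym by blast
  then obtain k where k: "homeomorphic_map (top_of_set (cball (0::real^2) 1)) (subtopology M ?G) k"
    using homeomorphic_space by blast
  have kG: "k ` cball 0 1 = ?G"
    using homeomorphic_imp_surjective_map[OF k] closure_of_subset_topspace[of M C] by auto
  interpret disc_chart M k
    using Haus k kG by unfold_locales (simp_all add: embedding_map_def)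
  let ?B = "k ` ball 0 1"
  have Bop: "openin M ?B" using openin_ball[OF M] .
  have CG: "C \<subseteq> ?G" using closure_of_subset[OF openin_subset[OF comps_open[OF C]]] .
  have CB: "C \<subseteq> ?B" using open_subset_disc[OF M comps_open[OF C]] CG kG by simp
  have BG: "?B \<subseteq> ?G" unfolding kG[symmetric] by (intro image_mono) auto
  have DG: "D \<inter> ?G = {}" if "D \<in> comps" "D \<noteq> C" for D
    using openin_Int_closure_of_eq_empty[OF comps_open[OF that(1)], of C] comps_disjoint[OF that(1) C that(2)] by simp
  have GC: "?G - C \<subseteq> skeleton \<Gamma>"
  proof
    fix y assume y: "y \<in> ?G - C"
    show "y \<in> skeleton \<Gamma>"
    proof (rule ccontr)
      assume "y \<notin> skeleton \<Gamma>"
      then have "y \<in> topspace (subtopology M (topspace M - skeleton \<Gamma>))"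
        using y closure_of_subset_topspace[of M C] by auto
      then obtain D where "D \<in> comps" "y \<in> D"
        by (metis UnionE Union_connected_components_of)
      then show False using DG[of D] y by blast
    qed
  qed
  have otherB: "H \<inter> ?B = {}" if H: "H \<in> faces M \<Gamma>" "H \<noteq> ?G" for H
  proof -
    obtain D where D: "D \<in> comps" "H = M closure_of D" using H by (auto simp: faces_def)
    then have "D \<noteq> C" using H by blast
    then have "?B \<inter> D = {}" using DG[OF D(1)] BG by blast
    then show ?thesis using openin_Int_closure_of_eq_empty[OF Bop, of D] D(2) by (simp add: Int_commute)
  qed
  \<comment> \<open>An edge lies in a second face as well, and that face misses the open
    disc.\<close>
  have edgeB: "e \<inter> ?B = {}" if e: "e \<in> edges \<Gamma>" for e
  proof -
    have "\<not> {H\<in>faces M \<Gamma>. e \<subseteq> H} \<subseteq> {?G}"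
    proof
      assume "{H\<in>faces M \<Gamma>. e \<subseteq> H} \<subseteq> {?G}"
      then have "card {H\<in>faces M \<Gamma>. e \<subseteq> H} \<le> 1" using card_mono[of "{?G}"] by fastforce
      then show False using two_faces[OF e] by simp
    qed
    then show ?thesis using otherB by blast
  qed
  have split: "cball 0 1 = ball 0 1 \<union> sphere (0::real^2) 1" "ball 0 1 \<inter> sphere 0 1 = ({}::(real^2) set)" by auto
  have BS: "?B \<inter> k ` sphere 0 1 = {}"
    using image_Int[of "ball 0 1" "sphere 0 1"] split(2) by force
  have GBS: "?G = ?B \<union> k ` sphere 0 1" using kG split(1) by (metis image_Un)
  \<comment> \<open>By \<open>edgeB\<close> such a vertex is on no edge, so connectedness makes it
    the only vertex and leaves no edges. The boundary circle, being part of the skeleton, would then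
    lie in \<open>{x}\<close>, although \<open>x\<close> is in the open disc.\<close>
  have vB: "x \<notin> ?B" if x: "x \<in> vertices \<Gamma>" for x
  proof
    assume xB: "x \<in> ?B"
    then have noe: "x \<notin> e" if "e \<in> edges \<Gamma>" for e using edgeB[OF that] by blast
    have only: "v = x" if v: "v \<in> vertices \<Gamma>" for v
    proof (rule ccontr)
      assume "v \<noteq> x"
      moreover have "(joined M \<Gamma>)\<^sup>*\<^sup>* x v" using graph(2) x v unfolding connected_graph_def by blast
      ultimately obtain w where "joined M \<Gamma> x w" by (metis converse_rtranclpE)
      then obtain e where e: "e \<in> edges \<Gamma>" "arc_joining M x w e" by (auto simp: joined_def)
      then have "x \<in> e" by (auto simp: arc_joining_def)
      then show False using noe e(1) by blast
    qed
    have "edges \<Gamma> = {}" using embedded_edge[OF graph(1)] only by (metis equals0I)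
    then have "skeleton \<Gamma> \<subseteq> {x}" using only by (auto simp: skeleton_def)
    then have "k ` sphere 0 1 \<subseteq> {x}" using GC CB BS GBS by blast
    then have "k ` sphere 0 1 = {}" using BS xB by blast
    moreover have "sphere (0::real^2) 1 \<noteq> {}" by simp
    ultimately show False by blast
  qed
  have Bsk: "?B \<inter> skeleton \<Gamma> = {}" using edgeB vB unfolding skeleton_def by blast
  have B: "?B = C" using CB GC BG Bsk by blast
  \<comment> \<open>Another face \<open>H\<close> containing \<open>e\<close> meets
    \<open>?G\<close> in a set with the non-vertex \<open>x\<close>, hence in an edge; that edge
    shares \<open>x\<close> with \<open>e\<close>, so it is \<open>e\<close>.\<close>
  have in_edge: "e \<subseteq> ?G" if e: "e \<in> edges \<Gamma>" and x: "x \<in> e" "x \<in> ?G" "x \<notin> vertices \<Gamma>" for e x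
  proof (rule ccontr)
    assume nG: "\<not> e \<subseteq> ?G"
    have "{H\<in>faces M \<Gamma>. e \<subseteq> H} \<noteq> {}" using two_faces[OF e] by force
    then obtain H where H: "H \<in> faces M \<Gamma>" "e \<subseteq> H" by blast
    then have "H \<noteq> ?G" using nG by blast
    then consider "H \<inter> ?G \<in> edges \<Gamma>" | "\<exists>v\<in>vertices \<Gamma>. H \<inter> ?G = {v}" | "H \<inter> ?G = {}"
      using faces_Int[OF H(1) G] by blast
    then show False
    proof cases
      case 1
      have "x \<in> e \<inter> (H \<inter> ?G)" using x H by blast
      then have "e = H \<inter> ?G" using edges_Int[OF graph(1) e 1] x(3) by (metis emptyE singletonD)
      then show False using nG by blast
    next
      case 2
      then obtain v where "v \<in> vertices \<Gamma>" "H \<inter> ?G = {v}" by blast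
      moreover have "x \<in> H \<inter> ?G" using x H by blast
      ultimately show False using x(3) by simp
    next
      case 3 then show False using x H by blast
    qed
  qed
  let ?U = "\<Union>{e\<in>edges \<Gamma>. e \<subseteq> ?G}"
  \<comment> \<open>The finitely many parameters of vertices. Other boundary points lie on edges of
    this face by \<open>in_edge\<close>, and taking closures recovers the full circle.\<close>
  let ?K = "{z\<in>cball 0 1. k z \<in> vertices \<Gamma>}"
  have "finite ?K"
  proof -
    have "?K \<subseteq> k' ` vertices \<Gamma>" using k'_k by force
    then show ?thesis using finite_graph(1) finite_surj by blast
  qed
  have "closedin M ?U" using edge_closed finite_graph by (intro closedin_Union) auto
  moreover have "k ` (sphere 0 1 - ?K) \<subseteq> ?U"
  proof
    fix y assume "y \<in> k ` (sphere 0 1 - ?K)"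
    then obtain z where z: "z \<in> sphere 0 1" "z \<notin> ?K" "y = k z" by blast
    then have "y \<in> k ` sphere 0 1" "y \<notin> vertices \<Gamma>" by auto
    moreover have "y \<in> ?G" "y \<notin> C" using calculation(1) GBS BS B by blast+
    moreover have "y \<in> skeleton \<Gamma>" using calculation GC by blast
    ultimately obtain e where "e \<in> edges \<Gamma>" "y \<in> e" unfolding skeleton_def by blast
    then show "y \<in> ?U" using in_edge \<open>y \<in> ?G\<close> \<open>y \<notin> vertices \<Gamma>\<close> by blast
  qed
  ultimately have "M closure_of (k ` (sphere 0 1 - ?K)) \<subseteq> ?U" by (rule closure_of_minimal[rotated])
  moreover have "M closure_of (k ` (sphere 0 1 - ?K)) = k ` sphere 0 1"
  proof -
    have "sphere 0 1 - ?K \<subseteq> cball 0 1" by auto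
    from closure_of_image[OF this] show ?thesis
      unfolding closure_circle_minus_finite[OF \<open>finite ?K\<close>] .
  qed
  ultimately have "k ` sphere 0 1 \<subseteq> ?U" by simp
  moreover have "?U \<subseteq> k ` sphere 0 1"
  proof
    fix y assume "y \<in> ?U"
    then obtain e where e: "e \<in> edges \<Gamma>" "y \<in> e" "y \<in> ?G" by blast
    then have "y \<notin> ?B" using edgeB[OF e(1)] by blast
    then show "y \<in> k ` sphere 0 1" using e(3) GBS by simp
  qed
  ultimately have bd: "k ` sphere 0 1 = ?U" by blast
  show ?thesis by (rule that[OF disc_chart_axioms kG B]) (simp only: kG bd)
qed

text \<open>Three arcs cover the boundary circle and meet only in vertices, so each end of one arc
  lies on another; three such pairs of ends form a triangle.\<close>

lemma face_triangle:
  assumes G: "G \<in> faces M \<Gamma>"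
  obtains k a b c x y z where "disc_chart M k" "G = k ` cball 0 1" "k ` ball 0 1 \<in> comps"
    "k ` sphere 0 1 = \<Union>{e\<in>edges \<Gamma>. e \<subseteq> G}"
    "a \<noteq> b" "b \<noteq> c" "a \<noteq> c" "x \<noteq> y" "y \<noteq> z" "x \<noteq> z"
    "{e\<in>edges \<Gamma>. e \<subseteq> G} = {x,y,z}" "vertices \<Gamma> \<inter> G = {a,b,c}"
    "x \<inter> vertices \<Gamma> = {b,c}" "y \<inter> vertices \<Gamma> = {a,c}" "z \<inter> vertices \<Gamma> = {a,b}"
proof -
  obtain C where C: "C \<in> comps" "G = M closure_of C" using G by (auto simp: faces_def)
  obtain k where dk: "disc_chart M k" and k: "k ` cball 0 1 = M closure_of C" "k ` ball 0 1 = C"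
    "k ` sphere 0 1 = \<Union>{e\<in>edges \<Gamma>. e \<subseteq> k ` cball 0 1}"
    using comp_chart[OF C(1)] .
  interpret disc_chart M k by (rule dk)
  define E where "E = {e\<in>edges \<Gamma>. e \<subseteq> G}"
  have kE: "k ` sphere 0 1 = \<Union>E" using k C unfolding E_def by simp
  have E3: "card E = 3" using three_edges[OF G] E_def by simp
  have Ee: "e \<in> edges \<Gamma>" "e \<subseteq> k ` cball 0 1" if "e \<in> E" for e using that k(1) C(2) by (auto simp: E_def)
  have P: "\<exists>u v. u \<noteq> v \<and> e \<inter> vertices \<Gamma> = {u,v}" if "e \<in> E" for e
    using embedded_edge[OF graph(1) Ee(1)[OF that]] by metis
  have I: "e = f" if "e \<in> E" "f \<in> E" "u \<in> (e \<inter> vertices \<Gamma>) \<inter> (f \<inter> vertices \<Gamma>)"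
    "v \<in> (e \<inter> vertices \<Gamma>) \<inter> (f \<inter> vertices \<Gamma>)" "u \<noteq> v" for e f u v
    using edge_eqI[OF graph(1) Ee(1)[OF that(1)] Ee(1)[OF that(2)], of u v] that(3-5) by simp
  have sph: "sphere 0 1 = (\<Union>e\<in>E. k' ` e)"
  proof -
    have "k' ` k ` sphere 0 1 = sphere 0 1" unfolding image_image by (simp add: k'_k)
    then show ?thesis using kE by (metis image_Union)
  qed
  have cmp: "compact (k' ` e)" if e: "e \<in> E" for e
  proof -
    obtain u v where "arc_joining M u v e" using embedded_edge[OF graph(1) Ee(1)[OF e]] by metis
    then obtain q where "arc q" "path_image q = k' ` e" using arc_k' Ee(2)[OF e] by metis
    then show ?thesis using compact_arc_image by metis
  qed
  have injk': "inj_on k' (k ` cball 0 1)" using k_k'(1) by (rule inj_on_inverseI)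
  \<comment> \<open>\<open>k'\<close> carries the edges to compact subsets of the circle; an end of
    \<open>e\<close> on no other edge is ruled out by \<open>arc_endpoint_shared\<close>.\<close>
  have S: "\<exists>f\<in>E. f \<noteq> e \<and> u \<in> f \<inter> vertices \<Gamma>" if e: "e \<in> E" and u: "u \<in> e \<inter> vertices \<Gamma>" for e u
  proof -
    obtain p q where "p \<noteq> q" "e \<inter> vertices \<Gamma> = {p,q}" using P[OF e] by blast
    then obtain v where v: "u \<noteq> v" "e \<inter> vertices \<Gamma> = {u,v}" using u by (metis doubleton_eq_iff insert_iff singletonD)
    let ?B = "\<Union>f\<in>E - {e}. k' ` f"
    have finE: "finite E" using E3 by (simp add: card_ge_0_finite)
    have "(\<Union>f\<in>insert e (E - {e}). k' ` f) = k' ` e \<union> ?B" by (rule UN_insert)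
    then have cov: "sphere 0 1 = k' ` e \<union> ?B" using sph e by (simp only: insert_Diff)
    have B: "closed ?B" using finE cmp compact_imp_closed by (intro closed_UN) auto
    have AB: "k' ` e \<inter> ?B \<subseteq> {k' u, k' v}"
    proof
      fix t assume "t \<in> k' ` e \<inter> ?B"
      then obtain f r s where f: "f \<in> E" "f \<noteq> e" "r \<in> e" "s \<in> f" "t = k' r" "t = k' s" by blast
      then have "r = s" using injk' Ee(2) e by (meson inj_onD subsetD)
      then have rf: "r \<in> e \<inter> f" using f(3,4) by simp
      have "e \<inter> f \<subseteq> vertices \<Gamma>"
        using edges_Int[OF graph(1) Ee(1)[OF e] Ee(1)[OF f(1)] f(2)[symmetric]] by (elim disjE bexE) simp_all
      then have "r \<in> e \<inter> vertices \<Gamma>" using rf by (metis IntD1 IntI subsetD)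
      then show "t \<in> {k' u, k' v}" unfolding v(2) f(5) by auto
    qed
    have uv: "u \<in> e" "v \<in> e" using v(2) by blast+
    then have kuv: "k' u \<noteq> k' v" using v(1) injk' Ee(2)[OF e] by (meson inj_onD subsetD)
    have "\<not> ?B \<subseteq> {k' v}"
    proof
      assume B1: "?B \<subseteq> {k' v}"
      have "E - {e} \<noteq> {}" using E3 by (metis Diff_eq_empty_iff card_mono card.empty card_insert_disjoint
            empty_iff finite.emptyI finite_insert numeral_3_eq_3 One_nat_def Suc_le_mono Zero_not_Suc le_zero_eq)
      then obtain f where f: "f \<in> E" "f \<noteq> e" by blast
      obtain p q where pq: "p \<noteq> q" "f \<inter> vertices \<Gamma> = {p,q}" using P[OF f(1)] by blast
      then have "p \<in> f" "q \<in> f" by blast+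
      then have "k' p \<in> ?B" "k' q \<in> ?B" using f by blast+
      then have "k' p = k' q" using B1 by (metis singletonD subsetD)
      then show False using injk' \<open>p \<in> f\<close> \<open>q \<in> f\<close> pq(1) Ee(2)[OF f(1)] by (meson inj_onD subsetD)
    qed
    then have "k' u \<in> ?B"
      using arc_endpoint_shared[OF cov compact_imp_closed[OF cmp[OF e]] B AB] uv kuv by blast
    then obtain f s where f: "f \<in> E" "f \<noteq> e" "s \<in> f" "k' u = k' s" by blast
    then have "u = s" using injk' Ee(2) e uv(1) by (meson inj_onD subsetD)
    then show ?thesis using f u by blast
  qed
  obtain a b c x y z where abc: "a \<noteq> b" "b \<noteq> c" "a \<noteq> c" "E = {x,y,z}" "x \<noteq> y" "y \<noteq> z" "x \<noteq> z"
    "x \<inter> vertices \<Gamma> = {b,c}" "y \<inter> vertices \<Gamma> = {a,c}" "z \<inter> vertices \<Gamma> = {a,b}"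
    by (rule triangle_of_pairs[of E "\<lambda>e. e \<inter> vertices \<Gamma>", OF E3 P I S])
  have "vertices \<Gamma> \<inter> G = {a,b,c}"
  proof
    show "vertices \<Gamma> \<inter> G \<subseteq> {a,b,c}"
    proof
      fix v assume v: "v \<in> vertices \<Gamma> \<inter> G"
      have "v \<notin> C" using v connected_components_of_subset[OF C(1)] by (auto simp: skeleton_def)
      moreover have "k ` cball 0 1 = C \<union> k ` sphere 0 1"
      proof -
        have "cball 0 1 = ball 0 1 \<union> sphere (0::real^2) 1" by auto
        then show ?thesis using k(2) by (metis image_Un)
      qed
      ultimately have "v \<in> k ` sphere 0 1" using v C(2) k(1) by blast
      then have "v \<in> x \<or> v \<in> y \<or> v \<in> z" using kE abc(4) by simp
      then show "v \<in> {a,b,c}" using v abc(8-10) by blast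
    qed
    have "x \<subseteq> G" "z \<subseteq> G" using abc(4) by (auto simp: E_def)
    then show "{a,b,c} \<subseteq> vertices \<Gamma> \<inter> G" using abc(8-10) by blast
  qed
  then show ?thesis
    using that[OF dk, of a b c x y z] abc k C kE unfolding E_def[symmetric] by simp
qed

end

section \<open>The complex of a triangulated surface and its connectedness\<close>

definition complex_of :: "'a topology \<Rightarrow> 'a drawn_graph \<Rightarrow> 'a set set" where
  "complex_of M \<Gamma> = (\<lambda>G. vertices \<Gamma> \<inter> G) ` faces M \<Gamma>"

text \<open>A punctured disc in the plane is connected, so near each removed point only one side of
  a separation is present. Adding the point to that side would separate the whole surface.\<close>

lemma connectedin_surface_minus_finite:
  assumes M: "closed_surface M" and V: "finite V" "V \<subseteq> topspace M"
  shows "connectedin M (topspace M - V)"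
proof (rule ccontr)
  let ?X = "topspace M - V"
  have Haus: "Hausdorff_space M" and conn: "connected_space M" using M by (simp_all add: closed_surface_def)
  have cl: "closedin M S" if "S \<subseteq> V" for S
    using V Haus Hausdorff_imp_t1_space t1_space_closedin_finite that by (metis finite_subset subset_trans)
  assume "\<not> connectedin M ?X"
  then obtain E1 E2 where E: "openin M E1" "openin M E2" "?X \<subseteq> E1 \<union> E2" "E1 \<inter> E2 \<inter> ?X = {}"
    "E1 \<inter> ?X \<noteq> {}" "E2 \<inter> ?X \<noteq> {}"
    unfolding connectedin by blast
  have Xop: "openin M ?X" using cl[of V] by blast
  define X1 X2 where "X1 = E1 \<inter> ?X" and "X2 = E2 \<inter> ?X"
  have X: "openin M X1" "openin M X2" "X1 \<union> X2 = ?X" "X1 \<inter> X2 = {}" "X1 \<noteq> {}" "X2 \<noteq> {}"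
    using E Xop unfolding X1_def X2_def by auto
  have nb: "\<exists>N. openin M N \<and> v \<in> N \<and> (N - {v} \<subseteq> X1 \<or> N - {v} \<subseteq> X2) \<and> N - {v} \<noteq> {}"
    if v: "v \<in> V" for v
  proof -
    have "v \<in> topspace M" using v V by blast
    then obtain c :: "real^2 \<Rightarrow> 'a" where c: "continuous_map euclidean M c" "inj c" "v \<in> range c"
        "\<And>S. open S \<Longrightarrow> openin M (c ` S)"
      using surface_chart[OF M] by metis
    obtain z where z: "v = c z" using c(3) by blast
    have "closedin M (V - {v})" using cl by blast
    then have "openin M (topspace M - (V - {v}))" by blast
    moreover have "open (c -` S)" if "openin M S" for S
      using openin_continuous_map_preimage[OF c(1) that] by (simp add: vimage_def)
    ultimately have "open (c -` (topspace M - (V - {v})))" by blast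
    moreover have "z \<in> c -` (topspace M - (V - {v}))" using z \<open>v \<in> topspace M\<close> by simp
    ultimately obtain r where r: "r > 0" "ball z r \<subseteq> c -` (topspace M - (V - {v}))"
      using open_contains_ball by blast
    let ?N = "c ` ball z r"
    have Nv: "?N - {v} = c ` (ball z r - {z})" using c(2) z by (auto dest: injD)
    have "connected (ball z r - {z})" by (rule connected_open_delete) auto
    then have "connectedin M (?N - {v})" unfolding Nv
      by (intro connectedin_continuous_map_image[OF c(1)]) simp
    moreover have "?N - {v} \<subseteq> X1 \<union> X2" unfolding X(3) using r(2) by auto
    ultimately have "?N - {v} \<subseteq> X1 \<or> ?N - {v} \<subseteq> X2"
      using connectedin_subset_separated_union[of M "?N - {v}" X1 X2] X separatedin_open_sets[of M X1 X2]
      by (simp add: disjnt_def)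
    \<comment> \<open>A point at half the radius: the punctured disc is nonempty, so it cannot lie
      on both sides.\<close>
    moreover have "z + (r/2) *\<^sub>R axis 1 1 \<in> ball z r - {z}" using r(1) by (simp add: dist_norm axis_eq_0_iff)
    then have "?N - {v} \<noteq> {}" unfolding Nv by blast
    moreover have "v \<in> ?N" using z r(1) by simp
    ultimately show ?thesis using c(4)[of "ball z r"] by blast
  qed
  then obtain N where N: "\<And>v. v \<in> V \<Longrightarrow> openin M (N v) \<and> v \<in> N v \<and> (N v - {v} \<subseteq> X1 \<or> N v - {v} \<subseteq> X2) \<and> N v - {v} \<noteq> {}"
    by metis
  \<comment> \<open>One side together with the removed points that belong to it; adding whole
    neighbourhoods keeps it open.\<close>
  define Y where "Y = (\<lambda>Z. Z \<union> (\<Union>v\<in>{v\<in>V. N v - {v} \<subseteq> Z}. N v))"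
  have Yop: "openin M (Y Z)" if "openin M Z" for Z
    unfolding Y_def using that N by (intro openin_Un openin_Union) auto
  have Yeq: "Y Z = Z \<union> {v\<in>V. N v - {v} \<subseteq> Z}" for Z
    unfolding Y_def using N by blast
  have "topspace M \<subseteq> Y X1 \<union> Y X2"
  proof
    fix x assume "x \<in> topspace M"
    then show "x \<in> Y X1 \<union> Y X2" using X(3) N[of x] unfolding Yeq by (cases "x \<in> V") auto
  qed
  moreover have "Y X1 \<inter> Y X2 = {}"
  proof (rule ccontr)
    assume "Y X1 \<inter> Y X2 \<noteq> {}"
    then obtain x where x: "x \<in> Y X1" "x \<in> Y X2" by blast
    show False
    proof (cases "x \<in> V")
      case True
      then have "x \<notin> X1" "x \<notin> X2" using X(3) by blast+
      then have "N x - {x} \<subseteq> X1" "N x - {x} \<subseteq> X2" using x unfolding Yeq by blast+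
      then show False using N[OF True] X(4) by blast
    next
      case False
      then show False using x X(4) unfolding Yeq by blast
    qed
  qed
  moreover have "Y X1 \<noteq> {}" "Y X2 \<noteq> {}" using X(5,6) unfolding Yeq by blast+
  ultimately show False using conn Yop[OF X(1)] Yop[OF X(2)] unfolding connected_space_def by blast
qed

context triangulated_surface
begin

lemma edge_exists:
  assumes "G \<in> faces M \<Gamma>" "u \<in> vertices \<Gamma> \<inter> G" "v \<in> vertices \<Gamma> \<inter> G" "u \<noteq> v"
  obtains e where "e \<in> edges \<Gamma>" "e \<subseteq> G" "e \<inter> vertices \<Gamma> = {u,v}"
proof -
  obtain a b c x y z where *: "{e\<in>edges \<Gamma>. e \<subseteq> G} = {x,y,z}" "vertices \<Gamma> \<inter> G = {a,b,c}"
    "x \<inter> vertices \<Gamma> = {b,c}" "y \<inter> vertices \<Gamma> = {a,c}" "z \<inter> vertices \<Gamma> = {a,b}"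
    by (rule face_triangle[OF assms(1)])
  have E: "x \<in> edges \<Gamma>" "x \<subseteq> G" "y \<in> edges \<Gamma>" "y \<subseteq> G" "z \<in> edges \<Gamma>" "z \<subseteq> G" using *(1) by blast+
  have "{u,v} = {b,c} \<or> {u,v} = {a,c} \<or> {u,v} = {a,b}" using assms(2-4) unfolding *(2) by auto
  then show ?thesis using that[OF E(1,2)] that[OF E(3,4)] that[OF E(5,6)] *(3-5) by metis
qed

text \<open>In a simple graph the two ends determine the edge. Incidence of edges and faces thereby
  becomes incidence of vertex sets.\<close>

lemma edge_face_iff:
  assumes "G \<in> faces M \<Gamma>" "e \<in> edges \<Gamma>" "e \<inter> vertices \<Gamma> = {u,v}" "u \<noteq> v"
  shows "e \<subseteq> G \<longleftrightarrow> u \<in> vertices \<Gamma> \<inter> G \<and> v \<in> vertices \<Gamma> \<inter> G"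
proof
  assume "e \<subseteq> G" then show "u \<in> vertices \<Gamma> \<inter> G \<and> v \<in> vertices \<Gamma> \<inter> G" using assms(3) by blast
next
  assume *: "u \<in> vertices \<Gamma> \<inter> G \<and> v \<in> vertices \<Gamma> \<inter> G"
  obtain f where f: "f \<in> edges \<Gamma>" "f \<subseteq> G" "f \<inter> vertices \<Gamma> = {u,v}"
    using edge_exists[OF assms(1) conjunct1[OF *] conjunct2[OF *] assms(4)] .
  have "u \<in> e \<inter> f" "v \<in> e \<inter> f" using assms(3) f(3) by blast+
  then have "e = f" using edge_eqI[OF graph(1) assms(2) f(1)] assms(4) by blast
  then show "e \<subseteq> G" using f(2) by simp
qed

lemma face_vertices:
  assumes "G \<in> faces M \<Gamma>"
  obtains a b c where "a \<noteq> b" "b \<noteq> c" "a \<noteq> c" "vertices \<Gamma> \<inter> G = {a,b,c}"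
  by (rule face_triangle[OF assms])

lemma face_Int_vertices:
  assumes "G \<in> faces M \<Gamma>" "H \<in> faces M \<Gamma>" "G \<noteq> H"
  shows "card (vertices \<Gamma> \<inter> (G \<inter> H)) \<le> 2"
    and "card (vertices \<Gamma> \<inter> (G \<inter> H)) = 2 \<or> G \<inter> H \<subseteq> vertices \<Gamma>"
proof -
  have "(card (vertices \<Gamma> \<inter> (G \<inter> H)) = 2) \<or> (card (vertices \<Gamma> \<inter> (G \<inter> H)) \<le> 1 \<and> G \<inter> H \<subseteq> vertices \<Gamma>)"
    using faces_Int[OF assms]
  proof (elim disjE)
    assume "G \<inter> H \<in> edges \<Gamma>"
    then obtain u v where "u \<noteq> v" "(G \<inter> H) \<inter> vertices \<Gamma> = {u,v}" using embedded_edge[OF graph(1)] by metis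
    then show ?thesis by (simp add: Int_commute)
  next
    assume "\<exists>v\<in>vertices \<Gamma>. G \<inter> H = {v}"
    then obtain v where "v \<in> vertices \<Gamma>" "G \<inter> H = {v}" by blast
    then show ?thesis by simp
  qed simp
  then show "card (vertices \<Gamma> \<inter> (G \<inter> H)) \<le> 2"
    and "card (vertices \<Gamma> \<inter> (G \<inter> H)) = 2 \<or> G \<inter> H \<subseteq> vertices \<Gamma>" by auto
qed

lemma inj_face_vertices: "inj_on (\<lambda>G. vertices \<Gamma> \<inter> G) (faces M \<Gamma>)"
proof (rule inj_onI, rule ccontr)
  fix G H assume *: "G \<in> faces M \<Gamma>" "H \<in> faces M \<Gamma>" "vertices \<Gamma> \<inter> G = vertices \<Gamma> \<inter> H" "G \<noteq> H"
  obtain a b c where "a \<noteq> b" "b \<noteq> c" "a \<noteq> c" "vertices \<Gamma> \<inter> G = {a,b,c}" using face_vertices[OF *(1)] .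
  moreover have "vertices \<Gamma> \<inter> (G \<inter> H) = vertices \<Gamma> \<inter> G" using *(3) by blast
  ultimately show False using face_Int_vertices(1)[OF *(1,2,4)] by simp
qed

lemma finite_faces: "finite (faces M \<Gamma>)"
proof -
  have "faces M \<Gamma> \<subseteq> (\<Union>e\<in>edges \<Gamma>. {G\<in>faces M \<Gamma>. e \<subseteq> G})"
  proof
    fix G assume G: "G \<in> faces M \<Gamma>"
    have "{e\<in>edges \<Gamma>. e \<subseteq> G} \<noteq> {}" using three_edges[OF G] by force
    then show "G \<in> (\<Union>e\<in>edges \<Gamma>. {G\<in>faces M \<Gamma>. e \<subseteq> G})" using G by blast
  qed
  moreover have "finite (\<Union>e\<in>edges \<Gamma>. {G\<in>faces M \<Gamma>. e \<subseteq> G})"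
    using finite_graph(2) two_faces by (intro finite_UN_I) (auto intro: card_ge_0_finite)
  ultimately show ?thesis by (rule finite_subset)
qed

lemma closed_complex: "closed_complex (complex_of M \<Gamma>)"
  unfolding closed_complex_def
proof (intro conjI ballI impI)
  show "finite (complex_of M \<Gamma>)" using finite_faces by (simp add: complex_of_def)
  fix t assume "t \<in> complex_of M \<Gamma>"
  then obtain G where G: "G \<in> faces M \<Gamma>" "t = vertices \<Gamma> \<inter> G" by (auto simp: complex_of_def)
  show "card t = 3" using face_vertices[OF G(1)] G(2) by (metis card_3_iff)
  fix u v assume uv: "u \<in> t" "v \<in> t" "u \<noteq> v"
  obtain e where e: "e \<in> edges \<Gamma>" "e \<subseteq> G" "e \<inter> vertices \<Gamma> = {u,v}"
    using edge_exists[OF G(1) _ _ uv(3)] uv(1,2) G(2) by metis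
  have "{s\<in>complex_of M \<Gamma>. u \<in> s \<and> v \<in> s} = (\<lambda>G. vertices \<Gamma> \<inter> G) ` {G\<in>faces M \<Gamma>. e \<subseteq> G}"
    unfolding complex_of_def using edge_face_iff[OF _ e(1,3) uv(3)] by auto
  moreover have "inj_on (\<lambda>G. vertices \<Gamma> \<inter> G) {G\<in>faces M \<Gamma>. e \<subseteq> G}"
    using inj_face_vertices by (rule inj_on_subset) blast
  ultimately show "card {s\<in>complex_of M \<Gamma>. u \<in> s \<and> v \<in> s} = 2"
    using two_faces[OF e(1)] card_image by metis
qed

lemma ex_pierced_face:
  assumes G: "G \<in> faces M \<Gamma>"
  obtains k where "pierced_face M k \<Gamma>" "G = k ` cball 0 1"
proof -
  obtain k a b c x y z where k: "disc_chart M k" "G = k ` cball 0 1" "k ` ball 0 1 \<in> comps"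
    "k ` sphere 0 1 = \<Union>{e\<in>edges \<Gamma>. e \<subseteq> G}" and d:
    "a \<noteq> b" "b \<noteq> c" "a \<noteq> c" "x \<noteq> y" "y \<noteq> z" "x \<noteq> z" and E:
    "{e\<in>edges \<Gamma>. e \<subseteq> G} = {x,y,z}" "vertices \<Gamma> \<inter> G = {a,b,c}" and V:
    "x \<inter> vertices \<Gamma> = {b,c}" "y \<inter> vertices \<Gamma> = {a,c}" "z \<inter> vertices \<Gamma> = {a,b}"
    by (rule face_triangle[OF G])
  interpret disc_chart M k by (rule k(1))
  have deg: "card {e\<in>edges \<Gamma>. e \<subseteq> G \<and> v \<in> e} = 2" if v: "v \<in> vertices \<Gamma>" "v \<in> G" for v
  proof -
    have eq: "{e\<in>edges \<Gamma>. e \<subseteq> G \<and> v \<in> e} = {e\<in>{x,y,z}. v \<in> e}" unfolding E(1)[symmetric] by auto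
    have i: "v \<in> x \<longleftrightarrow> v \<in> {b,c}" "v \<in> y \<longleftrightarrow> v \<in> {a,c}" "v \<in> z \<longleftrightarrow> v \<in> {a,b}"
      using v(1) unfolding V[symmetric] by auto
    have "v \<in> {a,b,c}" using v unfolding E(2)[symmetric] by blast
    then consider "v = a" | "v = b" | "v = c" by blast
    then have "{e\<in>{x,y,z}. v \<in> e} = {y,z} \<or> {e\<in>{x,y,z}. v \<in> e} = {x,z} \<or> {e\<in>{x,y,z}. v \<in> e} = {x,y}"
    proof cases
      case 1
      then have "{e\<in>{x,y,z}. v \<in> e} = {y,z}" using i d by auto
      then show ?thesis by blast
    next
      case 2
      then have "{e\<in>{x,y,z}. v \<in> e} = {x,z}" using i d by auto
      then show ?thesis by blast
    next
      case 3
      then have "{e\<in>{x,y,z}. v \<in> e} = {x,y}" using i d by auto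
      then show ?thesis by blast
    qed
    then show ?thesis unfolding eq card_2_iff using d(4-6) by (elim disjE) (intro exI conjI, assumption+)+
  qed
  have "pierced_face M k \<Gamma>"
    using graph(1) k(2-4) comps_open deg by unfold_locales auto
  then show ?thesis using that k(2) by blast
qed

text \<open>The union of the faces reached from \<open>s\<close> and the union of the others are
  closed and cover the surface off the vertices. A reached and an unreached face share no edge, so
  these unions meet only in vertices, against the connectedness of the complement of the
  vertices.\<close>

lemma strongly_connected:
  assumes s: "s \<in> complex_of M \<Gamma>" and t: "t \<in> complex_of M \<Gamma>"
  shows "(edge_adjacent (complex_of M \<Gamma>))\<^sup>*\<^sup>* s t"
proof (rule ccontr)
  assume nst: "\<not> (edge_adjacent (complex_of M \<Gamma>))\<^sup>*\<^sup>* s t"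
  let ?R = "\<lambda>G. (edge_adjacent (complex_of M \<Gamma>))\<^sup>*\<^sup>* s (vertices \<Gamma> \<inter> G)"
  define A where "A = {G\<in>faces M \<Gamma>. ?R G}"
  define B where "B = {G\<in>faces M \<Gamma>. \<not> ?R G}"
  obtain G0 where G0: "G0 \<in> faces M \<Gamma>" "s = vertices \<Gamma> \<inter> G0" using s by (auto simp: complex_of_def)
  obtain G1 where G1: "G1 \<in> faces M \<Gamma>" "t = vertices \<Gamma> \<inter> G1" using t by (auto simp: complex_of_def)
  have AB: "G0 \<in> A" "G1 \<in> B" using G0 G1 nst by (auto simp: A_def B_def)
  have clF: "closedin M G" if "G \<in> faces M \<Gamma>" for G using that by (auto simp: faces_def)
  have cl: "closedin M (\<Union>A)" "closedin M (\<Union>B)"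
    using clF finite_faces by (auto simp: A_def B_def intro!: closedin_Union)
  have disj: "G \<inter> H \<subseteq> vertices \<Gamma>" if "G \<in> A" "H \<in> B" for G H
  proof (rule ccontr)
    assume n: "\<not> G \<inter> H \<subseteq> vertices \<Gamma>"
    have GH: "G \<in> faces M \<Gamma>" "H \<in> faces M \<Gamma>" "G \<noteq> H" using that by (auto simp: A_def B_def)
    then have "card (vertices \<Gamma> \<inter> (G \<inter> H)) = 2" using face_Int_vertices(2) n by blast
    moreover have "vertices \<Gamma> \<inter> (G \<inter> H) = (vertices \<Gamma> \<inter> G) \<inter> (vertices \<Gamma> \<inter> H)" by blast
    ultimately have "edge_adjacent (complex_of M \<Gamma>) (vertices \<Gamma> \<inter> G) (vertices \<Gamma> \<inter> H)"
      using GH unfolding edge_adjacent_def complex_of_def by simp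
    then have "?R H" using that(1) unfolding A_def by (auto intro: rtranclp.rtrancl_into_rtrancl)
    then show False using that(2) by (simp add: B_def)
  qed
  let ?X = "topspace M - vertices \<Gamma>"
  have cover: "?X \<subseteq> \<Union>A \<union> \<Union>B"
  proof
    fix x assume x: "x \<in> ?X"
    have "\<exists>G\<in>faces M \<Gamma>. x \<in> G"
    proof (cases "x \<in> skeleton \<Gamma>")
      case True
      then obtain e where e: "e \<in> edges \<Gamma>" "x \<in> e" using x by (auto simp: skeleton_def)
      have "{G\<in>faces M \<Gamma>. e \<subseteq> G} \<noteq> {}" using two_faces[OF e(1)] by force
      then show ?thesis using e by blast
    next
      case False
      then have "x \<in> topspace (subtopology M (topspace M - skeleton \<Gamma>))" using x by auto
      then obtain C where C: "C \<in> comps" "x \<in> C" by (metis UnionE Union_connected_components_of)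
      have "C \<subseteq> M closure_of C" using closure_of_subset[OF openin_subset[OF comps_open[OF C(1)]]] .
      then show ?thesis using C by (auto simp: faces_def)
    qed
    then show "x \<in> \<Union>A \<union> \<Union>B" by (auto simp: A_def B_def)
  qed
  have meets: "G \<inter> ?X \<noteq> {}" if G: "G \<in> faces M \<Gamma>" for G
  proof -
    obtain C where C: "C \<in> comps" "G = M closure_of C" using G unfolding faces_def by blast
    have "C \<subseteq> topspace M - skeleton \<Gamma>" using connected_components_of_subset[OF C(1)] by auto
    then have "C \<subseteq> ?X" by (auto simp: skeleton_def)
    moreover have "C \<subseteq> G" unfolding C(2) using closure_of_subset[OF openin_subset[OF comps_open[OF C(1)]]] .
    moreover have "C \<noteq> {}" using nonempty_connected_components_of[OF C(1)] .
    ultimately show ?thesis by blast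
  qed
  have m: "\<Union>A \<inter> ?X \<noteq> {}" "\<Union>B \<inter> ?X \<noteq> {}" using meets[OF G0(1)] meets[OF G1(1)] AB by blast+
  have "\<Union>A \<inter> \<Union>B \<inter> ?X = {}" using disj by blast
  moreover have "connectedin M ?X"
    using connectedin_surface_minus_finite[OF M finite_graph(1,3)] .
  ultimately show False using cl cover m unfolding connectedin_closedin by blast
qed

end

context pierced_face
begin

lemma star_surface_triangulation:
  assumes M: "closed_surface M" and tri: "surface_triangulation M \<Gamma>"
  shows "surface_triangulation M star"
proof -
  interpret T: triangulated_surface M \<Gamma> using M tri by unfold_locales
  show ?thesis
  proof (rule star_triangulation[OF T.graph(2)])
    show "\<forall>e\<in>edges \<Gamma>. card {G\<in>faces M \<Gamma>. e \<subseteq> G} = 2" using T.two_faces by blast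
    show "subtopology M G homeomorphic_space top_of_set (cball (0::real^2) 1)" if "G \<in> faces M \<Gamma> - {F}" for G
      using T.disc that by blast
    show "card {e\<in>edges \<Gamma>. e \<subseteq> G} = 3" if "G \<in> faces M \<Gamma> - {F}" for G
      using T.three_edges that by blast
    show "meets_nicely (G \<inter> H)" if "G \<in> faces M \<Gamma> - {F}" "H \<in> faces M \<Gamma> - {F}" "G \<noteq> H" for G H
      using T.faces_Int that unfolding meets_nicely_def by blast
    show "meets_nicely (G \<inter> e)" if G: "G \<in> faces M \<Gamma> - {F}" and e: "e \<in> EF" for G e
    proof -
      have eq: "G \<inter> e = (G \<inter> F) \<inter> e" using EFD(2)[OF e] by blast
      have G': "G \<in> faces M \<Gamma>" "G \<noteq> F" using G by simp_all
      show ?thesis using T.faces_Int[OF G'(1) F_face G'(2)]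
      proof (elim disjE)
        assume f: "G \<inter> F \<in> edges \<Gamma>"
        show ?thesis
        proof (cases "G \<inter> F = e")
          case True
          then show ?thesis unfolding eq meets_nicely_def using f by simp
        next
          case False
          then show ?thesis unfolding eq meets_nicely_def
            using edges_Int[OF graph f EFD(1)[OF e] False] by (metis (no_types))
        qed
      next
        assume "\<exists>v\<in>vertices \<Gamma>. G \<inter> F = {v}"
        then obtain v where "v \<in> vertices \<Gamma>" "G \<inter> F = {v}" by blast
        then show ?thesis unfolding eq meets_nicely_def by (cases "v \<in> e") simp_all
      next
        assume "G \<inter> F = {}"
        then show ?thesis unfolding eq meets_nicely_def by simp
      qed
    qed
  qed
qed

lemma complex_of_star:
  assumes M: "closed_surface M" and tri: "surface_triangulation M \<Gamma>"
  shows "complex_of M star = insert_vertex (complex_of M \<Gamma>) (vertices \<Gamma> \<inter> F) (k 0)"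
proof -
  interpret T: triangulated_surface M \<Gamma> using M tri by unfold_locales
  obtain a b c x y z where d: "a \<noteq> b" "b \<noteq> c" "a \<noteq> c" and
    E: "{e\<in>edges \<Gamma>. e \<subseteq> F} = {x,y,z}" "vertices \<Gamma> \<inter> F = {a,b,c}" and
    V: "x \<inter> vertices \<Gamma> = {b,c}" "y \<inter> vertices \<Gamma> = {a,c}" "z \<inter> vertices \<Gamma> = {a,b}"
    by (rule T.face_triangle[OF F_face])
  have EF: "EF = {x,y,z}" using E(1) by (simp add: EF_def)
  have sec: "vertices star \<inter> sector e = insert (k 0) (e \<inter> vertices \<Gamma>)" if e: "e \<in> EF" for e
  proof -
    have "vertices \<Gamma> \<inter> sector e = e \<inter> vertices \<Gamma>"
    proof
      show "vertices \<Gamma> \<inter> sector e \<subseteq> e \<inter> vertices \<Gamma>"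
      proof
        fix v assume v: "v \<in> vertices \<Gamma> \<inter> sector e"
        then have "v \<in> k ` sphere 0 1"
          using sector_subset(1)[OF e] by (intro skeleton_F) (auto simp: skeleton_def)
        then show "v \<in> e \<inter> vertices \<Gamma>" using v sector_sphere[OF e] by blast
      qed
      show "e \<inter> vertices \<Gamma> \<subseteq> vertices \<Gamma> \<inter> sector e" using sector_sphere[OF e] by blast
    qed
    then show ?thesis using sector_subset(2)[OF e] by (simp add: star_simps Int_insert_left)
  qed
  have old: "vertices star \<inter> G = vertices \<Gamma> \<inter> G" if "G \<in> faces M \<Gamma> - {F}" for G
    using other_face_C0[OF that] k0(1) by (auto simp: star_simps)
  have "complex_of M star = (\<lambda>G. vertices star \<inter> G) ` (faces M \<Gamma> - {F}) \<union> (\<lambda>G. vertices star \<inter> G) ` sector ` EF"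
    unfolding complex_of_def faces_star by (rule image_Un)
  also have "(\<lambda>G. vertices star \<inter> G) ` (faces M \<Gamma> - {F}) = (\<lambda>G. vertices \<Gamma> \<inter> G) ` (faces M \<Gamma> - {F})"
    using old by (intro image_cong) auto
  also have "\<dots> = complex_of M \<Gamma> - {vertices \<Gamma> \<inter> F}"
    using inj_on_image_set_diff[OF T.inj_face_vertices, of "faces M \<Gamma>" "{F}"] F_face
    by (simp add: complex_of_def)
  also have "(\<lambda>G. vertices star \<inter> G) ` sector ` EF = (\<lambda>e. insert (k 0) (e \<inter> vertices \<Gamma>)) ` EF"
    unfolding image_image using sec by (intro image_cong) auto
  also have "\<dots> = {insert (k 0) {b,c}, insert (k 0) {c,a}, insert (k 0) {a,b}}"
    unfolding EF using V by (simp add: insert_commute)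
  finally show ?thesis unfolding E(2) insert_vertex_triangle[OF d] .
qed

end

section \<open>Zigzags in terms of flags\<close>

context triangulated_surface
begin

abbreviation T :: "'a set set" where "T \<equiv> complex_of M \<Gamma>"

definition edge_between :: "'a \<Rightarrow> 'a \<Rightarrow> 'a set" where
  "edge_between u v = (THE e. e \<in> edges \<Gamma> \<and> e \<inter> vertices \<Gamma> = {u,v})"

lemma edge_between_eq:
  assumes "e \<in> edges \<Gamma>" "e \<inter> vertices \<Gamma> = {u,v}"
  shows "edge_between u v = e"
  unfolding edge_between_def
proof (rule the_equality)
  fix f assume f: "f \<in> edges \<Gamma> \<and> f \<inter> vertices \<Gamma> = {u,v}"
  have "u \<noteq> v"
  proof -
    obtain p q where "p \<noteq> q" "e \<inter> vertices \<Gamma> = {p,q}" using embedded_edge[OF graph(1) assms(1)] by metis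
    then show ?thesis using assms(2) by (metis doubleton_eq_iff)
  qed
  then show "f = e" using edge_eqI[OF graph(1), of f e u v] f assms by blast
qed (use assms in blast)

lemma edge_between_commute: "edge_between u v = edge_between v u"
  by (simp add: edge_between_def insert_commute)

text \<open>A flag spans two consecutive edges of the zigzag; the second one is the
  \<open>flag_edge\<close> of the next flag.\<close>

definition flag_edge :: "'a \<times> 'a \<times> 'a \<Rightarrow> 'a set" where
  "flag_edge = (\<lambda>(a,b,c). edge_between a b)"

lemma flag_edge_simp [simp]: "flag_edge (a,b,c) = edge_between a b"
  by (simp add: flag_edge_def)

lemma flag_face:
  assumes "(a,b,c) \<in> flags T"
  obtains G where "G \<in> faces M \<Gamma>" "vertices \<Gamma> \<inter> G = {a,b,c}"
    "edge_between a b \<in> edges \<Gamma>" "edge_between a b \<subseteq> G" "edge_between a b \<inter> vertices \<Gamma> = {a,b}"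
    "edge_between b c \<in> edges \<Gamma>" "edge_between b c \<subseteq> G" "edge_between b c \<inter> vertices \<Gamma> = {b,c}"
proof -
  have abc: "{a,b,c} \<in> T" "a \<noteq> b" "b \<noteq> c" "a \<noteq> c" using assms by simp_all
  then obtain G where G: "G \<in> faces M \<Gamma>" "vertices \<Gamma> \<inter> G = {a,b,c}" by (auto simp: complex_of_def)
  obtain e where e: "e \<in> edges \<Gamma>" "e \<subseteq> G" "e \<inter> vertices \<Gamma> = {a,b}"
    using edge_exists[OF G(1), of a b] abc G(2) by auto
  obtain f where f: "f \<in> edges \<Gamma>" "f \<subseteq> G" "f \<inter> vertices \<Gamma> = {b,c}"
    using edge_exists[OF G(1), of b c] abc G(2) by auto
  show ?thesis using that[OF G] e f edge_between_eq[OF e(1,3)] edge_between_eq[OF f(1,3)] by simp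
qed

lemma face_determined:
  assumes "G \<in> faces M \<Gamma>" "e \<subseteq> G" "f \<subseteq> G" "e \<inter> vertices \<Gamma> = {a,b}" "f \<inter> vertices \<Gamma> = {b,c}"
    "a \<noteq> b" "b \<noteq> c" "a \<noteq> c"
  shows "vertices \<Gamma> \<inter> G = {a,b,c}"
proof -
  obtain p q r where "p \<noteq> q" "q \<noteq> r" "p \<noteq> r" "vertices \<Gamma> \<inter> G = {p,q,r}" using face_vertices[OF assms(1)] .
  then have card: "card (vertices \<Gamma> \<inter> G) = 3" by simp
  have "{a,b,c} \<subseteq> vertices \<Gamma> \<inter> G" using assms(2-5) by blast
  moreover have "card {a,b,c} = 3" using assms(6-8) by simp
  ultimately show ?thesis using card card_subset_eq[of "vertices \<Gamma> \<inter> G" "{a,b,c}"]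
    by (metis card.infinite zero_neq_numeral)
qed

definition zigzag_of :: "'a \<times> 'a \<times> 'a \<Rightarrow> nat \<Rightarrow> 'a set" where
  "zigzag_of f i = flag_edge ((zstep T ^^ i) f)"

text \<open>The faces of consecutive flags \<open>(a,b,c)\<close> and \<open>(b,c,d)\<close> differ
  because \<open>d \<noteq> a\<close>. The edges \<open>ab\<close> and \<open>cd\<close> are
  disjoint because edges meet only in vertices and the four vertices are distinct.\<close>

lemma zigzag_zigzag_of:
  assumes f: "f \<in> flags T"
  shows "zigzag M \<Gamma> (zigzag_of f)"
proof -
  have loc: "adjacent_edges M \<Gamma> (zigzag_of f i) (zigzag_of f (i+1)) \<and>
    (\<forall>F\<in>faces M \<Gamma>. \<forall>G\<in>faces M \<Gamma>. zigzag_of f i \<subseteq> F \<and> zigzag_of f (i+1) \<subseteq> F \<and> zigzag_of f (i+1) \<subseteq> G \<and> zigzag_of f (i+2) \<subseteq> G \<longrightarrow> F \<noteq> G)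
    \<and> zigzag_of f i \<inter> zigzag_of f (i+2) = {}" for i
  proof -
    obtain a b c where abc: "(zstep T ^^ i) f = (a,b,c)" using prod_cases3 by blast
    have g: "(a,b,c) \<in> flags T" using zpow_flags[OF closed_complex f, of i] abc by simp
    obtain d where d: "zstep T (a,b,c) = (b,c,d)" "{b,c,d} \<in> T" "d \<noteq> a" "d \<noteq> b" "d \<noteq> c"
      using zstep_obtain[OF closed_complex g] .
    have g': "(b,c,d) \<in> flags T" using zstep_flags[OF closed_complex g] d(1) by simp
    have Z: "zigzag_of f i = edge_between a b" "zigzag_of f (i+1) = edge_between b c" "zigzag_of f (i+2) = edge_between c d"
      using abc d(1) by (simp_all add: zigzag_of_def zstep_def)
    have ne: "a \<noteq> b" "b \<noteq> c" "a \<noteq> c" using g by simp_all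
    obtain G where G: "G \<in> faces M \<Gamma>" "vertices \<Gamma> \<inter> G = {a,b,c}"
      "edge_between a b \<in> edges \<Gamma>" "edge_between a b \<subseteq> G" "edge_between a b \<inter> vertices \<Gamma> = {a,b}"
      "edge_between b c \<in> edges \<Gamma>" "edge_between b c \<subseteq> G" "edge_between b c \<inter> vertices \<Gamma> = {b,c}"
      using flag_face[OF g] .
    obtain H where H: "H \<in> faces M \<Gamma>" "vertices \<Gamma> \<inter> H = {b,c,d}"
      "edge_between c d \<in> edges \<Gamma>" "edge_between c d \<subseteq> H" "edge_between c d \<inter> vertices \<Gamma> = {c,d}"
      using flag_face[OF g'] by metis
    have "edge_between a b \<noteq> edge_between b c" using G(5,8) ne by (metis doubleton_eq_iff)
    moreover have "b \<in> vertices \<Gamma>" "b \<in> edge_between a b" "b \<in> edge_between b c" using G(5,8) by blast+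
    ultimately have "adjacent_edges M \<Gamma> (edge_between a b) (edge_between b c)"
      unfolding adjacent_edges_def using G(1,3,4,6,7) by blast
    moreover have "F \<noteq> F'" if F: "F \<in> faces M \<Gamma>" "F' \<in> faces M \<Gamma>"
      "edge_between a b \<subseteq> F" "edge_between b c \<subseteq> F" "edge_between b c \<subseteq> F'" "edge_between c d \<subseteq> F'" for F F'
    proof -
      have "vertices \<Gamma> \<inter> F = {a,b,c}" using face_determined[OF F(1,3,4) G(5,8)] ne by simp
      moreover have "vertices \<Gamma> \<inter> F' = {b,c,d}" using face_determined[OF F(2,5,6) G(8) H(5)] ne d by simp
      moreover have "{a,b,c} \<noteq> {b,c,d}" using ne d by blast
      ultimately show ?thesis by auto
    qed
    moreover have "edge_between a b \<inter> edge_between c d = {}"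
    proof -
      have "edge_between a b \<noteq> edge_between c d" using G(5) H(5) ne d by (metis doubleton_eq_iff)
      then consider "edge_between a b \<inter> edge_between c d = {}" | v where "v \<in> vertices \<Gamma>" "edge_between a b \<inter> edge_between c d = {v}"
        using edges_Int[OF graph(1) G(3) H(3)] by blast
      then show ?thesis
      proof cases
        case 2
        then have "v \<in> {a,b}" "v \<in> {c,d}" using G(5) H(5) by blast+
        then show ?thesis using ne d by auto
      qed
    qed
    ultimately show ?thesis unfolding Z by blast
  qed
  then show ?thesis unfolding zigzag_def by blast
qed

lemma adjacent_flag:
  assumes "adjacent_edges M \<Gamma> e f"
  obtains u v w G where "(u,v,w) \<in> flags T" "e = edge_between u v" "f = edge_between v w"
    "e \<inter> vertices \<Gamma> = {u,v}" "f \<inter> vertices \<Gamma> = {v,w}"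
    "G \<in> faces M \<Gamma>" "e \<subseteq> G" "f \<subseteq> G" "vertices \<Gamma> \<inter> G = {u,v,w}"
proof -
  obtain v G where *: "e \<in> edges \<Gamma>" "f \<in> edges \<Gamma>" "e \<noteq> f" "v \<in> vertices \<Gamma>" "v \<in> e" "v \<in> f"
    "G \<in> faces M \<Gamma>" "e \<subseteq> G" "f \<subseteq> G"
    using assms unfolding adjacent_edges_def by blast
  have other: "\<exists>u. u \<noteq> v \<and> g \<inter> vertices \<Gamma> = {u,v}" if g: "g \<in> edges \<Gamma>" "v \<in> g" for g
  proof -
    obtain p q where "p \<noteq> q" "g \<inter> vertices \<Gamma> = {p,q}" using embedded_edge[OF graph(1) g(1)] by metis
    moreover have "v \<in> g \<inter> vertices \<Gamma>" using g *(4) by blast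
    ultimately show ?thesis by (metis doubleton_eq_iff insert_iff singletonD)
  qed
  obtain u where u: "u \<noteq> v" "e \<inter> vertices \<Gamma> = {u,v}" using other[OF *(1,5)] by blast
  obtain w where w: "w \<noteq> v" "f \<inter> vertices \<Gamma> = {w,v}" using other[OF *(2,6)] by blast
  then have w': "f \<inter> vertices \<Gamma> = {v,w}" by blast
  have "u \<noteq> w"
  proof
    assume "u = w"
    then have "u \<in> e \<inter> f" using u w by blast
    then show False using edge_eqI[OF graph(1) *(1,2), of u v] u(1) *(3,5,6) by blast
  qed
  then have "vertices \<Gamma> \<inter> G = {u,v,w}" using face_determined[OF *(7-9) u(2) w'] u(1) w(1) by simp
  moreover from this have "(u,v,w) \<in> flags T"
    using *(7) u(1) w(1) \<open>u \<noteq> w\<close> by (auto simp: complex_of_def)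
  ultimately show ?thesis using that[of u v w G] edge_between_eq[OF *(1) u(2)] edge_between_eq[OF *(2) w'] u w' * by simp
qed

text \<open>Two consecutive edges determine the rest: disjointness of \<open>Z i\<close> and
  \<open>Z (i+2)\<close> fixes the vertex at which the walk turns, and distinctness of the faces
  fixes the triangle that it enters. The induction therefore carries two edges.\<close>

lemma zigzag_obtain:
  assumes Z: "zigzag M \<Gamma> Z"
  obtains f where "f \<in> flags T" "Z = zigzag_of f"
proof -
  have adj: "adjacent_edges M \<Gamma> (Z i) (Z (i+1))" for i using Z by (simp add: zigzag_def)
  have dis: "Z i \<inter> Z (i+2) = {}" for i using Z by (simp add: zigzag_def)
  have nf: "F \<noteq> G" if "F \<in> faces M \<Gamma>" "G \<in> faces M \<Gamma>" "Z i \<subseteq> F" "Z (i+1) \<subseteq> F" "Z (i+1) \<subseteq> G" "Z (i+2) \<subseteq> G" for F G i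
    using Z that unfolding zigzag_def by blast
  obtain u v w G where f0: "(u,v,w) \<in> flags T" "Z 0 = edge_between u v" "Z 1 = edge_between v w"
    using adjacent_flag[OF adj[of 0]] by (metis add_0)
  let ?f = "(u,v,w)"
  have "Z i = zigzag_of ?f i \<and> Z (i+1) = zigzag_of ?f (i+1)" for i
  proof (induction i)
    case 0
    then show ?case using f0 by (simp add: zigzag_of_def zstep_def)
  next
    case (Suc i)
    obtain a b c where abc: "(zstep T ^^ i) ?f = (a,b,c)" using prod_cases3 by blast
    have g: "(a,b,c) \<in> flags T" using zpow_flags[OF closed_complex f0(1), of i] abc by simp
    obtain d where d: "zstep T (a,b,c) = (b,c,d)" "{b,c,d} \<in> T" "d \<noteq> a" "d \<noteq> b" "d \<noteq> c"
      using zstep_obtain[OF closed_complex g] .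
    have zz3: "zigzag_of ?f i = edge_between a b" "zigzag_of ?f (i+1) = edge_between b c" "zigzag_of ?f (i+2) = edge_between c d"
      using abc d(1) by (simp_all add: zigzag_of_def zstep_def)
    have ne: "a \<noteq> b" "b \<noteq> c" "a \<noteq> c" using g by simp_all
    obtain G where G: "G \<in> faces M \<Gamma>" "vertices \<Gamma> \<inter> G = {a,b,c}" "edge_between a b \<subseteq> G" "edge_between b c \<subseteq> G"
        "edge_between a b \<inter> vertices \<Gamma> = {a,b}" "edge_between b c \<inter> vertices \<Gamma> = {b,c}"
      using flag_face[OF g] by metis
    have "adjacent_edges M \<Gamma> (Z (i+1)) (Z (i+2))" using adj[of "i+1"] by (simp add: numeral_2_eq_2)
    then obtain p q r H where pqr: "(p,q,r) \<in> flags T" "Z (i+1) = edge_between p q" "Z (i+2) = edge_between q r"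
      "Z (i+1) \<inter> vertices \<Gamma> = {p,q}" "Z (i+2) \<inter> vertices \<Gamma> = {q,r}"
      "H \<in> faces M \<Gamma>" "Z (i+1) \<subseteq> H" "Z (i+2) \<subseteq> H" "vertices \<Gamma> \<inter> H = {p,q,r}"
      by (rule adjacent_flag)
    have Zi: "Z i = edge_between a b" "Z (i+1) = edge_between b c" using Suc zz3 by simp_all
    have "{p,q} = {b,c}" using pqr(4) Zi(2) G(6) by simp
    \<comment> \<open>Turning at \<open>b\<close> again would mean going round \<open>b\<close>, and
      \<open>b\<close> would lie on both \<open>Z i\<close> and \<open>Z (i+2)\<close>.\<close>
    moreover have "q \<noteq> b"
    proof
      assume "q = b"
      then have "b \<in> Z i" "b \<in> Z (i+2)" using Zi(1) G(5) pqr(5) by blast+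
      then show False using dis[of i] by blast
    qed
    ultimately have pq: "p = b" "q = c" by (auto simp: doubleton_eq_iff)
    have "Z i \<subseteq> G" "Z (i+1) \<subseteq> G" using G(3,4) Zi by simp_all
    then have "G \<noteq> H" using nf[OF G(1) pqr(6) _ _ pqr(7,8)] by blast
    then have "{a,b,c} \<noteq> {b,c,r}" using inj_onD[OF inj_face_vertices _ G(1) pqr(6)] G(2) pqr(9) pq by auto
    then have "r \<noteq> a" by blast
    moreover have "(b,c,r) \<in> flags T" using pqr(1) pq by simp
    ultimately have "zstep T (a,b,c) = (b,c,r)"
      using g by (intro zstep_eq[OF closed_complex]) auto
    then have "r = d" using d(1) by simp
    then have "Z (i+2) = zigzag_of ?f (i+2)" using pqr(3) pq zz3(3) by simp
    then show ?case using Suc by (simp add: numeral_2_eq_2)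
  qed
  then have "Z = zigzag_of ?f" by blast
  then show ?thesis using that f0(1) by blast
qed

lemma zigzag_of_shift: "zigzag_of f (i + j) = zigzag_of ((zstep T ^^ j) f) i"
  by (simp add: zigzag_of_def funpow_add)

text \<open>A cyclic class consists of forward shifts only; equality holds because, by periodicity,
  a shift is undone by a further forward shift.\<close>

lemma cyclic_class_shift:
  assumes f: "f \<in> flags T"
  shows "cyclic_class (zigzag_of ((zstep T ^^ j) f)) = cyclic_class (zigzag_of f)"
proof -
  have cc: "cyclic_class (zigzag_of g) = {zigzag_of ((zstep T ^^ i) g) | i. True}" for g
    unfolding cyclic_class_def zigzag_of_shift by simp
  obtain m where m: "(zstep T ^^ m) ((zstep T ^^ j) f) = f" using zpow_inverse[OF closed_complex f] .
  show ?thesis unfolding cc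
  proof (intro equalityI subsetI)
    fix Z assume "Z \<in> {zigzag_of ((zstep T ^^ i) ((zstep T ^^ j) f)) | i. True}"
    then obtain i where "Z = zigzag_of ((zstep T ^^ (i+j)) f)" by (auto simp: funpow_add)
    then show "Z \<in> {zigzag_of ((zstep T ^^ i) f) | i. True}" by blast
  next
    fix Z assume "Z \<in> {zigzag_of ((zstep T ^^ i) f) | i. True}"
    then obtain i where "Z = zigzag_of ((zstep T ^^ i) f)" by blast
    then have "Z = zigzag_of ((zstep T ^^ (i+m)) ((zstep T ^^ j) f))" using m by (simp add: funpow_add)
    then show "Z \<in> {zigzag_of ((zstep T ^^ i) ((zstep T ^^ j) f)) | i. True}" by blast
  qed
qed

text \<open>The offset 2: for \<open>f = (v0,v1,v2)\<close> the reversed sequence starts with the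
  edge before \<open>v0 v1\<close>, whereas \<open>flip f\<close> starts with \<open>v2 v1\<close>,
  two edges later.\<close>

lemma reverse_zigzag_of:
  assumes f: "f \<in> flags T"
  shows "reverse_seq (zigzag_of f) = zigzag_of ((zstep T ^^ 2) (flip f))"
proof
  fix i
  define P where "P = period (zigzag_of f)"
  obtain L where L: "L > 0" "(zstep T ^^ L) f = f" using zpow_periodic[OF closed_complex f] .
  have "0 < L \<and> (\<forall>i. zigzag_of f (i + L) = zigzag_of f i)" using L by (simp add: zigzag_of_shift)
  then have P: "P > 0" "\<And>i. zigzag_of f (i + P) = zigzag_of f i"
    using LeastI[of "\<lambda>n. 0 < n \<and> (\<forall>i. zigzag_of f (i + n) = zigzag_of f i)" L] unfolding P_def period_def by simp_all
  have Pm: "zigzag_of f (j + m * P) = zigzag_of f j" for j m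
    by (induction m) (use P(2) in \<open>simp_all add: add.assoc[symmetric] add.commute[of P]\<close>)
  have PL: "P * L \<ge> 1" using P(1) L(1) by (simp add: Suc_le_eq)
  \<comment> \<open>\<open>P\<close> is a period of the edges and \<open>L\<close> one of the flags.
    The number \<open>P * q\<close> is a multiple of both and large enough to step back
    \<open>i + 2\<close> places.\<close>
  define q where "q = L * (i + 2)"
  have q: "q \<ge> i + 2" using mult_le_mono1[of 1 L "i + 2"] L(1) by (simp add: q_def)
  have qP: "P * q \<ge> i + 2" using q P(1) by (metis le_trans mult_le_mono1 nat_mult_1 Suc_leI One_nat_def)
  have fN: "(zstep T ^^ (P * q)) f = f"
  proof -
    have "P * q = P * (i + 2) * L" by (simp only: q_def ac_simps)
    then show ?thesis using zpow_mult_period[OF L(2), of "P * (i+2)"] by simp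
  qed
  define j where "j = P * q - (i + 2)"
  define y where "y = (zstep T ^^ j) f"
  have y: "y \<in> flags T" using zpow_flags[OF closed_complex f] y_def by simp
  have fy: "(zstep T ^^ (i + 2)) y = f"
  proof -
    have "(i + 2) + j = P * q" using qP by (simp add: j_def)
    then show ?thesis using fN unfolding y_def by (metis comp_apply funpow_add)
  qed
  have "zigzag_of ((zstep T ^^ 2) (flip f)) i = flag_edge ((zstep T ^^ (i+2)) (flip f))"
    by (simp only: zigzag_of_def funpow_add comp_apply)
  also have "(zstep T ^^ (i+2)) (flip f) = flip y"
    using zpow_flip_zpow[OF closed_complex y, of "i+2"] fy by simp
  \<comment> \<open>Reversal costs one index: the first edge of \<open>flip y\<close> is the second
    edge of \<open>y\<close>.\<close>
  also have "flag_edge (flip y) = flag_edge (zstep T y)"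
    by (cases y) (simp add: zstep_def edge_between_commute)
  also have "\<dots> = zigzag_of f (j + 1)" by (simp add: zigzag_of_def y_def)
  also have "j + 1 = (P - 1 - i mod P) + (q - 1 - i div P) * P"
  proof -
    have r: "i mod P < P" using P(1) by simp
    have i: "i = i mod P + (i div P) * P" by simp
    have "i div P \<le> i" by simp
    then have d: "i div P + 1 \<le> q" using q by linarith
    then obtain m where m: "q = i div P + 1 + m" using le_iff_add by blast
    then have "q - 1 - i div P = m" by simp
    moreover have "m * P + (i div P + 1) * P = P * q" unfolding m by (simp add: algebra_simps)
    ultimately have "(q - 1 - i div P) * P + (i div P) * P + P = P * q" by simp
    then show ?thesis using r i qP unfolding j_def by linarith
  qed
  also have "zigzag_of f \<dots> = zigzag_of f (P - 1 - i mod P)" by (rule Pm)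
  also have "\<dots> = reverse_seq (zigzag_of f) i" by (simp add: reverse_seq_def P_def)
  finally show "reverse_seq (zigzag_of f) i = zigzag_of ((zstep T ^^ 2) (flip f)) i" by simp
qed

text \<open>Without faces there would be no edges, since each lies in two faces, and the surface
  would consist of finitely many vertices although it contains a copy of the plane.\<close>

lemma flags_nonempty: "flags T \<noteq> {}"
proof -
  have "faces M \<Gamma> \<noteq> {}"
  proof
    assume no: "faces M \<Gamma> = {}"
    then have "comps = {}" by (simp add: faces_def)
    then have "topspace M \<subseteq> skeleton \<Gamma>"
      using Union_connected_components_of[of "subtopology M (topspace M - skeleton \<Gamma>)"] by auto
    moreover have "edges \<Gamma> = {}" using two_faces no by fastforce
    ultimately have fin: "finite (topspace M)"
      using finite_graph(1) by (simp add: skeleton_def finite_subset)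
    obtain x where "x \<in> topspace M" using M unfolding closed_surface_def by blast
    then obtain c :: "real^2 \<Rightarrow> 'a" where c: "continuous_map euclidean M c" "inj c"
      using surface_chart[OF M] by metis
    have "range c \<subseteq> topspace M" using continuous_map_image_subset_topspace[OF c(1)] by simp
    then have "finite (UNIV :: (real^2) set)" using fin c(2) by (meson finite_imageD finite_subset)
    then show False using infinite_circle by (meson finite_subset subset_UNIV)
  qed
  then obtain G where G: "G \<in> faces M \<Gamma>" by blast
  obtain a b c where "a \<noteq> b" "b \<noteq> c" "a \<noteq> c" "vertices \<Gamma> \<inter> G = {a,b,c}" using face_vertices[OF G] .
  then have "(a,b,c) \<in> flags T" using G by (auto simp: complex_of_def)
  then show ?thesis by blast
qed

text \<open>Every zigzag comes from a flag \<open>g\<close>, and \<open>g\<close> is a shift of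
  \<open>f\<close> or of \<open>flip f\<close>; the second possibility is the class of the reversed
  zigzag.\<close>

lemma z_knotted_if_all_related:
  assumes all: "\<And>f g. f \<in> flags T \<Longrightarrow> g \<in> flags T \<Longrightarrow> (f,g) \<in> zrel T"
  shows "z_knotted M \<Gamma>"
proof -
  obtain f where f: "f \<in> flags T" using flags_nonempty by blast
  have ff: "flip f \<in> flags T" using f by simp
  have rev: "cyclic_class (reverse_seq (zigzag_of f)) = cyclic_class (zigzag_of (flip f))"
    unfolding reverse_zigzag_of[OF f] by (rule cyclic_class_shift[OF ff])
  have "cyclic_zigzags M \<Gamma> = {cyclic_class (zigzag_of f), cyclic_class (zigzag_of (flip f))}"
  proof
    show "{cyclic_class (zigzag_of f), cyclic_class (zigzag_of (flip f))} \<subseteq> cyclic_zigzags M \<Gamma>"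
      using zigzag_zigzag_of[OF f] zigzag_zigzag_of[OF ff] by (auto simp: cyclic_zigzags_def)
    show "cyclic_zigzags M \<Gamma> \<subseteq> {cyclic_class (zigzag_of f), cyclic_class (zigzag_of (flip f))}"
    proof
      fix X assume "X \<in> cyclic_zigzags M \<Gamma>"
      then obtain Z where Z: "zigzag M \<Gamma> Z" "X = cyclic_class Z" by (auto simp: cyclic_zigzags_def)
      obtain g where g: "g \<in> flags T" "Z = zigzag_of g" using zigzag_obtain[OF Z(1)] .
      obtain n where "g = (zstep T ^^ n) f \<or> g = (zstep T ^^ n) (flip f)"
        using all[OF f g(1)] by (auto simp: zrel_def)
      then show "X \<in> {cyclic_class (zigzag_of f), cyclic_class (zigzag_of (flip f))}"
        using Z(2) g(2) cyclic_class_shift[OF f] cyclic_class_shift[OF ff] by auto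
    qed
  qed
  then show ?thesis unfolding z_knotted_def using zigzag_zigzag_of[OF f] rev by metis
qed

end

section \<open>The two hemispheres\<close>

definition hemisphere :: "real \<Rightarrow> real^2 \<Rightarrow> real^3" where
  "hemisphere s x = vector [x$1, x$2, s * sqrt (1 - (norm x)\<^sup>2)]"

lemma hemisphere_nth [simp]: "hemisphere s x $ 1 = x$1" "hemisphere s x $ 2 = x$2"
    "hemisphere s x $ 3 = s * sqrt (1 - (norm x)\<^sup>2)"
  by (simp_all add: hemisphere_def vector_3)

lemma norm2: "(norm (x::real^2))\<^sup>2 = (x$1)\<^sup>2 + (x$2)\<^sup>2"
  by (simp add: norm_vec_def L2_set_def sum_2)

lemma norm3: "(norm (x::real^3))\<^sup>2 = (x$1)\<^sup>2 + (x$2)\<^sup>2 + (x$3)\<^sup>2"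
  by (simp add: norm_vec_def L2_set_def sum_3)

lemma norm_sq_le_1: "norm (x::'a::real_normed_vector) \<le> 1 \<Longrightarrow> (norm x)\<^sup>2 \<le> 1"
  using power_mono[of "norm x" 1 2] by simp

lemma hemisphere_sphere:
  assumes "x \<in> cball 0 1" "s = 1 \<or> s = -1" shows "hemisphere s x \<in> sphere 0 1"
proof -
  have "(norm (hemisphere s x))\<^sup>2 = 1"
    using assms norm_sq_le_1[of x] unfolding norm3 by (auto simp: power_mult_distrib norm2)
  then have "norm (hemisphere s x) = 1" by (simp add: power2_eq_1_iff) (metis abs_norm_cancel abs_minus abs_one)
  then show ?thesis by simp
qed

lemma hemisphere_eqD:
  assumes "hemisphere s x = hemisphere r y" shows "x = y"
proof -
  have "x$1 = y$1" using arg_cong[OF assms, of "\<lambda>p. p$1"] by simp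
  moreover have "x$2 = y$2" using arg_cong[OF assms, of "\<lambda>p. p$2"] by simp
  ultimately show ?thesis by (simp add: vec_eq_iff forall_2)
qed

lemma hemisphere_height:
  assumes "x \<in> cball 0 1"
  shows "hemisphere 1 x $ 3 \<ge> 0" "hemisphere (-1) x $ 3 \<le> 0" "hemisphere s x $ 3 = 0 \<longleftrightarrow> s = 0 \<or> x \<in> sphere 0 1"
proof -
  have "(norm x)\<^sup>2 \<le> 1" using assms norm_sq_le_1[of x] by simp
  then show "hemisphere 1 x $ 3 \<ge> 0" "hemisphere (-1) x $ 3 \<le> 0" by simp_all
  have "(norm x)\<^sup>2 = 1 \<longleftrightarrow> norm x = 1" by (simp add: power2_eq_1_iff) (metis norm_ge_zero not_one_le_zero le_minus_one_simps(3) )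
  then show "hemisphere s x $ 3 = 0 \<longleftrightarrow> s = 0 \<or> x \<in> sphere 0 1" by simp
qed

lemma hemisphere_equator: "x \<in> sphere 0 1 \<Longrightarrow> hemisphere s x = hemisphere r x"
  by (simp add: hemisphere_def)

lemma hemisphere_onto:
  assumes p: "p \<in> sphere (0::real^3) 1" and s: "s = 1 \<or> s = -1" and sp: "s * p$3 \<ge> 0"
  obtains x where "x \<in> cball 0 1" "p = hemisphere s x"
proof -
  define x :: "real^2" where "x = vector [p$1, p$2]"
  have x: "x$1 = p$1" "x$2 = p$2" by (simp_all add: x_def)
  have n: "(p$1)\<^sup>2 + (p$2)\<^sup>2 + (p$3)\<^sup>2 = 1" using norm3[of p] p by simp
  have xx: "(norm x)\<^sup>2 = 1 - (p$3)\<^sup>2" using n x norm2[of x] by simp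
  then have "(norm x)\<^sup>2 \<le> 1\<^sup>2" by simp
  then have "norm x \<le> 1" by (rule power2_le_imp_le) simp
  moreover have "p = hemisphere s x"
  proof -
    have "sqrt (1 - (norm x)\<^sup>2) = \<bar>p$3\<bar>" using xx by simp
    then have "p$3 = s * sqrt (1 - (norm x)\<^sup>2)" using s sp by auto
    then show ?thesis by (simp add: vec_eq_iff forall_3 x)
  qed
  ultimately show ?thesis using that by simp
qed

lemma continuous_hemisphere: "continuous_on S (hemisphere s)"
proof -
  have "hemisphere s = (\<lambda>x. x$1 *\<^sub>R axis 1 1 + x$2 *\<^sub>R axis 2 1 + (s * sqrt (1 - (norm x)\<^sup>2)) *\<^sub>R axis 3 1)"
    by (rule ext) (simp add: vec_eq_iff forall_3 axis_def)
  moreover have "continuous_on S (\<lambda>x::real^2. x$1 *\<^sub>R (axis 1 1 :: real^3) + x$2 *\<^sub>R axis 2 1 + (s * sqrt (1 - (norm x)\<^sup>2)) *\<^sub>R axis 3 1)"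
    by (intro continuous_intros)
  ultimately show ?thesis by simp
qed

lemma Hausdorff_two_sphere: "Hausdorff_space two_sphere"
  by (simp add: Hausdorff_space_subtopology)

lemma disc_chart_hemisphere:
  assumes s: "s = 1 \<or> s = -1" shows "disc_chart two_sphere (hemisphere s)"
proof
  show "Hausdorff_space two_sphere" by (rule Hausdorff_two_sphere)
  show "embedding_map (top_of_set (cball 0 1)) two_sphere (hemisphere s)"
  proof (rule continuous_imp_embedding_map)
    show "continuous_map (top_of_set (cball 0 1)) two_sphere (hemisphere s)"
      using continuous_hemisphere[of "cball 0 1" s] hemisphere_sphere[OF _ s] by auto
    show "compact_space (top_of_set (cball (0::real^2) 1))" by (simp add: compact_space_subtopology)
    show "inj_on (hemisphere s) (topspace (top_of_set (cball 0 1)))"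
      using hemisphere_eqD by (auto intro: inj_onI)
  qed (rule Hausdorff_two_sphere)
qed

abbreviation "up \<equiv> hemisphere 1"
abbreviation "lo \<equiv> hemisphere (-1)"

interpretation up: disc_chart two_sphere up by (rule disc_chart_hemisphere) simp
interpretation lo: disc_chart two_sphere lo by (rule disc_chart_hemisphere) simp

lemma lo_disc: "lo ` cball 0 1 = {p \<in> sphere 0 1. p$3 \<le> 0}"
proof (intro equalityI subsetI)
  fix p assume "p \<in> lo ` cball 0 1"
  then show "p \<in> {p \<in> sphere 0 1. p$3 \<le> 0}" using hemisphere_sphere[of _ "-1"] hemisphere_height(2) by blast
next
  fix p :: "real^3" assume p: "p \<in> {p \<in> sphere 0 1. p$3 \<le> 0}"
  obtain x where "x \<in> cball 0 1" "p = lo x" by (rule hemisphere_onto[of p "-1"]) (use p in simp_all)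
  then show "p \<in> lo ` cball 0 1" by (simp only: imageI)
qed

lemma up_disc: "up ` cball 0 1 = {p \<in> sphere 0 1. p$3 \<ge> 0}"
proof (intro equalityI subsetI)
  fix p assume "p \<in> up ` cball 0 1"
  then show "p \<in> {p \<in> sphere 0 1. p$3 \<ge> 0}" using hemisphere_sphere[of _ 1] hemisphere_height(1) by blast
next
  fix p :: "real^3" assume p: "p \<in> {p \<in> sphere 0 1. p$3 \<ge> 0}"
  obtain x where "x \<in> cball 0 1" "p = up x" by (rule hemisphere_onto[of p 1]) (use p in simp_all)
  then show "p \<in> up ` cball 0 1" by (simp only: imageI)
qed

lemma up_lo_equator: "up ` sphere 0 1 = lo ` sphere 0 1"
  using hemisphere_equator by (intro image_cong) auto

lemma lo_equator: "lo ` sphere 0 1 = {p \<in> sphere 0 1. p$3 = 0}"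
proof (intro equalityI subsetI)
  fix p assume "p \<in> lo ` sphere 0 1"
  then obtain x where x: "x \<in> sphere 0 1" "p = lo x" by blast
  then have "x \<in> cball 0 1" by auto
  then show "p \<in> {p \<in> sphere 0 1. p$3 = 0}" using x hemisphere_sphere[of x "-1"] hemisphere_height(3)[of x "-1"] by blast
next
  fix p :: "real^3" assume p: "p \<in> {p \<in> sphere 0 1. p$3 = 0}"
  obtain x where x: "x \<in> cball 0 1" "p = lo x" by (rule hemisphere_onto[of p "-1"]) (use p in simp_all)
  then have "x \<in> sphere 0 1" using hemisphere_height(3)[of x "-1"] p by simp
  then show "p \<in> lo ` sphere 0 1" using x by blast
qed

lemma open_hemisphere_eq:
  assumes s: "s = 1 \<or> s = -1"
  shows "hemisphere s ` ball 0 1 = hemisphere s ` cball 0 1 - hemisphere s ` sphere 0 1"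
proof -
  have "inj (hemisphere s)" using hemisphere_eqD by (auto intro: injI)
  then have "hemisphere s ` (cball 0 1 - sphere 0 1) = hemisphere s ` cball 0 1 - hemisphere s ` sphere 0 1"
    by (rule image_set_diff)
  moreover have "cball 0 1 - sphere 0 1 = ball (0::real^2) 1" by auto
  ultimately show ?thesis by simp
qed

lemma lo_ball: "lo ` ball 0 1 = {p \<in> sphere 0 1. p$3 < 0}"
  using open_hemisphere_eq[of "-1"] lo_disc lo_equator by auto

lemma up_ball: "up ` ball 0 1 = {p \<in> sphere 0 1. p$3 > 0}"
  using open_hemisphere_eq[of 1] up_disc lo_equator up_lo_equator by auto

lemma openin_lo_ball: "openin two_sphere (lo ` ball 0 1)"
proof -
  have "open {p::real^3. p$3 < 0}" by (intro open_Collect_less continuous_intros)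
  moreover have "lo ` ball 0 1 = sphere 0 1 \<inter> {p. p$3 < 0}" unfolding lo_ball by blast
  ultimately show ?thesis by (auto simp: openin_open)
qed

lemma openin_up_ball: "openin two_sphere (up ` ball 0 1)"
proof -
  have "open {p::real^3. 0 < p$3}" by (intro open_Collect_less continuous_intros)
  moreover have "up ` ball 0 1 = sphere 0 1 \<inter> {p. 0 < p$3}" unfolding up_ball by blast
  ultimately show ?thesis by (auto simp: openin_open)
qed

lemma open_connected_subtopology:
  assumes "openin X C" "connectedin X C" "C \<subseteq> S"
  shows "openin (subtopology X S) C \<and> connectedin (subtopology X S) C"
  using assms by (auto simp: connectedin_subtopology openin_subtopology)

lemma components_minus_equator:
  "connected_components_of (subtopology two_sphere (topspace two_sphere - lo ` sphere 0 1))
    = {lo ` ball 0 1, up ` ball 0 1}"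
proof (rule connected_components_of_partition)
  let ?X = "topspace two_sphere - lo ` sphere 0 1"
  have sub: "lo ` ball 0 1 \<subseteq> ?X" "up ` ball 0 1 \<subseteq> ?X" unfolding lo_ball up_ball lo_equator by auto
  show "\<Union>{lo ` ball 0 1, up ` ball 0 1} = topspace (subtopology two_sphere ?X)"
    unfolding lo_ball up_ball lo_equator by auto
  show "pairwise disjnt {lo ` ball 0 1, up ` ball 0 1}"
    unfolding lo_ball up_ball by (auto simp: pairwise_def disjnt_def)
  fix C assume C: "C \<in> {lo ` ball 0 1, up ` ball 0 1}"
  have "openin two_sphere C" using C openin_lo_ball openin_up_ball by blast
  moreover have "connectedin two_sphere C"
    using C lo.connectedin_image[of "ball 0 1"] up.connectedin_image[of "ball 0 1"] by auto
  moreover have "C \<noteq> {}" using C by auto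
  moreover have "C \<subseteq> ?X" using C sub by blast
  ultimately show "openin (subtopology two_sphere ?X) C \<and> connectedin (subtopology two_sphere ?X) C \<and> C \<noteq> {}"
    using open_connected_subtopology by blast
qed

text \<open>An open set inside the closed upper hemisphere misses the open lower one, hence also the
  closure of the latter, which contains the equator.\<close>

lemma interior_of_up: "two_sphere interior_of (up ` cball 0 1) = up ` ball 0 1"
proof
  show "up ` ball 0 1 \<subseteq> two_sphere interior_of (up ` cball 0 1)"
    by (rule interior_of_maximal[OF _ openin_up_ball]) auto
  let ?O = "two_sphere interior_of (up ` cball 0 1)"
  have "?O \<inter> lo ` ball 0 1 = {}"
    using interior_of_subset[of two_sphere "up ` cball 0 1"] unfolding up_disc lo_ball by fastforce
  then have "?O \<inter> two_sphere closure_of (lo ` ball 0 1) = {}"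
    by (rule iffD2[OF openin_Int_closure_of_eq_empty[OF openin_interior_of]])
  moreover have "two_sphere closure_of (lo ` ball 0 1) = lo ` cball 0 1"
    using lo.closure_of_image[of "ball 0 1"] by auto
  ultimately show "?O \<subseteq> up ` ball 0 1"
    using interior_of_subset[of two_sphere "up ` cball 0 1"] unfolding up_disc up_ball lo_disc by fastforce
qed

lemma frontier_of_up: "two_sphere frontier_of (up ` cball 0 1) = up ` sphere 0 1"
proof -
  have "two_sphere closure_of (up ` cball 0 1) = up ` cball 0 1"
    using up.closure_of_image[of "cball 0 1"] by simp
  moreover have "up ` ball 0 1 = up ` cball 0 1 - up ` sphere 0 1" by (rule open_hemisphere_eq) simp
  moreover have "up ` sphere 0 1 \<subseteq> up ` cball 0 1" by (rule image_mono) auto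
  ultimately show ?thesis
    unfolding frontier_of_def interior_of_up by (simp only: double_diff subset_refl)
qed

section \<open>Starring as a connected sum\<close>

context pierced_face
begin

text \<open>Flattens \<open>F\<close> to the plane disc and bends it down to the lower hemisphere,
  so that the boundary of \<open>F\<close> lands on the equator. Only values on \<open>F\<close> are
  meaningful.\<close>

definition to_sphere :: "'a \<Rightarrow> real^3" where "to_sphere x = lo (k' x)"

text \<open>The boundary of \<open>F\<close> redrawn on the equator. For a triangle the two
  hemispheres share three edges, so this is not yet a triangulation of the sphere; starring the
  lower hemisphere makes it a tetrahedron.\<close>

definition equator :: "(real^3) drawn_graph" where
  "equator = \<lparr>vertices = to_sphere ` W, edges = (\<lambda>e. to_sphere ` e) ` EF\<rparr>"

lemma equator_simps: "vertices equator = to_sphere ` W" "edges equator = (\<lambda>e. to_sphere ` e) ` EF"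
  by (simp_all add: equator_def)

lemma inj_to_sphere: "inj_on to_sphere F"
proof (rule inj_onI)
  fix x y assume "x \<in> F" "y \<in> F" "to_sphere x = to_sphere y"
  then show "x = y" unfolding to_sphere_def using hemisphere_eqD k_k'(1) by metis
qed

lemma to_sphere_image: "to_sphere ` S = lo ` k' ` S" by (simp add: to_sphere_def image_image)

lemma k'_sphere_image: "k' ` k ` sphere 0 1 = sphere 0 1"
  by (simp add: image_image)

lemma to_sphere_sphere: "to_sphere ` k ` sphere 0 1 = lo ` sphere 0 1"
  unfolding to_sphere_image k'_sphere_image ..

lemma to_sphere_Int: "S \<subseteq> F \<Longrightarrow> T \<subseteq> F \<Longrightarrow> to_sphere ` S \<inter> to_sphere ` T = to_sphere ` (S \<inter> T)"
  using inj_on_image_Int[OF inj_to_sphere] by blast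

lemma W_sub: "W \<subseteq> F" using WD(2) by blast

lemma inj_to_sphere_EF: "inj_on (\<lambda>e. to_sphere ` e) EF"
  by (rule inj_onI) (use inj_on_image_eq_iff[OF inj_to_sphere EFD(2) EFD(2)] in blast)

lemma to_sphere_edge_vertices: "e \<in> EF \<Longrightarrow> to_sphere ` e \<inter> to_sphere ` W = to_sphere ` (e \<inter> W)"
  using to_sphere_Int[OF EFD(2) W_sub] .

lemma to_sphere_edge_arc:
  assumes e: "e \<in> EF"
  obtains u v where "u \<in> W" "v \<in> W" "u \<noteq> v" "e \<inter> vertices \<Gamma> = {u,v}" "e \<inter> W = {u,v}"
    "arc_joining two_sphere (to_sphere u) (to_sphere v) (to_sphere ` e)"
proof -
  obtain q u v where q: "arc q" "path_image q = k' ` e" "q 0 = k' u" "q 1 = k' v"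
    "u \<in> W" "v \<in> W" "u \<noteq> v" "e \<inter> vertices \<Gamma> = {u,v}"
    using edge_arc[OF e] by metis
  have "path_image q \<subseteq> cball 0 1" using q(2) edge_F(2)[OF e] by auto
  from lo.arc_joining_image[OF q(1) this]
  have "arc_joining two_sphere (to_sphere u) (to_sphere v) (to_sphere ` e)" unfolding q(2-4) to_sphere_image to_sphere_def .
  moreover have "e \<inter> W = {u,v}" using q(5,6,8) by (auto simp: W_def)
  ultimately show ?thesis using that q by blast
qed

lemma embedded_equator: "embedded_simple_graph two_sphere equator"
  unfolding embedded_simple_graph_def equator_simps
proof (intro conjI ballI impI)
  show "finite (to_sphere ` W)" "finite ((\<lambda>e. to_sphere ` e) ` EF)" using finite_EF by auto
  show "to_sphere ` W \<subseteq> topspace two_sphere"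
    using hemisphere_sphere[of _ "-1"] W_sub k_k'(2) unfolding to_sphere_def by force
next
  fix f assume "f \<in> (\<lambda>e. to_sphere ` e) ` EF"
  then obtain e where e: "e \<in> EF" "f = to_sphere ` e" by blast
  obtain u v where uv: "u \<in> W" "v \<in> W" "e \<inter> W = {u,v}" "arc_joining two_sphere (to_sphere u) (to_sphere v) (to_sphere ` e)"
    using to_sphere_edge_arc[OF e(1)] by metis
  then show "\<exists>u\<in>to_sphere ` W. \<exists>v\<in>to_sphere ` W. arc_joining two_sphere u v f \<and> f \<inter> to_sphere ` W = {u, v}"
    unfolding e(2) to_sphere_edge_vertices[OF e(1)] by (intro bexI[of _ "to_sphere u"] bexI[of _ "to_sphere v"]) simp_all
next
  fix f g assume "f \<in> (\<lambda>e. to_sphere ` e) ` EF" "g \<in> (\<lambda>e. to_sphere ` e) ` EF" and fg: "f \<noteq> g"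
  then obtain d e where d: "d \<in> EF" "f = to_sphere ` d" and e: "e \<in> EF" "g = to_sphere ` e" by blast
  have "d \<noteq> e" using fg d e by blast
  have eq: "f \<inter> g = to_sphere ` (d \<inter> e)" unfolding d e by (rule to_sphere_Int[OF EFD(2)[OF d(1)] EFD(2)[OF e(1)]])
  consider "d \<inter> e = {}" | v where "v \<in> vertices \<Gamma>" "d \<inter> e = {v}"
    using edges_Int[OF graph EFD(1)[OF d(1)] EFD(1)[OF e(1)] \<open>d \<noteq> e\<close>] by blast
  then show "f \<inter> g = {} \<or> (\<exists>v\<in>to_sphere ` W. f \<inter> g = {v})"
  proof cases
    case 1
    then show ?thesis unfolding eq by simp
  next
    case 2
    have "v \<in> d" using 2 by blast
    then have "v \<in> W" using 2(1) EFD(2)[OF d(1)] by (auto simp: W_def)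
    then show ?thesis unfolding eq 2(2) by simp
  qed
qed

lemma skeleton_equator: "skeleton equator = lo ` sphere 0 1"
proof -
  have "\<Union>(edges equator) = to_sphere ` \<Union>EF" unfolding equator_simps by blast
  then have "\<Union>(edges equator) = lo ` sphere 0 1" unfolding boundary_EF[symmetric] to_sphere_sphere .
  moreover have "to_sphere ` W \<subseteq> lo ` sphere 0 1"
  proof -
    have "W \<subseteq> k ` sphere 0 1" using W_F(1) by blast
    then have "to_sphere ` W \<subseteq> to_sphere ` k ` sphere 0 1" by (rule image_mono)
    then show ?thesis unfolding to_sphere_sphere .
  qed
  ultimately show ?thesis unfolding skeleton_def equator_simps(1) by (simp add: Un_absorb1)
qed

lemma comps_equator: "connected_components_of (subtopology two_sphere (topspace two_sphere - skeleton equator))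
    = {lo ` ball 0 1, up ` ball 0 1}"
  unfolding skeleton_equator by (rule components_minus_equator)

lemma faces_equator: "faces two_sphere equator = {lo ` cball 0 1, up ` cball 0 1}"
proof -
  have "two_sphere closure_of (lo ` ball 0 1) = lo ` cball 0 1"
    "two_sphere closure_of (up ` ball 0 1) = up ` cball 0 1"
    using lo.closure_of_image[of "ball 0 1"] up.closure_of_image[of "ball 0 1"] by auto
  then show ?thesis unfolding faces_def comps_equator by simp
qed

lemma lo_neq_up: "lo ` cball 0 1 \<noteq> up ` cball 0 1"
proof
  assume "lo ` cball 0 1 = up ` cball 0 1"
  moreover have "up ` ball 0 1 \<subseteq> up ` cball 0 1" by (rule image_mono) auto
  moreover have "up 0 \<in> up ` ball 0 1" by simp
  ultimately have "up 0 \<in> lo ` cball 0 1" by blast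
  then show False unfolding lo_disc by simp
qed

lemma edge_equator_subset:
  assumes "e \<in> edges equator" shows "e \<subseteq> lo ` cball 0 1" "e \<subseteq> up ` cball 0 1" "e \<subseteq> lo ` sphere 0 1"
proof -
  have "e \<subseteq> skeleton equator" using assms by (auto simp: skeleton_def)
  then show *: "e \<subseteq> lo ` sphere 0 1" unfolding skeleton_equator .
  have "sphere 0 1 \<subseteq> cball (0::real^2) 1" by auto
  then have "lo ` sphere 0 1 \<subseteq> lo ` cball 0 1" "up ` sphere 0 1 \<subseteq> up ` cball 0 1"
    by (simp_all only: image_mono)
  then show "e \<subseteq> lo ` cball 0 1" "e \<subseteq> up ` cball 0 1" using * up_lo_equator by simp_all
qed

lemma pierced_equator: "pierced_face two_sphere lo equator"
proof
  show "embedded_simple_graph two_sphere equator" by (rule embedded_equator)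
  show "lo ` ball 0 1 \<in> connected_components_of (subtopology two_sphere (topspace two_sphere - skeleton equator))"
    unfolding comps_equator by simp
  show "openin two_sphere C"
    if "C \<in> connected_components_of (subtopology two_sphere (topspace two_sphere - skeleton equator))" for C
    using that openin_lo_ball openin_up_ball unfolding comps_equator by blast
  have all: "{e\<in>edges equator. e \<subseteq> lo ` cball 0 1} = edges equator" using edge_equator_subset(1) by blast
  show "lo ` sphere 0 1 = \<Union>{e\<in>edges equator. e \<subseteq> lo ` cball 0 1}"
    unfolding all using skeleton_equator boundary_EF to_sphere_sphere unfolding equator_simps by (metis image_Union)
  show "card {e\<in>edges equator. e \<subseteq> lo ` cball 0 1 \<and> v \<in> e} = 2" if v: "v \<in> vertices equator" for v
  proof -
    obtain w where w: "w \<in> W" "v = to_sphere w" using v unfolding equator_simps by blast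
    have mem: "to_sphere w \<in> to_sphere ` e \<longleftrightarrow> w \<in> e" if "e \<in> EF" for e
      by (rule inj_on_image_mem_iff[OF inj_to_sphere WD(2)[OF w(1)] EFD(2)[OF that]])
    have "{e\<in>edges equator. e \<subseteq> lo ` cball 0 1 \<and> v \<in> e} = {e\<in>edges equator. v \<in> e}"
      using edge_equator_subset(1) by blast
    also have "\<dots> = (\<lambda>e. to_sphere ` e) ` {e\<in>EF. w \<in> e}" unfolding equator_simps w(2) using mem by blast
    also have "card \<dots> = card {e\<in>EF. w \<in> e}"
      by (intro card_image inj_on_subset[OF inj_to_sphere_EF]) blast
    also have "{e\<in>EF. w \<in> e} = {e\<in>edges \<Gamma>. e \<subseteq> F \<and> w \<in> e}" by (auto simp: EF_def)
    finally show ?thesis using degree[OF WD[OF w(1)]] by simp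
  qed
qed

section \<open>The tetrahedron on the sphere and the gluing map\<close>

context
  assumes M: "closed_surface M" and tri: "surface_triangulation M \<Gamma>"
begin

lemma connected_equator: "connected_graph two_sphere equator"
  unfolding connected_graph_def
proof (intro ballI)
  interpret T: triangulated_surface M \<Gamma> using M tri by unfold_locales
  fix p q assume "p \<in> vertices equator" "q \<in> vertices equator"
  then obtain u v where u: "u \<in> W" "p = to_sphere u" and v: "v \<in> W" "q = to_sphere v" unfolding equator_simps by blast
  show "(joined two_sphere equator)\<^sup>*\<^sup>* p q"
  proof (cases "u = v")
    case False
    have "u \<in> vertices \<Gamma> \<inter> F" "v \<in> vertices \<Gamma> \<inter> F" using u v by (simp_all add: W_def)
    then obtain e where e: "e \<in> edges \<Gamma>" "e \<subseteq> F" "e \<inter> vertices \<Gamma> = {u,v}"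
      using T.edge_exists[OF F_face] False by metis
    then have eF: "e \<in> EF" by (simp add: EF_def)
    obtain a b where ab: "e \<inter> vertices \<Gamma> = {a,b}" "arc_joining two_sphere (to_sphere a) (to_sphere b) (to_sphere ` e)"
      using to_sphere_edge_arc[OF eF] by metis
    have "joined two_sphere equator (to_sphere a) (to_sphere b)" using ab(2) eF unfolding joined_def equator_simps by blast
    then have j: "(joined two_sphere equator)\<^sup>*\<^sup>* (to_sphere a) (to_sphere b)" by blast
    have "a = u \<and> b = v \<or> a = v \<and> b = u" using ab(1) e(3) by (metis doubleton_eq_iff)
    then show ?thesis using j joined_rtranclp_sym[OF Hausdorff_two_sphere j] u(2) v(2) by metis
  qed (use u v in simp)
qed

interpretation Q: pierced_face two_sphere lo equator by (rule pierced_equator)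

text \<open>The only face besides the starred one is the upper hemisphere. It contains all equator
  edges, so it meets each of them in the edge itself, and there are no two distinct other faces to
  compare.\<close>

lemma sphere_star: "surface_triangulation two_sphere Q.star"
proof (rule Q.star_triangulation[OF connected_equator])
  interpret T: triangulated_surface M \<Gamma> using M tri by unfold_locales
  have other: "G = up ` cball 0 1" if "G \<in> faces two_sphere equator - {lo ` cball 0 1}" for G
    using that unfolding faces_equator by blast
  show "\<forall>e\<in>edges equator. card {G\<in>faces two_sphere equator. e \<subseteq> G} = 2"
  proof
    fix e assume "e \<in> edges equator"
    then have "{G\<in>faces two_sphere equator. e \<subseteq> G} = {lo ` cball 0 1, up ` cball 0 1}"
      unfolding faces_equator using edge_equator_subset by blast
    then show "card {G\<in>faces two_sphere equator. e \<subseteq> G} = 2" using lo_neq_up by simp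
  qed
  fix G assume "G \<in> faces two_sphere equator - {lo ` cball 0 1}"
  then have G: "G = up ` cball 0 1" by (rule other)
  show "subtopology two_sphere G homeomorphic_space top_of_set (cball (0::real^2) 1)"
    unfolding G by (rule up.homeomorphic_image[OF _ homeomorphic_refl]) simp
  have "{e\<in>edges equator. e \<subseteq> G} = edges equator" unfolding G using edge_equator_subset(2) by blast
  moreover have "card (edges equator) = card EF" unfolding equator_simps by (rule card_image[OF inj_to_sphere_EF])
  moreover have "card EF = 3" using T.three_edges[OF F_face] by (simp add: EF_def)
  ultimately show "card {e\<in>edges equator. e \<subseteq> G} = 3" by simp
  show "Q.meets_nicely (G \<inter> e)" if "e \<in> Q.EF" for e
  proof -
    have e: "e \<in> edges equator" using Q.EFD(1)[OF that] .
    then have "G \<inter> e = e" unfolding G using edge_equator_subset(2) by blast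
    then show ?thesis unfolding Q.meets_nicely_def using e by simp
  qed
  show "Q.meets_nicely (G \<inter> H)" if "H \<in> faces two_sphere equator - {lo ` cball 0 1}" "G \<noteq> H" for H
    using other[OF that(1)] that(2) G by simp
qed

lemma interior_of_F: "M interior_of F = C0"
proof
  show "M interior_of F \<subseteq> C0"
    by (rule open_subset_disc[OF M openin_interior_of interior_of_subset])
  show "C0 \<subseteq> M interior_of F" by (rule interior_of_maximal[OF _ open_C0]) auto
qed

lemma frontier_of_F: "M frontier_of F = k ` sphere 0 1"
proof -
  have "M closure_of F = F" using closure_of_image[of "cball 0 1"] by simp
  moreover have "F - C0 = k ` sphere 0 1" using F_split by blast
  ultimately show ?thesis by (simp only: frontier_of_def interior_of_F)
qed

lemma to_sphere_special: "special_homeomorphism M \<Gamma> F two_sphere Q.star (up ` cball 0 1) to_sphere"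
  unfolding special_homeomorphism_def frontier_of_F frontier_of_up
proof
  have kF: "k ` sphere 0 1 \<subseteq> F" by (rule image_mono) auto
  have top1: "topspace (subtopology M (k ` sphere 0 1)) = k ` sphere 0 1"
    using kF image_topspace by auto
  have top2: "topspace (subtopology two_sphere (up ` sphere 0 1)) = lo ` sphere 0 1"
    unfolding up_lo_equator lo_equator by auto
  show "homeomorphic_map (subtopology M (k ` sphere 0 1)) (subtopology two_sphere (up ` sphere 0 1)) to_sphere"
  proof (rule continuous_imp_homeomorphic_map)
    have "continuous_map (subtopology M (k ` sphere 0 1)) (top_of_set (cball 0 1)) k'"
      using continuous_map_from_subtopology_mono[OF cont' kF] .
    then have "continuous_map (subtopology M (k ` sphere 0 1)) two_sphere (lo \<circ> k')"
      using lo.cont continuous_map_compose by blast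
    then have "continuous_map (subtopology M (k ` sphere 0 1)) two_sphere to_sphere"
      by (rule continuous_map_eq) (simp add: to_sphere_def)
    then show "continuous_map (subtopology M (k ` sphere 0 1)) (subtopology two_sphere (up ` sphere 0 1)) to_sphere"
      unfolding continuous_map_in_subtopology top1 using to_sphere_sphere up_lo_equator by auto
    have "compactin M (k ` sphere 0 1)" by (rule compactin_image) auto
    then show "compact_space (subtopology M (k ` sphere 0 1))" by (simp add: compact_space_subtopology)
    show "Hausdorff_space (subtopology two_sphere (up ` sphere 0 1))"
      by (rule Hausdorff_space_subtopology[OF Hausdorff_two_sphere])
    show "to_sphere ` topspace (subtopology M (k ` sphere 0 1)) = topspace (subtopology two_sphere (up ` sphere 0 1))"
      unfolding top1 top2 to_sphere_sphere ..
    show "inj_on to_sphere (topspace (subtopology M (k ` sphere 0 1)))"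
      unfolding top1 by (rule inj_on_subset[OF inj_to_sphere kF])
  qed
  \<comment> \<open>The new vertex is the south pole, outside the removed upper hemisphere; the
    vertices of that face are exactly those on the equator.\<close>
  have "lo 0 \<notin> up ` cball 0 1" unfolding up_disc by simp
  moreover have "to_sphere ` W \<subseteq> up ` cball 0 1"
  proof -
    have "to_sphere ` W \<subseteq> lo ` sphere 0 1" using skeleton_equator by (auto simp: skeleton_def equator_simps)
    moreover have "up ` sphere 0 1 \<subseteq> up ` cball 0 1" by (rule image_mono) auto
    ultimately show ?thesis unfolding up_lo_equator by blast
  qed
  ultimately show "to_sphere ` (vertices \<Gamma> \<inter> F) = vertices Q.star \<inter> up ` cball 0 1"
    unfolding Q.star_simps equator_simps W_def[symmetric] by auto
qed

text \<open>The part of \<open>M\<close> outside \<open>C0\<close> stays in place, and the starred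
  lower hemisphere is put back onto \<open>F\<close> by undoing \<open>to_sphere\<close>. Both stars
  are coned from the centre of the same plane disc, so spokes go to spokes.\<close>

lemma star_connected_sum:
  "is_connected_sum M \<Gamma> F two_sphere Q.star (up ` cball 0 1) to_sphere M star"
proof -
  define \<psi> where "\<psi> = k \<circ> lo.k'"
  have \<psi>_lo: "\<psi> (lo x) = k x" if "x \<in> cball 0 1" for x using that by (simp add: \<psi>_def)
  have \<psi>_lo_image: "\<psi> ` lo ` S = k ` S" if "S \<subseteq> cball 0 1" for S
    unfolding image_image using \<psi>_lo that by (intro image_cong) auto
  have \<psi>_m: "\<psi> (to_sphere x) = x" if "x \<in> F" for x unfolding to_sphere_def using \<psi>_lo k_k' that by simp
  have \<psi>_m_image: "\<psi> ` to_sphere ` S = S" if "S \<subseteq> F" for S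
  proof -
    have "\<psi> ` to_sphere ` S = (\<lambda>x. x) ` S" unfolding image_image using \<psi>_m that by (intro image_cong) auto
    then show ?thesis by simp
  qed
  have lower: "topspace two_sphere - up ` ball 0 1 = lo ` cball 0 1" unfolding up_ball lo_disc by auto
  have upper: "topspace M - C0 \<subseteq> topspace M" by blast
  show ?thesis
    unfolding is_connected_sum_def interior_of_F interior_of_up frontier_of_F lower
  proof (intro exI[of _ id] exI[of _ \<psi>] conjI ballI)
    show "embedding_map (subtopology M (topspace M - C0)) M id"
      unfolding embedding_map_def by (simp add: Int_absorb1 homeomorphic_map_id)
    show "embedding_map (subtopology two_sphere (lo ` cball 0 1)) M \<psi>"
    proof (rule continuous_imp_embedding_map[OF _ _ Haus])
      show "continuous_map (subtopology two_sphere (lo ` cball 0 1)) M \<psi>"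
        unfolding \<psi>_def using continuous_map_compose[OF lo.cont' cont] .
      have "compactin two_sphere (lo ` cball 0 1)" by (rule lo.compactin_image) auto
      then show "compact_space (subtopology two_sphere (lo ` cball 0 1))"
        using compact_space_subtopology by blast
      have "topspace (subtopology two_sphere (lo ` cball 0 1)) = lo ` cball 0 1"
        using lo.image_topspace by auto
      moreover have "inj_on \<psi> (lo ` cball 0 1)"
      proof (rule inj_onI)
        fix x y assume x: "x \<in> lo ` cball 0 1" and y: "y \<in> lo ` cball 0 1" and xy: "\<psi> x = \<psi> y"
        obtain a where a: "a \<in> cball 0 1" "x = lo a" using x by blast
        obtain b where b: "b \<in> cball 0 1" "y = lo b" using y by blast
        have "k a = k b" using xy \<psi>_lo[OF a(1)] \<psi>_lo[OF b(1)] a(2) b(2) by simp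
        then show "x = y" using inj_onD[OF inj _ a(1) b(1)] a(2) b(2) by simp
      qed
      ultimately show "inj_on \<psi> (topspace (subtopology two_sphere (lo ` cball 0 1)))" by metis
    qed
    have F_top: "F \<subseteq> topspace M" by (rule image_topspace)
    have im: "\<psi> ` lo ` cball 0 1 = F" by (rule \<psi>_lo_image) simp
    have C0F: "C0 \<subseteq> F" using F_split(1) by blast
    show "id ` (topspace M - C0) \<union> \<psi> ` lo ` cball 0 1 = topspace M"
    proof -
      have "A - C \<union> B = A" if "B \<subseteq> A" "C \<subseteq> B" for A B C :: "'a set" using that by blast
      from this[OF F_top C0F] show ?thesis unfolding im image_id id_apply .
    qed
    show "id ` (topspace M - C0) \<inter> \<psi> ` lo ` cball 0 1 = id ` k ` sphere 0 1"
    proof -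
      have "(A - C) \<inter> B = S" if "B \<subseteq> A" "B = C \<union> S" "C \<inter> S = {}" for A B C S :: "'a set"
        using that by blast
      from this[OF F_top F_split] show ?thesis unfolding im image_id id_apply .
    qed
    show "id x = \<psi> (to_sphere x)" if "x \<in> k ` sphere 0 1" for x
      using \<psi>_m[of x] that F_split(1) by auto
    have p0: "\<psi> (lo 0) = k 0" by (rule \<psi>_lo) simp
    show "vertices star = id ` vertices \<Gamma> \<union> \<psi> ` vertices Q.star"
      unfolding star_simps Q.star_simps equator_simps image_insert \<psi>_m_image[OF W_sub] p0 using WD(1) by auto
    have QW: "Q.W = to_sphere ` W" 
    proof -
      have "to_sphere ` W \<subseteq> lo ` cball 0 1"
        using W_sub k_k'(2) unfolding to_sphere_def by blast
      then show ?thesis unfolding Q.W_def equator_simps by blast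
    qed
    have sp: "\<psi> ` Q.spoke (to_sphere w) = spoke w" if w: "w \<in> W" for w
    proof -
      have "lo.k' (to_sphere w) = k' w" unfolding to_sphere_def using k_k'(2)[OF WD(2)[OF w]] by simp
      then show ?thesis unfolding Q.spoke_def spoke_def using \<psi>_lo_image[OF cone_W[OF w]] by simp
    qed
    have "(\<lambda>e. \<psi> ` e) ` edges Q.star = (\<lambda>e. \<psi> ` to_sphere ` e) ` EF \<union> (\<lambda>w. \<psi> ` Q.spoke (to_sphere w)) ` W"
      unfolding Q.star_simps equator_simps QW by (simp add: image_Un image_image)
    also have "(\<lambda>e. \<psi> ` to_sphere ` e) ` EF = EF" using \<psi>_m_image EFD(2) by (simp cong: image_cong)
    also have "(\<lambda>w. \<psi> ` Q.spoke (to_sphere w)) ` W = spoke ` W" using sp by (rule image_cong[OF refl])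
    finally show "edges star = (\<lambda>e. id ` e) ` edges \<Gamma> \<union> (\<lambda>e. \<psi> ` e) ` edges Q.star"
      unfolding star_simps image_id using EFD(1) by auto
  qed
qed

theorem sphere_sum_star: "sphere_sum_step M \<Gamma> star"
proof -
  have "up ` cball 0 1 \<in> faces two_sphere Q.star"
    unfolding Q.faces_star faces_equator using lo_neq_up by blast
  then show ?thesis
    unfolding sphere_sum_step_def using sphere_star F_face to_sphere_special star_connected_sum by blast
qed

end

end

theorem theorem1:
  fixes M :: "'a topology" and \<Gamma> :: "'a drawn_graph"
  assumes "closed_surface M" and "surface_triangulation M \<Gamma>"
  shows "\<exists>\<Gamma>'. shredding M \<Gamma>' \<Gamma> \<and> z_knotted M \<Gamma>'"
proof -
  note M = assms(1)
  \<comment> \<open>Classes of flags under shift and reversal, that is, zigzags counted up to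
    reversal.\<close>
  define N where "N = (\<lambda>\<Delta>. card (flags (complex_of M \<Delta>) // zrel (complex_of M \<Delta>)))"
  have fresh: "k 0 \<notin> \<Union>(complex_of M \<Delta>)" if "pierced_face M k \<Delta>" for k \<Delta>
    using pierced_face.k0(3)[OF that] by (auto simp: complex_of_def)
  have insert: "\<exists>\<Theta> x. sphere_sum_step M \<Delta> \<Theta> \<and> surface_triangulation M \<Theta> \<and>
      complex_of M \<Theta> = insert_vertex (complex_of M \<Delta>) t x \<and> x \<notin> \<Union>(complex_of M \<Delta>) \<and> x \<in> vertices \<Theta>
      \<and> vertices \<Theta> = insert x (vertices \<Delta>) \<and> x \<notin> vertices \<Delta>"
    if \<Delta>: "surface_triangulation M \<Delta>" and t: "t \<in> complex_of M \<Delta>" for \<Delta> t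
  proof -
    interpret T: triangulated_surface M \<Delta> using M \<Delta> by unfold_locales
    obtain G where G: "G \<in> faces M \<Delta>" "t = vertices \<Delta> \<inter> G" using t by (auto simp: complex_of_def)
    obtain k where k: "pierced_face M k \<Delta>" "G = k ` cball 0 1" using T.ex_pierced_face[OF G(1)] .
    interpret P: pierced_face M k \<Delta> by (rule k(1))
    have "complex_of M P.star = insert_vertex (complex_of M \<Delta>) t (k 0)"
      unfolding G(2) k(2) by (rule P.complex_of_star[OF M \<Delta>])
    then show ?thesis
      using P.sphere_sum_star[OF M \<Delta>] P.star_surface_triangulation[OF M \<Delta>] fresh[OF k(1)] P.k0(3)
      by (intro exI[of _ P.star] exI[of _ "k 0"]) (simp add: P.star_simps)
  qed
  \<comment> \<open>Zero spheres are allowed here, so that the induction can stop as soon as all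
    flags are related.\<close>
  have reach: "\<exists>\<Theta>. (sphere_sum_step M)\<^sup>*\<^sup>* \<Delta> \<Theta> \<and> surface_triangulation M \<Theta> \<and> z_knotted M \<Theta>"
    if "surface_triangulation M \<Delta>" for \<Delta>
    using that
  proof (induction "N \<Delta>" arbitrary: \<Delta> rule: less_induct)
    case less
    interpret T: triangulated_surface M \<Delta> using M less.prems by unfold_locales
    show ?case
    proof (cases "\<forall>f\<in>flags T.T. \<forall>g\<in>flags T.T. (f,g) \<in> zrel T.T")
      case True
      then show ?thesis using T.z_knotted_if_all_related less.prems by blast
    next
      case False
      then obtain f g where fg: "f \<in> flags T.T" "g \<in> flags T.T" "(f,g) \<notin> zrel T.T" by blast
      obtain a b c where abc: "{a,b,c} \<in> T.T" "a \<noteq> b" "b \<noteq> c" "a \<noteq> c" and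
        red: "(\<forall>x T'. x \<notin> \<Union>T.T \<longrightarrow> T' = insert_vertex T.T {a,b,c} x \<longrightarrow> closed_complex T' \<longrightarrow>
             card (flags T' // zrel T') < card (flags T.T // zrel T.T)) \<or>
           (\<forall>x y T'. x \<notin> \<Union>T.T \<longrightarrow> y \<notin> \<Union>T.T \<longrightarrow> y \<noteq> x \<longrightarrow>
             T' = insert_vertex (insert_vertex T.T {a,b,c} x) {x,a,b} y \<longrightarrow> closed_complex T' \<longrightarrow>
             card (flags T' // zrel T') < card (flags T.T // zrel T.T))"
        using exists_reducing_insertion[OF T.closed_complex T.strongly_connected fg] by metis
      obtain \<Theta> x where \<Theta>: "sphere_sum_step M \<Delta> \<Theta>" "surface_triangulation M \<Theta>"
        "complex_of M \<Theta> = insert_vertex T.T {a,b,c} x" "x \<notin> \<Union>T.T"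
        "vertices \<Theta> = insert x (vertices \<Delta>)" "x \<notin> vertices \<Delta>"
        using insert[OF less.prems abc(1)] by blast
      interpret T1: triangulated_surface M \<Theta> using M \<Theta>(2) by unfold_locales
      \<comment> \<open>Both insertions are carried out in any case; the count has dropped after the
        first or after the second.\<close>
      have "{x,a,b} \<in> complex_of M \<Theta>" unfolding \<Theta>(3) insert_vertex_triangle[OF abc(2-4)] by simp
      then obtain \<Xi> y where \<Xi>: "sphere_sum_step M \<Theta> \<Xi>" "surface_triangulation M \<Xi>"
        "complex_of M \<Xi> = insert_vertex (complex_of M \<Theta>) {x,a,b} y" "y \<notin> vertices \<Theta>"
        using insert[OF \<Theta>(2)] by blast
      interpret T2: triangulated_surface M \<Xi> using M \<Xi>(2) by unfold_locales
      have "\<Union>T.T \<subseteq> vertices \<Theta>" using \<Theta>(5) by (auto simp: complex_of_def)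
      then have y: "y \<notin> \<Union>T.T" "y \<noteq> x" using \<Xi>(4) \<Theta>(5) by auto
      have "N \<Theta> < N \<Delta> \<or> N \<Xi> < N \<Delta>"
        unfolding N_def using red \<Theta>(3,4) y \<Xi>(3) T1.closed_complex T2.closed_complex by metis
      then show ?thesis
      proof
        assume "N \<Theta> < N \<Delta>"
        then obtain \<Lambda> where "(sphere_sum_step M)\<^sup>*\<^sup>* \<Theta> \<Lambda>" "surface_triangulation M \<Lambda>" "z_knotted M \<Lambda>"
          using less.hyps \<Theta>(2) by blast
        then show ?thesis using \<Theta>(1) by (meson converse_rtranclp_into_rtranclp)
      next
        assume "N \<Xi> < N \<Delta>"
        then obtain \<Lambda> where "(sphere_sum_step M)\<^sup>*\<^sup>* \<Xi> \<Lambda>" "surface_triangulation M \<Lambda>" "z_knotted M \<Lambda>"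
          using less.hyps \<Xi>(2) by blast
        then show ?thesis using \<Theta>(1) \<Xi>(1) by (meson converse_rtranclp_into_rtranclp)
      qed
    qed
  qed
  \<comment> \<open>\<open>shredding\<close> demands at least one sphere, so an arbitrary face is
    starred before \<open>reach\<close> is applied.\<close>
  interpret T: triangulated_surface M \<Gamma> using assms by unfold_locales
  obtain f where f: "f \<in> flags T.T" using T.flags_nonempty by blast
  obtain a b c where "f = (a,b,c)" using prod_cases3 by blast
  then have "{a,b,c} \<in> T.T" using f by simp
  then obtain \<Theta> where \<Theta>: "sphere_sum_step M \<Gamma> \<Theta>" "surface_triangulation M \<Theta>"
    using insert[OF assms(2)] by blast
  obtain \<Lambda> where \<Lambda>: "(sphere_sum_step M)\<^sup>*\<^sup>* \<Theta> \<Lambda>" "surface_triangulation M \<Lambda>" "z_knotted M \<Lambda>"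
    using reach[OF \<Theta>(2)] by blast
  have "(sphere_sum_step M)\<^sup>+\<^sup>+ \<Gamma> \<Lambda>" using \<Theta>(1) \<Lambda>(1) by (rule rtranclp_into_tranclp2)
  then show ?thesis unfolding shredding_def using assms(2) \<Lambda> by blast
qed

end
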